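(* Let $L$ be a countable language and let $\mathcal{M}$ be a countably infinite $L$-structure with underlying set $\mathbb{N}$. Then exactly one of the following holds: (0) $\mathcal{M}$ has nontrivial definable closure, in which case there is no $S_\infty$-invariant Borel probability measure on $\mathrm{Str}_L$ that is concentrated on the orbit of $\mathcal{M}$; (1) $\mathcal{M}$ is highly homogeneous, in which case there is a unique $S_\infty$-invariant Borel probability measure on $\mathrm{Str}_L$ that is concentrated on the orbit of $\mathcal{M}$; ($2^{\aleph_0}$) there are continuum-many ergodic $S_\infty$-invariant Borel probability measures on $\mathrm{Str}_L$ that are concentrated on the orbit of $\mathcal{M}$.
   Context: $\mathrm{Str}_L$ is the space of $L$-structures with underlying set $\mathbb{N}$, with the Borel $\sigma$-algebra of the topology whose basic open sets are $[\![\varphi(n_0,\dots,n_{j-1})]\!]=\{\mathcal{N}\in\mathrm{Str}_L : \mathcal{N}\models\varphi(n_0,\dots,n_{j-1})\}$ for $\varphi\in\mathcal{L}_{\omega_1,\omega}(L)$ and $n_i\in\mathbb{N}$. $S_\infty$ (the group of permutations of $\mathbb{N}$) acts on $\mathrm{Str}_L$ by the logic action: $g\cdot\mathcal{M}=\mathcal{N}$ iff $R^{\mathcal{N}}(s_0,\dots,s_{k-1})\leftrightarrow R^{\mathcal{M}}(g^{-1}(s_0),\dots,g^{-1}(s_{k-1}))$ for all relation symbols (and similarly for constants and functions); orbits are isomorphism classes. A measure $\mu$ is ergodic if every Borel $B$ with $\mu(B\triangle g^{-1}B)=0$ for all $g\in S_\infty$ has $\mu(B)\in\{0,1\}$. The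 definable closure $\mathrm{dcl}_{\mathcal{M}}(\mathbf{a})$ of a finite tuple $\mathbf{a}$ is the set of elements fixed by every automorphism of $\mathcal{M}$ fixing $\mathbf{a}$ pointwise; $\mathcal{M}$ has trivial definable closure if $\mathrm{dcl}_{\mathcal{M}}(\mathbf{a})=\mathbf{a}$ for every finite tuple $\mathbf{a}$. $\mathcal{M}$ is highly homogeneous if for each $k$ and every pair of $k$-element subsets $X,Y$ of $\mathcal{M}$ there is $f\in\mathrm{Aut}(\mathcal{M})$ with $f[X]=Y$. *)

theory Defs
  imports "HOL-Probability.Probability" "HOL-Library.Equipollence"
begin

section \<open>Languages and structures with underlying set the natural numbers\<close>

text \<open>Constant symbols are function symbols of arity 0. The symbols form carrier sets, so that
  languages without relation symbols or without function symbols are covered.\<close>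

record ('r, 'f) language =
  Rels :: "'r set"
  rel_ar :: "'r \<Rightarrow> nat"
  Funs :: "'f set"
  fun_ar :: "'f \<Rightarrow> nat"

definition countable_language :: "('r, 'f) language \<Rightarrow> bool" where
  "countable_language L \<longleftrightarrow> countable (Rels L) \<and> countable (Funs L)"

record ('r, 'f) struct =
  rel_int :: "'r \<Rightarrow> nat list set"
  fun_int :: "'f \<Rightarrow> nat list \<Rightarrow> nat"

text \<open>Outside the symbols of the language and outside tuples of the right length, the
  interpretations get a default value, so that distinct elements of \<open>Str L\<close> are distinct
  \<open>L\<close>-structures.\<close>

definition Str :: "('r, 'f) language \<Rightarrow> ('r, 'f) struct set" where
  "Str L = {M.
     (\<forall>r\<in>Rels L. \<forall>s\<in>rel_int M r. length s = rel_ar L r) \<and>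
     (\<forall>r. r \<notin> Rels L \<longrightarrow> rel_int M r = {}) \<and>
     (\<forall>f s. \<not> (f \<in> Funs L \<and> length s = fun_ar L f) \<longrightarrow> fun_int M f s = undefined)}"

definition act :: "('r, 'f) language \<Rightarrow> (nat \<Rightarrow> nat) \<Rightarrow> ('r, 'f) struct \<Rightarrow> ('r, 'f) struct" where
  "act L g M =
     \<lparr> rel_int = (\<lambda>r. {s. map (inv g) s \<in> rel_int M r}),
       fun_int = (\<lambda>f s. if f \<in> Funs L \<and> length s = fun_ar L f
                        then g (fun_int M f (map (inv g) s)) else undefined) \<rparr>"

definition orbit :: "('r, 'f) language \<Rightarrow> ('r, 'f) struct \<Rightarrow> ('r, 'f) struct set" where
  "orbit L M = {act L g M | g. bij g}"

definition Aut :: "('r, 'f) language \<Rightarrow> ('r, 'f) struct \<Rightarrow> (nat \<Rightarrow> nat) set" where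
  "Aut L M = {g. bij g \<and>
     (\<forall>r\<in>Rels L. \<forall>s. length s = rel_ar L r \<longrightarrow> (map g s \<in> rel_int M r \<longleftrightarrow> s \<in> rel_int M r)) \<and>
     (\<forall>f\<in>Funs L. \<forall>s. length s = fun_ar L f \<longrightarrow> fun_int M f (map g s) = g (fun_int M f s))}"

definition dcl :: "('r, 'f) language \<Rightarrow> ('r, 'f) struct \<Rightarrow> nat list \<Rightarrow> nat set" where
  "dcl L M a = {b. \<forall>g\<in>Aut L M. (\<forall>x\<in>set a. g x = x) \<longrightarrow> g b = b}"

definition trivial_dcl :: "('r, 'f) language \<Rightarrow> ('r, 'f) struct \<Rightarrow> bool" where
  "trivial_dcl L M \<longleftrightarrow> (\<forall>a. dcl L M a = set a)"

definition highly_homogeneous :: "('r, 'f) language \<Rightarrow> ('r, 'f) struct \<Rightarrow> bool" where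
  "highly_homogeneous L M \<longleftrightarrow>
     (\<forall>k X Y. finite X \<and> card X = k \<and> finite Y \<and> card Y = k \<longrightarrow> (\<exists>f\<in>Aut L M. f ` X = Y))"

section \<open>Infinitary formulas\<close>

datatype 'f trm = Var nat | App 'f "'f trm list"

text \<open>\<open>Conj\<close> is the conjunction of a countable sequence of formulas. Finite conjunctions
  (by repetition), disjunctions and universal quantifiers are definable. Formulas may have
  infinitely many free variables here; this is excluded in \<open>basic_open\<close> below, and a formula with
  finitely many free variables has only subformulas with finitely many free variables.\<close>

datatype ('r, 'f) form =
    Eq "'f trm" "'f trm"
  | Atom 'r "'f trm list"
  | Neg "('r, 'f) form"
  | Conj "nat \<Rightarrow> ('r, 'f) form"
  | Exists nat "('r, 'f) form"

fun wf_trm :: "('r, 'f) language \<Rightarrow> 'f trm \<Rightarrow> bool" where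
  "wf_trm L (Var x) \<longleftrightarrow> True"
| "wf_trm L (App f ts) \<longleftrightarrow>
     f \<in> Funs L \<and> length ts = fun_ar L f \<and> list_all (wf_trm L) ts"

primrec wf_form :: "('r, 'f) language \<Rightarrow> ('r, 'f) form \<Rightarrow> bool" where
  "wf_form L (Eq t u) \<longleftrightarrow> wf_trm L t \<and> wf_trm L u"
| "wf_form L (Atom r ts) \<longleftrightarrow>
     r \<in> Rels L \<and> length ts = rel_ar L r \<and> list_all (wf_trm L) ts"
| "wf_form L (Neg p) \<longleftrightarrow> wf_form L p"
| "wf_form L (Conj ps) \<longleftrightarrow> (\<forall>i. wf_form L (ps i))"
| "wf_form L (Exists x p) \<longleftrightarrow> wf_form L p"

primrec fv_trm :: "'f trm \<Rightarrow> nat set" where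
  "fv_trm (Var x) = {x}"
| "fv_trm (App f ts) = \<Union> (set (map fv_trm ts))"

primrec fv :: "('r, 'f) form \<Rightarrow> nat set" where
  "fv (Eq t u) = fv_trm t \<union> fv_trm u"
| "fv (Atom r ts) = \<Union> (set (map fv_trm ts))"
| "fv (Neg p) = fv p"
| "fv (Conj ps) = (\<Union>i. fv (ps i))"
| "fv (Exists x p) = fv p - {x}"

primrec eval_trm :: "('r, 'f) struct \<Rightarrow> (nat \<Rightarrow> nat) \<Rightarrow> 'f trm \<Rightarrow> nat" where
  "eval_trm M e (Var x) = e x"
| "eval_trm M e (App f ts) = fun_int M f (map (eval_trm M e) ts)"

primrec sat :: "('r, 'f) struct \<Rightarrow> (nat \<Rightarrow> nat) \<Rightarrow> ('r, 'f) form \<Rightarrow> bool" where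
  "sat M e (Eq t u) \<longleftrightarrow> eval_trm M e t = eval_trm M e u"
| "sat M e (Atom r ts) \<longleftrightarrow> map (eval_trm M e) ts \<in> rel_int M r"
| "sat M e (Neg p) \<longleftrightarrow> \<not> sat M e p"
| "sat M e (Conj ps) \<longleftrightarrow> (\<forall>i. sat M e (ps i))"
| "sat M e (Exists x p) \<longleftrightarrow> (\<exists>n. sat M (e(x := n)) p)"

section \<open>The Borel space of structures and invariant measures\<close>

definition basic_open :: "('r, 'f) language \<Rightarrow> ('r, 'f) struct set set" where
  "basic_open L = {{N \<in> Str L. sat N (\<lambda>i. ns ! i) p} | p ns. wf_form L p \<and> fv p \<subseteq> {..<length ns}}"

text \<open>The sets in \<open>basic_open L\<close> form a base of this topology, see \<open>openin_Str_topology\<close>.\<close>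

definition Str_topology :: "('r, 'f) language \<Rightarrow> ('r, 'f) struct topology" where
  "Str_topology L = topology_generated_by (basic_open L)"

definition Str_borel :: "('r, 'f) language \<Rightarrow> ('r, 'f) struct measure" where
  "Str_borel L = sigma (Str L) {U. openin (Str_topology L) U}"

definition borel_prob :: "('r, 'f) language \<Rightarrow> ('r, 'f) struct measure \<Rightarrow> bool" where
  "borel_prob L \<mu> \<longleftrightarrow> sets \<mu> = sets (Str_borel L) \<and> prob_space \<mu>"

definition invariant :: "('r, 'f) language \<Rightarrow> ('r, 'f) struct measure \<Rightarrow> bool" where
  "invariant L \<mu> \<longleftrightarrow> (\<forall>g. bij g \<longrightarrow> (\<forall>B\<in>sets \<mu>. emeasure \<mu> (act L g ` B) = emeasure \<mu> B))"

definition ergodic :: "('r, 'f) language \<Rightarrow> ('r, 'f) struct measure \<Rightarrow> bool" where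
  "ergodic L \<mu> \<longleftrightarrow>
     (\<forall>B\<in>sets \<mu>. (\<forall>g. bij g \<longrightarrow> emeasure \<mu> (sym_diff B (act L (inv g) ` B)) = 0) \<longrightarrow>
        emeasure \<mu> B = 0 \<or> emeasure \<mu> B = 1)"

definition concentrated_on :: "'a measure \<Rightarrow> 'a set \<Rightarrow> bool" where
  "concentrated_on \<mu> A \<longleftrightarrow> A \<in> sets \<mu> \<and> emeasure \<mu> A = 1"

definition invariant_measures_on_orbit ::
  "('r, 'f) language \<Rightarrow> ('r, 'f) struct \<Rightarrow> ('r, 'f) struct measure set" where
  "invariant_measures_on_orbit L M =
     {\<mu>. borel_prob L \<mu> \<and> invariant L \<mu> \<and> concentrated_on \<mu> (orbit L M)}"

definition continuum_many_ergodic_measures_on_orbit ::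
  "('r, 'f) language \<Rightarrow> ('r, 'f) struct \<Rightarrow> bool" where
  "continuum_many_ergodic_measures_on_orbit L M \<longleftrightarrow>
     {\<mu> \<in> invariant_measures_on_orbit L M. ergodic L \<mu>} \<approx> (UNIV :: real set)"

section \<open>Consistency of the encoding\<close>

subsection \<open>The basic open sets form a base\<close>

primrec ren_trm :: "(nat \<Rightarrow> nat) \<Rightarrow> 'f trm \<Rightarrow> 'f trm" where
  "ren_trm h (Var x) = Var (h x)"
| "ren_trm h (App f ts) = App f (map (ren_trm h) ts)"

primrec ren :: "(nat \<Rightarrow> nat) \<Rightarrow> ('r, 'f) form \<Rightarrow> ('r, 'f) form" where
  "ren h (Eq t u) = Eq (ren_trm h t) (ren_trm h u)"
| "ren h (Atom r ts) = Atom r (map (ren_trm h) ts)"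
| "ren h (Neg p) = Neg (ren h p)"
| "ren h (Conj ps) = Conj (\<lambda>i. ren h (ps i))"
| "ren h (Exists x p) = Exists (h x) (ren h p)"

lemma wf_ren_trm: "wf_trm L (ren_trm h t) = wf_trm L t"
  by (induction t) (auto simp: list_all_iff)

lemma wf_ren: "wf_form L (ren h p) = wf_form L p"
  by (induction p) (auto simp: wf_ren_trm list_all_iff)

lemma fv_ren_trm: "fv_trm (ren_trm h t) = h ` fv_trm t"
  by (induction t) auto

lemma fv_ren: "inj h \<Longrightarrow> fv (ren h p) = h ` fv p"
  by (induction p) (auto simp: fv_ren_trm inj_def)

lemma eval_ren_trm: "eval_trm M e (ren_trm h t) = eval_trm M (e \<circ> h) t"
  by (induction t) (auto intro!: arg_cong[where f = "fun_int M _"])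

lemma sat_ren: "inj h \<Longrightarrow> sat M e (ren h p) = sat M (e \<circ> h) p"
proof (induction p arbitrary: e)
  case (Atom r ts)
  then show ?case by (simp add: eval_ren_trm comp_def)
next
  case (Exists x p)
  have "(e(h x := n)) \<circ> h = (e \<circ> h)(x := n)" for n
    using Exists.prems by (auto simp: inj_def fun_eq_iff)
  then have "sat M (e(h x := n)) (ren h p) = sat M ((e \<circ> h)(x := n)) p" for n
    using Exists.IH[OF Exists.prems, of "e(h x := n)"] by (simp only:)
  then show ?case by (simp only: ren.simps sat.simps)
qed (auto simp: eval_ren_trm)

lemma eval_trm_cong: "(\<And>x. x \<in> fv_trm t \<Longrightarrow> e x = e' x) \<Longrightarrow> eval_trm M e t = eval_trm M e' t"
proof (induction t)
  case (App f ts)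
  then have "map (eval_trm M e) ts = map (eval_trm M e') ts"
    by (intro list.map_cong refl App.IH) (auto intro!: App.prems)
  then show ?case by (simp only: eval_trm.simps)
qed simp

lemma sat_cong: "(\<And>x. x \<in> fv p \<Longrightarrow> e x = e' x) \<Longrightarrow> sat M e p = sat M e' p"
proof (induction p arbitrary: e e')
  case (Eq t u)
  then show ?case using eval_trm_cong[of t e e' M] eval_trm_cong[of u e e' M] by simp
next
  case (Atom r ts)
  then have "map (eval_trm M e) ts = map (eval_trm M e') ts"
    by (auto intro!: eval_trm_cong)
  then show ?case by (simp only: sat.simps)
next
  case (Neg p)
  have "sat M e p = sat M e' p" by (rule Neg.IH) (use Neg.prems in auto)
  then show ?case by simp
next
  case (Conj ps)
  have "sat M e (ps i) = sat M e' (ps i)" for i by (rule Conj.IH) (use Conj.prems in auto)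
  then show ?case by simp
next
  case (Exists x p)
  have "sat M (e(x := n)) p = sat M (e'(x := n)) p" for n
    by (rule Exists.IH) (use Exists.prems in auto)
  then show ?case by simp
qed

lemma basic_open_Int:
  assumes "A \<in> basic_open L" "B \<in> basic_open L"
  shows "A \<inter> B \<in> basic_open L"
proof -
  obtain p ns where p: "wf_form L p" "fv p \<subseteq> {..<length ns}"
    and A: "A = {N \<in> Str L. sat N (\<lambda>i. ns ! i) p}"
    using assms(1) unfolding basic_open_def by blast
  obtain q ms where q: "wf_form L q" "fv q \<subseteq> {..<length ms}"
    and B: "B = {N \<in> Str L. sat N (\<lambda>i. ms ! i) q}"
    using assms(2) unfolding basic_open_def by blast
  define h where "h = (\<lambda>i. length ns + i)"
  have h: "inj h" by (simp add: h_def inj_def)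
  define c where "c = Conj (\<lambda>i::nat. if i = 0 then p else ren h q)"
  have "sat N (\<lambda>i. (ns @ ms) ! i) p = sat N (\<lambda>i. ns ! i) p" for N
    by (rule sat_cong) (use p in \<open>auto simp: nth_append\<close>)
  moreover have "sat N (\<lambda>i. (ns @ ms) ! i) (ren h q) = sat N (\<lambda>i. ms ! i) q" for N
    unfolding sat_ren[OF h] by (simp add: h_def comp_def)
  ultimately have "A \<inter> B = {N \<in> Str L. sat N (\<lambda>i. (ns @ ms) ! i) c}"
    unfolding A B c_def by auto
  moreover have "wf_form L c" using p q by (simp add: c_def wf_ren)
  moreover have "fv c \<subseteq> {..<length (ns @ ms)}"
  proof
    fix x assume "x \<in> fv c"
    then have "x \<in> fv p \<or> x \<in> h ` fv q"
      unfolding c_def by (auto simp: fv_ren[OF h] split: if_splits)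
    then show "x \<in> {..<length (ns @ ms)}" using p q by (auto simp: h_def)
  qed
  ultimately show ?thesis unfolding basic_open_def by blast
qed

lemma openin_Str_topology:
  "openin (Str_topology L) U \<longleftrightarrow> (arbitrary union_of (\<lambda>B. B \<in> basic_open L)) U"
proof
  have top: "istopology (arbitrary union_of (\<lambda>B. B \<in> basic_open L))"
    by (rule istopology_base) (rule basic_open_Int)
  assume "openin (Str_topology L) U"
  then have "generate_topology_on (basic_open L) U"
    unfolding Str_topology_def by (rule openin_topology_generated_by)
  then show "(arbitrary union_of (\<lambda>B. B \<in> basic_open L)) U"
  proof (induction rule: generate_topology_on.induct)
    case Empty
    then show ?case by simp
  next
    case (Int a b)
    then show ?case using top unfolding istopology_def by blast
  next
    case (UN K)
    then show ?case using top unfolding istopology_def by blast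
  next
    case (Basis s)
    then show ?case by (simp add: arbitrary_union_of_inc)
  qed
next
  assume "(arbitrary union_of (\<lambda>B. B \<in> basic_open L)) U"
  then obtain K where "K \<subseteq> basic_open L" "\<Union>K = U"
    unfolding union_of_def arbitrary_def by auto
  then show "openin (Str_topology L) U"
    unfolding Str_topology_def by (metis openin_Union subsetD topology_generated_by_Basis)
qed

lemma topspace_Str_topology: "topspace (Str_topology L) = Str L"
proof -
  have "{N \<in> Str L. sat N (\<lambda>i. [0] ! i) (Eq (Var 0) (Var 0))} \<in> basic_open L"
    unfolding basic_open_def
    by (rule CollectI, rule exI[of _ "Eq (Var 0) (Var 0)"], rule exI[of _ "[0]"]) simp
  then have "Str L \<in> basic_open L" by simp
  moreover have "A \<subseteq> Str L" if "A \<in> basic_open L" for A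
    using that unfolding basic_open_def by auto
  ultimately show ?thesis
    unfolding Str_topology_def topology_generated_by_topspace by auto
qed

lemma space_Str_borel: "space (Str_borel L) = Str L"
  and sets_Str_borel: "sets (Str_borel L) = sigma_sets (Str L) {U. openin (Str_topology L) U}"
proof -
  have "{U. openin (Str_topology L) U} \<subseteq> Pow (Str L)"
    using openin_subset[of "Str_topology L"] by (auto simp: topspace_Str_topology)
  then show "space (Str_borel L) = Str L"
    and "sets (Str_borel L) = sigma_sets (Str L) {U. openin (Str_topology L) U}"
    unfolding Str_borel_def by (simp_all add: space_measure_of_conv)
qed

subsection \<open>The logic action\<close>

lemma act_in_Str: "N \<in> Str L \<Longrightarrow> act L g N \<in> Str L"
  by (force simp: Str_def act_def)

lemma act_act:
  assumes "bij g" "bij h"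
  shows "act L g (act L h N) = act L (g \<circ> h) N"
proof -
  have "inv (g \<circ> h) = inv h \<circ> inv g" using assms by (rule o_inv_distrib)
  then show ?thesis by (auto simp: act_def intro!: ext)
qed

lemma act_id: "N \<in> Str L \<Longrightarrow> act L id N = N"
  by (cases N) (auto simp: act_def Str_def fun_eq_iff inv_id[unfolded id_def])

lemma Aut_iff_act:
  assumes "N \<in> Str L"
  shows "g \<in> Aut L N \<longleftrightarrow> bij g \<and> act L g N = N"
proof (cases "bij g")
  case True
  then have inv1: "map (inv g) (map g s) = s" and inv2: "map g (map (inv g) s) = s" for s
    by (auto simp: bij_is_inj bij_is_surj surj_f_inv_f intro!: map_idI)
  show ?thesis
  proof
    assume g: "g \<in> Aut L N"
    have "map (inv g) s \<in> rel_int N r \<longleftrightarrow> s \<in> rel_int N r" for r s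
    proof (cases "r \<in> Rels L \<and> length s = rel_ar L r")
      case True
      then have "length (map (inv g) s) = rel_ar L r" by simp
      with g True have "map g (map (inv g) s) \<in> rel_int N r \<longleftrightarrow> map (inv g) s \<in> rel_int N r"
        unfolding Aut_def by blast
      then show ?thesis by (simp only: inv2)
    next
      case False
      then show ?thesis using assms unfolding Str_def by force
    qed
    moreover have "fun_int (act L g N) f s = fun_int N f s" for f s
    proof (cases "f \<in> Funs L \<and> length s = fun_ar L f")
      case True
      then have "length (map (inv g) s) = fun_ar L f" by simp
      with g True have "fun_int N f (map g (map (inv g) s)) = g (fun_int N f (map (inv g) s))"
        unfolding Aut_def by blast
      then show ?thesis using True by (simp only: inv2) (simp add: act_def)
    next
      case False
      then show ?thesis using assms unfolding Str_def act_def by force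
    qed
    ultimately show "bij g \<and> act L g N = N"
      using True by (intro conjI struct.equality) (auto simp: act_def fun_eq_iff)
  next
    assume "bij g \<and> act L g N = N"
    then have eq: "act L g N = N" by blast
    have "map g s \<in> rel_int N r \<longleftrightarrow> s \<in> rel_int N r" for r s
    proof -
      have "map g s \<in> rel_int (act L g N) r \<longleftrightarrow> map (inv g) (map g s) \<in> rel_int N r"
        by (simp add: act_def)
      then show ?thesis by (simp only: eq inv1)
    qed
    moreover have "fun_int N f (map g s) = g (fun_int N f s)"
      if "f \<in> Funs L" "length s = fun_ar L f" for f s
    proof -
      have "fun_int (act L g N) f (map g s) = g (fun_int N f (map (inv g) (map g s)))"
        using that by (simp add: act_def)
      then show ?thesis by (simp only: eq inv1)
    qed
    ultimately show "g \<in> Aut L N" using True unfolding Aut_def by blast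
  qed
qed (auto simp: Aut_def)

lemma eval_act:
  assumes "bij g"
  shows "wf_trm L t \<Longrightarrow> eval_trm (act L g N) (\<lambda>x. g (e x)) t = g (eval_trm N e t)"
proof (induction t)
  case (App f ts)
  have 1: "map (eval_trm (act L g N) (\<lambda>x. g (e x))) ts = map g (map (eval_trm N e) ts)"
    using App by (simp add: list_all_iff)
  have 2: "map (inv g) (map g s) = s" for s
    using assms by (auto simp: bij_is_inj intro!: map_idI)
  have "eval_trm (act L g N) (\<lambda>x. g (e x)) (App f ts)
      = fun_int (act L g N) f (map g (map (eval_trm N e) ts))"
    by (simp only: eval_trm.simps 1)
  also have "\<dots> = g (fun_int N f (map (inv g) (map g (map (eval_trm N e) ts))))"
    using App.prems by (simp add: act_def)
  also have "\<dots> = g (eval_trm N e (App f ts))" by (simp only: 2 eval_trm.simps)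
  finally show ?case .
qed simp

lemma sat_act:
  assumes "bij g"
  shows "wf_form L p \<Longrightarrow> sat (act L g N) (\<lambda>x. g (e x)) p = sat N e p"
proof (induction p arbitrary: e)
  case (Eq t u)
  then show ?case
    using eval_act[OF assms, of L t N e] eval_act[OF assms, of L u N e] bij_is_inj[OF assms]
    by (simp add: inj_eq)
next
  case (Atom r ts)
  then have 1: "map (eval_trm (act L g N) (\<lambda>x. g (e x))) ts = map g (map (eval_trm N e) ts)"
    by (auto simp: eval_act[OF assms] list_all_iff)
  have 2: "map (inv g) (map g s) = s" for s
    using assms by (auto simp: bij_is_inj intro!: map_idI)
  have "sat (act L g N) (\<lambda>x. g (e x)) (Atom r ts)
      \<longleftrightarrow> map (inv g) (map g (map (eval_trm N e) ts)) \<in> rel_int N r"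
    by (simp only: sat.simps 1) (simp add: act_def)
  then show ?case by (simp only: 2 sat.simps)
next
  case (Exists x p)
  have "(\<lambda>y. g (e y))(x := g n) = (\<lambda>y. g ((e(x := n)) y))" for n by auto
  then have "sat (act L g N) ((\<lambda>y. g (e y))(x := g n)) p = sat N (e(x := n)) p" for n
    using Exists by (simp only: wf_form.simps)
  then show ?case using bij_is_surj[OF assms] by (metis sat.simps(5) surjD)
qed auto

lemma act_image_eq:
  assumes "bij g" "B \<subseteq> Str L"
  shows "act L g ` B = {N \<in> Str L. act L (inv g) N \<in> B}"
proof -
  have "bij (inv g)" using assms(1) by (rule bij_imp_bij_inv)
  moreover have "g \<circ> inv g = id" "inv g \<circ> g = id"
    using bij_is_surj[OF assms(1)] bij_is_inj[OF assms(1)] by (simp_all add: surj_iff)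
  ultimately have inv_act: "act L g (act L (inv g) N) = N" "act L (inv g) (act L g N) = N"
    if "N \<in> Str L" for N
    using that assms(1) by (simp_all add: act_act act_id)
  show ?thesis
  proof (intro equalityI subsetI)
    fix N assume "N \<in> act L g ` B"
    then show "N \<in> {N \<in> Str L. act L (inv g) N \<in> B}"
      using assms(2) by (auto simp: inv_act act_in_Str subset_iff)
  next
    fix N assume "N \<in> {N \<in> Str L. act L (inv g) N \<in> B}"
    then show "N \<in> act L g ` B"
      by (intro image_eqI[of _ _ "act L (inv g) N"]) (auto simp: inv_act)
  qed
qed

lemma act_image_basic_open:
  assumes "bij g" "A \<in> basic_open L"
  shows "act L g ` A \<in> basic_open L"
proof -
  obtain p ns where p: "wf_form L p" "fv p \<subseteq> {..<length ns}"
    and A: "A = {N \<in> Str L. sat N (\<lambda>i. ns ! i) p}"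
    using assms(2) unfolding basic_open_def by blast
  have bi: "bij (inv g)" using assms(1) by (rule bij_imp_bij_inv)
  have "sat (act L (inv g) N) (\<lambda>i. ns ! i) p = sat N (\<lambda>i. map g ns ! i) p" for N
  proof -
    have "sat (act L (inv g) N) (\<lambda>i. ns ! i) p
        = sat (act L (inv g) N) (\<lambda>i. inv g (map g ns ! i)) p"
      by (rule sat_cong) (use p assms(1) in \<open>auto simp: bij_is_inj subset_iff\<close>)
    then show ?thesis by (simp only: sat_act[OF bi p(1)])
  qed
  then have "act L g ` A = {N \<in> Str L. sat N (\<lambda>i. map g ns ! i) p}"
    by (subst act_image_eq[OF assms(1)]) (auto simp: A act_in_Str)
  then show ?thesis using p unfolding basic_open_def
    by (intro CollectI exI[of _ p] exI[of _ "map g ns"]) auto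
qed

lemma act_image_sets:
  assumes "bij g" "B \<in> sets (Str_borel L)"
  shows "act L g ` B \<in> sets (Str_borel L)"
proof -
  let ?B = "Str_borel L"
  have bi: "bij (inv g)" using assms(1) by (rule bij_imp_bij_inv)
  have opens: "{U. openin (Str_topology L) U} \<subseteq> Pow (Str L)"
    using openin_subset[of "Str_topology L"] by (auto simp: topspace_Str_topology)
  have "act L (inv g) \<in> measurable ?B (sigma (Str L) {U. openin (Str_topology L) U})"
  proof (rule measurable_measure_of[OF opens])
    show "act L (inv g) \<in> space ?B \<rightarrow> Str L" by (auto simp: space_Str_borel act_in_Str)
    fix U assume "U \<in> {U. openin (Str_topology L) U}"
    then have U: "openin (Str_topology L) U" by simp
    then obtain K where K: "K \<subseteq> basic_open L" "\<Union>K = U"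
      unfolding openin_Str_topology union_of_def arbitrary_def by auto
    have US: "U \<subseteq> Str L" using openin_subset[OF U] by (simp add: topspace_Str_topology)
    have "act L g ` U = \<Union> ((`) (act L g) ` K)" using K by auto
    moreover have "(`) (act L g) ` K \<subseteq> basic_open L"
      using K act_image_basic_open[OF assms(1)] by blast
    ultimately have "openin (Str_topology L) (act L g ` U)"
      unfolding Str_topology_def by (metis openin_Union subsetD topology_generated_by_Basis)
    then have "act L g ` U \<in> sets ?B" by (simp add: sets_Str_borel sigma_sets.Basic)
    moreover have "act L (inv g) -` U \<inter> space ?B = act L g ` U"
      using act_image_eq[OF assms(1) US] by (auto simp: space_Str_borel)
    ultimately show "act L (inv g) -` U \<inter> space ?B \<in> sets ?B" by simp
  qed
  then have "act L (inv g) -` B \<inter> space ?B \<in> sets ?B"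
    using assms(2) unfolding Str_borel_def[symmetric] by (rule measurable_sets)
  moreover have "B \<subseteq> Str L" using sets.sets_into_space[OF assms(2)] by (simp add: space_Str_borel)
  then have "act L (inv g) -` B \<inter> space ?B = act L g ` B"
    by (subst act_image_eq[OF assms(1)]) (auto simp: space_Str_borel)
  ultimately show ?thesis by simp
qed

end

theory Submission
  imports Defs "HOL-Combinatorics.Transposition"
begin

text \<open>The obstacle is that the random structure must lie in the single orbit of
  \<open>M\<close> although its points are sampled independently. No structure on the reals is
  built: at each level a labelled point carries an element of \<open>M\<close>, and this label may
  change later. What survives is the type of a tuple with distinct labels, because a halving moves
  at most one of its entries, and an automorphism fixing the other labels performs this move. Copies
  are needed since points that share a label have to be separated eventually; trivial definable
  closure provides the room for them. Roots provide the witnesses of the back-and-forth. A witness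
  for a tuple of labels is of use only while the points still carry these labels, hence the
  interplay of roots and copies. Treating the unlabelled points as one more cell \<open>None\<close>
  turns both operations into the halving of a cell, so one mass estimate controls both. The nodes
  below \<open>n1\<close> get cells of their own from the start, and the weights of the initial
  cells are the free parameters behind the continuum; for mere existence all points start in
  \<open>None\<close>.\<close>

text \<open>Scott's analysis makes the orbit of \<open>M\<close> and its cylinder sets (a tuple of the random structure
  has a prescribed \<open>Aut M\<close>-type) Borel, and every Borel set agrees on the orbit with a set generated
  by countably many cylinders. So an invariant measure on the orbit is determined by the
  probabilities of types.

  If \<open>b\<close> is in the definable closure of \<open>a\<close>, infinitely many disjoint cylinders of the same positive
  measure exist, so there is no invariant measure. If \<open>M\<close> is highly homogeneous, the finitely many
  types of \<open>k\<close>-tuples of distinct elements are permuted transitively by reordering the tuple, so all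
  of them have the same probability.

  If the definable closure is trivial, then an element outside a finite set can be moved away from
  any finite set by an automorphism that fixes the first set pointwise. Hence a finite tuple can be
  grown step by step, each new element being either a copy of an earlier one over all others, or a
  new root that realises a prescribed type. An i.i.d. sequence of points descending through this
  tree gets at each level a tuple of labels whose type stabilises once the labels are distinct; the
  limit structure is almost surely isomorphic to \<open>M\<close>, and its law is invariant and ergodic. The
  probability that the first \<open>k\<close> points span a set equivalent to a given \<open>X\<close> is a form of degree
  \<open>k\<close> in the weights of the initial nodes. It is constant only if all \<open>k\<close>-sets of nodes
  are equivalent; otherwise it takes a continuum of values.\<close>

section \<open>Back-and-forth and permutation groups\<close>

text \<open>Each stage puts \<open>n\<close> into the left list and then into the right one, so the
  limit is total and onto. The conclusion keeps arbitrarily long related pairs along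
  \<open>g\<close>, since \<open>R\<close> speaks about finite tuples only.\<close>

lemma back_and_forth:
  fixes R :: "nat list \<Rightarrow> nat list \<Rightarrow> bool"
  assumes nil: "R [] []"
    and fwd: "\<And>a b c. R a b \<Longrightarrow> \<exists>d. R (a @ [c]) (b @ [d])"
    and bwd: "\<And>a b d. R a b \<Longrightarrow> \<exists>c. R (a @ [c]) (b @ [d])"
    and len: "\<And>a b. R a b \<Longrightarrow> length a = length b"
    and eq: "\<And>a b i j. R a b \<Longrightarrow> i < length a \<Longrightarrow> j < length a \<Longrightarrow> a ! i = a ! j \<longleftrightarrow> b ! i = b ! j"
  shows "\<exists>g. bij g \<and> (\<forall>n. \<exists>a b. R a b \<and> {..<n} \<subseteq> set a \<and> map g a = b)"
proof -
  have step: "\<exists>y. (R (fst y) (snd y) \<and> length (fst y) = 2 * Suc n) \<and>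
      (\<exists>c d. y = (fst x @ [n, c], snd x @ [d, n]))"
    if x: "R (fst x) (snd x) \<and> length (fst x) = 2 * n" for x n
  proof -
    obtain d where "R (fst x @ [n]) (snd x @ [d])" using fwd x by blast
    then obtain c where "R ((fst x @ [n]) @ [c]) ((snd x @ [d]) @ [n])" using bwd by blast
    then show ?thesis using x by (intro exI[of _ "(fst x @ [n, c], snd x @ [d, n])"]) simp
  qed
  have "\<exists>s. \<forall>n. (R (fst (s n)) (snd (s n)) \<and> length (fst (s n)) = 2 * n) \<and>
      (\<exists>c d. s (Suc n) = (fst (s n) @ [n, c], snd (s n) @ [d, n]))"
    by (rule dependent_nat_choice[where P = "\<lambda>n x. R (fst x) (snd x) \<and> length (fst x) = 2 * n"])
      (use nil step in \<open>auto intro!: exI[of _ "[]"]\<close>)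
  then obtain s where s: "\<And>n. R (fst (s n)) (snd (s n))" "\<And>n. length (fst (s n)) = 2 * n"
    "\<And>n. \<exists>c d. s (Suc n) = (fst (s n) @ [n, c], snd (s n) @ [d, n])" by blast
  \<comment> \<open>The lists extend one another, so entry \<open>i\<close> is final as soon as it
    exists; stage \<open>Suc i\<close> already has \<open>2 * Suc i\<close> entries.\<close>
  define \<alpha> where "\<alpha> i = fst (s (Suc i)) ! i" for i
  define \<beta> where "\<beta> i = snd (s (Suc i)) ! i" for i
  have len': "length (snd (s n)) = 2 * n" for n using s len by metis
  have nth: "fst (s (n + m)) ! i = fst (s n) ! i \<and> snd (s (n + m)) ! i = snd (s n) ! i"
    if "i < 2 * n" for i n m
  proof (induction m)
    case (Suc m)
    obtain c d where "s (Suc (n + m)) = (fst (s (n + m)) @ [n + m, c], snd (s (n + m)) @ [d, n +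
      m])"
      using s by blast
    then show ?case using Suc that by (simp add: nth_append s len')
  qed simp
  have \<alpha>\<beta>: "fst (s n) ! i = \<alpha> i \<and> snd (s n) ! i = \<beta> i" if "i < 2 * n" for i n
  proof (cases "n \<le> Suc i")
    case True
    then show ?thesis unfolding \<alpha>_def \<beta>_def using nth[OF that, of "Suc i - n"] by simp
  next
    case False
    then show ?thesis unfolding \<alpha>_def \<beta>_def using nth[of i "Suc i" "n - Suc i"] by simp
  qed
  have eq': "\<alpha> i = \<alpha> j \<longleftrightarrow> \<beta> i = \<beta> j" for i j
  proof -
    let ?n = "Suc (max i j)"
    have "i < 2 * ?n" "j < 2 * ?n" by auto
    then show ?thesis using eq[OF s(1)[of ?n], of i j] by (simp only: s(2) \<alpha>\<beta>)
  qed
  have \<alpha>s: "\<alpha> (2 * n) = n" and \<beta>s: "\<beta> (2 * n + 1) = n" for n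
  proof -
    obtain c d where "s (Suc n) = (fst (s n) @ [n, c], snd (s n) @ [d, n])" using s by blast
    moreover have "\<alpha> (2 * n) = fst (s (Suc n)) ! (2 * n)" "\<beta> (2 * n + 1) =
      snd (s (Suc n)) ! (2 * n + 1)"
      using \<alpha>\<beta>[of _ "Suc n"] by simp_all
    ultimately show "\<alpha> (2 * n) = n" "\<beta> (2 * n + 1) = n" by (simp_all add: nth_append s len')
  qed
  define g where "g x = \<beta> (2 * x)" for x
  have g\<alpha>: "g (\<alpha> i) = \<beta> i" for i using eq'[of "2 * \<alpha> i" i] by (simp add: g_def \<alpha>s)
  have "bij g"
  proof (rule bijI)
    show "inj g" by (rule injI) (metis g_def eq' \<alpha>s)
    show "surj g" unfolding surj_def by (metis g\<alpha> \<beta>s)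
  qed
  moreover have "\<exists>a b. R a b \<and> {..<n} \<subseteq> set a \<and> map g a = b" for n
  proof (intro exI conjI)
    show "R (fst (s n)) (snd (s n))" by (rule s)
    show "map g (fst (s n)) = snd (s n)"
      by (rule nth_equalityI) (auto simp: s len' \<alpha>\<beta> g\<alpha>)
    show "{..<n} \<subseteq> set (fst (s n))"
    proof
      fix x assume "x \<in> {..<n}"
      then have "fst (s n) ! (2 * x) = x" "2 * x < length (fst (s n))"
        using \<alpha>\<beta>[of "2*x" n] by (auto simp: \<alpha>s s)
      then show "x \<in> set (fst (s n))" by (metis nth_mem)
    qed
  qed
  ultimately show ?thesis by blast
qed

text \<open>Function values are compared through their positions in the tuple. Hence the tuple need
  not be closed under the functions.\<close>

definition atom_eq :: "('r, 'f) language \<Rightarrow> ('r, 'f) struct \<Rightarrow> nat list \<Rightarrow> ('r, 'f) struct \<Rightarrow> nat list \<Rightarrow>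
  bool" where
  "atom_eq L M a N b \<longleftrightarrow>
     (\<forall>r\<in>Rels L. \<forall>is. length is = rel_ar L r \<and> set is \<subseteq> {..<length a} \<longrightarrow>
        (map ((!) a) is \<in> rel_int M r \<longleftrightarrow> map ((!) b) is \<in> rel_int N r)) \<and>
     (\<forall>f\<in>Funs L. \<forall>is. \<forall>j<length a. length is = fun_ar L f \<and> set is \<subseteq> {..<length a} \<longrightarrow>
        (fun_int M f (map ((!) a) is) = a ! j \<longleftrightarrow> fun_int N f (map ((!) b) is) = b ! j))"

lemma list_indices:
  assumes "set s \<subseteq> set a"
  obtains "is" where "length is = length s" "set is \<subseteq> {..<length a}" "map ((!) a) is = s"
proof -
  have "\<exists>i<length a. a ! i = x" if "x \<in> set s" for x
    using that assms by (meson in_set_conv_nth subsetD)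
  then obtain h where "\<And>x. x \<in> set s \<Longrightarrow> h x < length a \<and> a ! h x = x" by metis
  then show thesis by (intro that[of "map h s"]) (auto intro!: map_idI)
qed

lemma act_eqI:
  assumes M: "M \<in> Str L" and N: "N \<in> Str L" and g: "bij g"
    and ex: "\<And>n. \<exists>a b. atom_eq L M a N b \<and> {..<n} \<subseteq> set a \<and> map g a = b"
  shows "act L g M = N"
proof -
  have inv: "map (inv g) (map g s) = s" "map g (map (inv g) s) = s" for s
    using g by (auto simp: bij_is_inj bij_is_surj surj_f_inv_f intro!: map_idI)
  have rel: "map g s \<in> rel_int N r \<longleftrightarrow> s \<in> rel_int M r" if "r \<in> Rels L" "length s = rel_ar L r"
    for r s
  proof -
    obtain a b where ab: "atom_eq L M a N b" "{..<Suc (Max (set s))} \<subseteq> set a" "map g a = b"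
      using ex by blast
    have "set s \<subseteq> {..<Suc (Max (set s))}" by (auto simp: less_Suc_eq_le)
    then obtain "is" where "is": "length is = length s" "set is \<subseteq> {..<length a}" "map ((!) a) is =
      s"
      using list_indices[of s a] ab by blast
    have "map ((!) b) is = map g (map ((!) a) is)" using ab "is" by (auto simp: subset_iff)
    moreover have "map ((!) a) is \<in> rel_int M r \<longleftrightarrow> map ((!) b) is \<in> rel_int N r"
      using ab(1) "is" that unfolding atom_eq_def by auto
    ultimately show ?thesis using "is" by simp
  qed
  have func: "fun_int N f (map g s) = g (fun_int M f s)" if "f \<in> Funs L" "length s = fun_ar L f"
    for f s
  proof -
    let ?v = "fun_int M f s"
    \<comment> \<open>The tuple has to contain the value besides the arguments, since
      \<open>atom_eq\<close> says nothing about values outside it.\<close>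
    obtain a b where ab: "atom_eq L M a N b" "{..<Suc (Max (set (?v # s)))} \<subseteq> set a" "map g a = b"
      using ex by blast
    have "set (?v # s) \<subseteq> {..<Suc (Max (set (?v # s)))}"
      using Max_ge[of "set (?v # s)"] by (simp add: less_Suc_eq_le subset_iff)
    then obtain "is'" where "is'": "length is' = length (?v # s)" "set is' \<subseteq> {..<length a}"
      "map ((!) a) is' = ?v # s"
      using list_indices[of "?v # s" a] ab by blast
    then obtain j "is" where [simp]: "is' = j # is" by (cases is') auto
    have "map ((!) b) is = map g (map ((!) a) is)" "b ! j = g (a ! j)"
      using ab "is'" by (auto simp: subset_iff)
    moreover have "fun_int M f (map ((!) a) is) = a ! j \<longleftrightarrow> fun_int N f (map ((!) b) is) = b ! j"
    proof -
      have "length is = fun_ar L f \<and> set is \<subseteq> {..<length a}" "j < length a" using "is'" that by auto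
      then show ?thesis using ab(1) that(1) unfolding atom_eq_def by blast
    qed
    moreover have "map ((!) a) is = s" "a ! j = fun_int M f s" using "is'" by auto
    ultimately show ?thesis by simp
  qed
  show ?thesis
  proof (rule struct.equality)
    have "map (inv g) s \<in> rel_int M r \<longleftrightarrow> s \<in> rel_int N r" for s r
    proof (cases "r \<in> Rels L \<and> length s = rel_ar L r")
      case True
      then show ?thesis using rel[of r "map (inv g) s"] by (simp only: inv length_map)
    next
      case False
      then show ?thesis using M N unfolding Str_def by force
    qed
    then show "rel_int (act L g M) = rel_int N" by (auto simp: act_def)
    have "fun_int (act L g M) f s = fun_int N f s" for f s
    proof (cases "f \<in> Funs L \<and> length s = fun_ar L f")
      case True
      then show ?thesis using func[of f "map (inv g) s"] unfolding inv length_map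
        by (simp add: act_def)
    next
      case False
      then show ?thesis using N unfolding Str_def by (auto simp: act_def)
    qed
    then show "fun_int (act L g M) = fun_int N" by auto
  qed auto
qed

section \<open>Tuples up to a permutation group\<close>

definition sim :: "(nat \<Rightarrow> nat) set \<Rightarrow> nat list \<Rightarrow> nat list \<Rightarrow> bool" where
  "sim G a b \<longleftrightarrow> (\<exists>g\<in>G. map g a = b)"

definition inv_set :: "(nat \<Rightarrow> nat) set \<Rightarrow> nat list set \<Rightarrow> bool" where
  "inv_set G A \<longleftrightarrow> (\<forall>g\<in>G. \<forall>a\<in>A. map g a \<in> A)"

locale perm_group =
  fixes G :: "(nat \<Rightarrow> nat) set"
  assumes G_bij: "g \<in> G \<Longrightarrow> bij g"
    and G_id: "id \<in> G"
    and G_comp: "g \<in> G \<Longrightarrow> h \<in> G \<Longrightarrow> g \<circ> h \<in> G"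
    and G_inv: "g \<in> G \<Longrightarrow> inv g \<in> G"
begin

lemma sim_refl: "sim G a a"
  unfolding sim_def using G_id by (metis list.map_id)

lemma sim_sym: "sim G a b \<Longrightarrow> sim G b a"
  unfolding sim_def
  by (metis G_bij G_inv bij_is_inj inv_o_cancel list.map_comp list.map_id)

lemma sim_trans: "sim G a b \<Longrightarrow> sim G b c \<Longrightarrow> sim G a c"
  unfolding sim_def by (metis G_comp list.map_comp)

lemma sim_length: "sim G a b \<Longrightarrow> length a = length b"
  unfolding sim_def by auto

lemma sim_distinct: "sim G a b \<Longrightarrow> distinct a \<longleftrightarrow> distinct b"
  unfolding sim_def by (metis G_bij bij_is_inj distinct_map inj_on_subset subset_UNIV)

lemma sim_nth_eq: "sim G a b \<Longrightarrow> i < length a \<Longrightarrow> j < length a \<Longrightarrow> a ! i = a ! j \<longleftrightarrow> b ! i = b ! j"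
  unfolding sim_def using G_bij by (auto simp: bij_is_inj inj_eq)

lemma sim_append: "sim G (a @ c) (b @ d) \<Longrightarrow> length a = length b \<Longrightarrow> sim G a b"
  unfolding sim_def by auto

lemma inv_set_iff: "inv_set G A \<Longrightarrow> sim G a b \<Longrightarrow> a \<in> A \<longleftrightarrow> b \<in> A"
  using sim_sym unfolding inv_set_def sim_def by metis

lemma inv_set_sim: "inv_set G {b. sim G a b}"
  unfolding inv_set_def using sim_trans unfolding sim_def by blast

end

lemma perm_group_Aut:
  assumes "M \<in> Str L"
  shows "perm_group (Aut L M)"
proof
  fix g h assume g: "g \<in> Aut L M"
  then have g': "bij g" "act L g M = M" using Aut_iff_act[OF assms] by auto
  then show "bij g" by simp
  have "act L (inv g) M = act L (inv g \<circ> g) M"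
    using g' by (metis act_act bij_imp_bij_inv)
  then show "inv g \<in> Aut L M"
    using g' by (simp add: Aut_iff_act[OF assms] bij_imp_bij_inv bij_is_inj act_id[OF assms])
  assume "h \<in> Aut L M"
  then have h': "bij h" "act L h M = M" using Aut_iff_act[OF assms] by auto
  show "g \<circ> h \<in> Aut L M"
    unfolding Aut_iff_act[OF assms] using g' h' by (metis act_act bij_comp)
next
  show "id \<in> Aut L M" by (simp add: Aut_iff_act[OF assms] act_id[OF assms])
qed

section \<open>Scott analysis\<close>

definition equiv_form :: "('r, 'f) language \<Rightarrow> ('r, 'f) struct \<Rightarrow> nat list \<Rightarrow> nat list \<Rightarrow> bool" where
  "equiv_form L M a b \<longleftrightarrow> length a = length b \<and>
     (\<forall>p. wf_form L p \<and> fv p \<subseteq> {..<length a} \<longrightarrow> sat M ((!) a) p = sat M ((!) b) p)"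

lemma sat_Exists_nth:
  assumes "length a = k" "fv p \<subseteq> {..<Suc k}"
  shows "sat N ((!) a) (Exists k p) \<longleftrightarrow> (\<exists>c. sat N ((!) (a @ [c])) p)"
proof -
  have "sat N (((!) a)(k := c)) p = sat N ((!) (a @ [c])) p" for c
    by (rule sat_cong) (use assms in \<open>auto simp: nth_append less_Suc_eq\<close>)
  then show ?thesis by simp
qed

lemma equiv_form_sym: "equiv_form L M a b \<Longrightarrow> equiv_form L M b a"
  unfolding equiv_form_def by auto

lemma not_equiv_form:
  assumes "length a = length b" "\<not> equiv_form L M a b"
  obtains p where "wf_form L p" "fv p \<subseteq> {..<length a}" "sat M ((!) a) p" "\<not> sat M ((!) b) p"
proof -
  obtain p where p: "wf_form L p" "fv p \<subseteq> {..<length a}" "sat M ((!) a) p \<noteq> sat M ((!) b) p"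
    using assms unfolding equiv_form_def by blast
  show thesis
  proof (cases "sat M ((!) a) p")
    case True
    then show ?thesis using p that by blast
  next
    case False
    then show ?thesis using p that[of "Neg p"] by auto
  qed
qed

text \<open>If no \<open>d\<close> matched \<open>c\<close>, every \<open>d\<close> would have a
  formula true of \<open>a @ [c]\<close> and false of \<open>b @ [d]\<close>. There are only
  countably many \<open>d\<close>, so these formulas have a conjunction, and quantifying its last
  variable separates \<open>a\<close> from \<open>b\<close>.\<close>

lemma equiv_form_extend:
  assumes "equiv_form L M a b"
  shows "\<exists>d. equiv_form L M (a @ [c]) (b @ [d])"
proof (rule ccontr)
  assume no: "\<not> ?thesis"
  have len: "length a = length b" using assms unfolding equiv_form_def by simp
  have "\<exists>p. wf_form L p \<and> fv p \<subseteq> {..<Suc (length a)} \<and> sat M ((!) (a @ [c])) p \<and>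
    \<not> sat M ((!) (b @ [d])) p" for d
    using not_equiv_form[of "a @ [c]" "b @ [d]" L M] no len by (metis length_append_singleton)
  then obtain P where P: "\<And>d. wf_form L (P d)" "\<And>d. fv (P d) \<subseteq> {..<Suc (length a)}"
    "\<And>d. sat M ((!) (a @ [c])) (P d)" "\<And>d. \<not> sat M ((!) (b @ [d])) (P d)" by metis
  let ?q = "Exists (length a) (Conj P)"
  have fv: "fv (Conj P) \<subseteq> {..<Suc (length a)}" using P by auto
  have "sat M ((!) a) ?q" unfolding sat_Exists_nth[OF refl fv] using P by auto
  moreover have "\<not> sat M ((!) b) ?q"
    unfolding sat_Exists_nth[OF len[symmetric] fv] unfolding sat.simps using P(4) by blast
  moreover have "wf_form L ?q" "fv ?q \<subseteq> {..<length a}" using P fv by auto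
  ultimately show False using assms unfolding equiv_form_def by blast
qed

lemma atom_eqI:
  assumes sat: "\<And>p. wf_form L p \<Longrightarrow> fv p \<subseteq> {..<length a} \<Longrightarrow> sat M ((!) a) p = sat N ((!) b) p"
  shows "atom_eq L M a N b"
  unfolding atom_eq_def
proof (intro conjI ballI allI impI)
  fix r "is" assume "r \<in> Rels L" "length is = rel_ar L r \<and> set is \<subseteq> {..<length a}"
  then show "map ((!) a) is \<in> rel_int M r \<longleftrightarrow> map ((!) b) is \<in> rel_int N r"
    using sat[of "Atom r (map Var is)"] by (auto simp: list_all_iff comp_def)
next
  fix f j "is" assume "f \<in> Funs L" "j < length a" "length is = fun_ar L f \<and> set is \<subseteq> {..<length a}"
  then show "fun_int M f (map ((!) a) is) = a ! j \<longleftrightarrow> fun_int N f (map ((!) b) is) = b ! j"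
    using sat[of "Eq (App f (map Var is)) (Var j)"] by (auto simp: list_all_iff comp_def)
qed

lemma equiv_form_atom_eq: "equiv_form L M a b \<Longrightarrow> atom_eq L M a M b"
  by (rule atom_eqI) (auto simp: equiv_form_def)

lemma equiv_form_nth_eq:
  assumes "equiv_form L M a b" "i < length a" "j < length a"
  shows "a ! i = a ! j \<longleftrightarrow> b ! i = b ! j"
proof -
  have "sat M ((!) a) (Eq (Var i) (Var j)) = sat M ((!) b) (Eq (Var i) (Var j))"
    using assms unfolding equiv_form_def by (metis fv.simps(1) fv_trm.simps(1) wf_form.simps(1)
      wf_trm.simps(1) Un_insert_left empty_subsetI insert_subset lessThan_iff sup_bot_left)
  then show ?thesis by simp
qed

lemma atom_eq_append:
  assumes "atom_eq L M (a @ a') N (b @ b')" "length a = length b" "length a' = length b'"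
  shows "atom_eq L M a' N b'"
proof -
  let ?f = "\<lambda>i. i + length a"
  have 1: "map ((!) (a @ a')) (map ?f is) = map ((!) a') is" "map ((!) (b @ b')) (map ?f is) =
    map ((!) b') is" for "is"
    using assms by (auto simp: nth_append)
  have 2: "(a @ a') ! ?f j = a' ! j" "(b @ b') ! ?f j = b' ! j" for j
    using assms by (auto simp: nth_append)
  show ?thesis
    unfolding atom_eq_def
  proof (intro conjI ballI allI impI)
    fix r "is" assume r: "r \<in> Rels L" "length is = rel_ar L r \<and> set is \<subseteq> {..<length a'}"
    then have "length (map ?f is) = rel_ar L r \<and> set (map ?f is) \<subseteq> {..<length (a @ a')}" by auto
    then have "map ((!) (a @ a')) (map ?f is) \<in> rel_int M r \<longleftrightarrow>
      map ((!) (b @ b')) (map ?f is) \<in> rel_int N r"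
      using assms(1) r(1) unfolding atom_eq_def by blast
    then show "map ((!) a') is \<in> rel_int M r \<longleftrightarrow> map ((!) b') is \<in> rel_int N r" by (simp only: 1)
  next
    fix f j "is" assume f: "f \<in> Funs L" "j < length a'" "length is = fun_ar L f \<and>
      set is \<subseteq> {..<length a'}"
    then have "length (map ?f is) = fun_ar L f \<and> set (map ?f is) \<subseteq> {..<length (a @ a')}"
      "?f j < length (a @ a')" by auto
    then have "fun_int M f (map ((!) (a @ a')) (map ?f is)) = (a @ a') ! ?f j \<longleftrightarrow>
      fun_int N f (map ((!) (b @ b')) (map ?f is)) = (b @ b') ! ?f j"
      using assms(1) f(1) unfolding atom_eq_def by blast
    then show "fun_int M f (map ((!) a') is) = a' ! j \<longleftrightarrow> fun_int N f (map ((!) b') is) = b' ! j"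
      by (simp only: 1 2)
  qed
qed

context
  fixes L :: "('r, 'f) language" and M :: "('r, 'f) struct"
  assumes L: "countable_language L" and M: "M \<in> Str L"
begin

interpretation perm_group "Aut L M" using M by (rule perm_group_Aut)

text \<open>The relation \<open>R\<close> keeps \<open>a\<close> and \<open>b\<close> as prefixes,
  which lets the back-and-forth start from empty lists. That the resulting automorphism maps
  \<open>a\<close> to \<open>b\<close> is recovered from equalities: each entry of \<open>a\<close>
  reappears in some list \<open>c\<close>, at a position where \<open>d\<close> repeats the matching
  entry of \<open>b\<close>.\<close>

lemma equiv_form_iff_sim: "equiv_form L M a b \<longleftrightarrow> sim (Aut L M) a b"
proof
  assume ab: "equiv_form L M a b"
  then have len: "length a = length b" unfolding equiv_form_def by simp
  define R where "R c d \<longleftrightarrow> length c = length d \<and> equiv_form L M (a @ c) (b @ d)" for c d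
  have "\<exists>g. bij g \<and> (\<forall>n. \<exists>c d. R c d \<and> {..<n} \<subseteq> set c \<and> map g c = d)"
  proof (rule back_and_forth)
    show "R [] []" using ab by (simp add: R_def)
    show "\<exists>d. R (c @ [x]) (e @ [d])" if "R c e" for c e x
      using equiv_form_extend[of L M "a @ c" "b @ e" x] that unfolding R_def by auto
    show "\<exists>d. R (c @ [d]) (e @ [x])" if "R c e" for c e x
      using equiv_form_extend[of L M "b @ e" "a @ c" x] that
      unfolding R_def by (auto dest: equiv_form_sym)
    show "length c = length d" if "R c d" for c d using that unfolding R_def by simp
    show "c ! i = c ! j \<longleftrightarrow> d ! i = d ! j" if "R c d" "i < length c" "j < length c" for c d i j
      using that equiv_form_nth_eq[of L M "a @ c" "b @ d" "length a + i" "length a + j"] len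
      unfolding R_def by (auto simp: nth_append)
  qed
  then obtain g where g: "bij g" "\<And>n. \<exists>c d. R c d \<and> {..<n} \<subseteq> set c \<and> map g c = d" by blast
  have "act L g M = M"
  proof (rule act_eqI[OF M M g(1)])
    fix n
    obtain c d where cd: "R c d" "{..<n} \<subseteq> set c" "map g c = d" using g by blast
    then have "atom_eq L M c M d"
      using equiv_form_atom_eq[of L M "a @ c" "b @ d"] len
      unfolding R_def by (blast intro: atom_eq_append)
    then show "\<exists>a b. atom_eq L M a M b \<and> {..<n} \<subseteq> set a \<and> map g a = b" using cd by blast
  qed
  then have "g \<in> Aut L M" using g by (simp add: Aut_iff_act[OF M])
  moreover have "map g a = b"
  proof (rule nth_equalityI)
    fix i assume i: "i < length (map g a)"
    obtain c d where cd: "R c d" "{..<Suc (a ! i)} \<subseteq> set c" "map g c = d" using g by blast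
    then obtain j where j: "j < length c" "c ! j = a ! i"
      by (meson in_set_conv_nth lessI lessThan_iff subsetD)
    then have "b ! i = d ! j"
      using cd(1) i equiv_form_nth_eq[of L M "a @ c" "b @ d" i "length a + j"] len
      unfolding R_def by (auto simp: nth_append)
    then show "map g a ! i = b ! i" using cd j i by auto
  qed (simp add: len)
  ultimately show "sim (Aut L M) a b" unfolding sim_def by blast
next
  assume "sim (Aut L M) a b"
  then obtain g where "g \<in> Aut L M" and gab: "map g a = b" unfolding sim_def by blast
  then have g: "bij g" "act L g M = M" "map g a = b" using Aut_iff_act[OF M] by auto
  have "sat M ((!) a) p = sat M ((!) b) p" if "wf_form L p" "fv p \<subseteq> {..<length a}" for p
  proof -
    have "sat M ((!) a) p = sat M (\<lambda>x. g (a ! x)) p" using sat_act[OF g(1) that(1), of M] g by simp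
    also have "\<dots> = sat M ((!) b) p" by (rule sat_cong) (use g that in auto)
    finally show ?thesis .
  qed
  then show "equiv_form L M a b" using g unfolding equiv_form_def by auto
qed

text \<open>The default is a sentence true in every structure. It makes the function total, so that
  the conjunction in \<open>type_form\<close> can run over the codes of all lists; one formula
  isolates a type because there are only countably many tuples to separate it from.\<close>

definition separator :: "nat list \<Rightarrow> nat list \<Rightarrow> ('r, 'f) form" where
  "separator a b = (if length a = length b \<and> \<not> equiv_form L M a b
     then SOME p. wf_form L p \<and> fv p \<subseteq> {..<length a} \<and> sat M ((!) a) p \<and> \<not> sat M ((!) b) p
     else Exists 0 (Eq (Var 0) (Var 0)))"

definition type_form :: "nat list \<Rightarrow> ('r, 'f) form" where
  "type_form a = Conj (\<lambda>n. separator a (from_nat n))"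

lemma separator: "wf_form L (separator a b)" "fv (separator a b) \<subseteq> {..<length a}"
  "sat M ((!) a) (separator a b)"
  "length a = length b \<Longrightarrow> \<not> equiv_form L M a b \<Longrightarrow> \<not> sat M ((!) b) (separator a b)"
proof -
  have "wf_form L (separator a b) \<and> fv (separator a b) \<subseteq> {..<length a} \<and>
    sat M ((!) a) (separator a b) \<and>
    (length a = length b \<and> \<not> equiv_form L M a b \<longrightarrow> \<not> sat M ((!) b) (separator a b))"
  proof (cases "length a = length b \<and> \<not> equiv_form L M a b")
    case True
    then have "\<exists>p. wf_form L p \<and> fv p \<subseteq> {..<length a} \<and> sat M ((!) a) p \<and> \<not> sat M ((!) b) p"
      using not_equiv_form by metis
    from someI_ex[OF this] show ?thesis using True unfolding separator_def by auto
  qed (auto simp: separator_def)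
  then show "wf_form L (separator a b)" "fv (separator a b) \<subseteq> {..<length a}"
    "sat M ((!) a) (separator a b)"
  "length a = length b \<Longrightarrow> \<not> equiv_form L M a b \<Longrightarrow> \<not> sat M ((!) b) (separator a b)" by auto
qed

lemma type_form: "wf_form L (type_form a)" "fv (type_form a) \<subseteq> {..<length a}"
  using separator(1,2) by (simp_all add: type_form_def UN_subset_iff)

lemma sat_type_form:
  assumes "length b = length a"
  shows "sat M ((!) b) (type_form a) \<longleftrightarrow> equiv_form L M a b"
proof
  assume "sat M ((!) b) (type_form a)"
  then have "sat M ((!) b) (separator a (from_nat (to_nat b)))"
    unfolding type_form_def by (simp del: from_nat_to_nat)
  then show "equiv_form L M a b" using separator(4)[of a b] assms by auto
next
  assume ab: "equiv_form L M a b"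
  have "sat M ((!) a) (type_form a)" using separator by (simp add: type_form_def)
  then show "sat M ((!) b) (type_form a)" using ab type_form unfolding equiv_form_def by blast
qed

text \<open>A Scott sentence for \<open>M\<close>, kept as a condition on \<open>N\<close> instead
  of a single formula; its later use is through measurability.\<close>

definition scott :: "('r, 'f) struct \<Rightarrow> bool" where
  "scott N \<longleftrightarrow> sat N ((!) []) (type_form []) \<and>
    (\<forall>a b. length b = length a \<longrightarrow> sat N ((!) b) (type_form a) \<longrightarrow>
      (\<forall>c. \<exists>d. sat N ((!) (b @ [d])) (type_form (a @ [c]))) \<and>
      (\<forall>d. \<exists>c. sat N ((!) (b @ [d])) (type_form (a @ [c]))) \<and>
      (\<forall>i<length a. \<forall>j<length a. a ! i = a ! j \<longleftrightarrow> b ! i = b ! j) \<and>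
      atom_eq L M a N b)"

text \<open>If \<open>N\<close> is a copy of \<open>M\<close>, each clause is checked in
  \<open>M\<close> on the preimage \<open>b'\<close> of \<open>b\<close>. Conversely, the clauses
  supply what \<open>back_and_forth\<close> and \<open>act_eqI\<close> ask for.\<close>

lemma orbit_eq_scott: "orbit L M = {N \<in> Str L. scott N}"
proof (intro equalityI subsetI)
  fix N assume "N \<in> orbit L M"
  then obtain g where g: "bij g" "N = act L g M" unfolding orbit_def by blast
  have N: "N \<in> Str L" using g M by (simp add: act_in_Str)
  have sat: "sat N ((!) (map g b)) p = sat M ((!) b) p" if "wf_form L p" "fv p \<subseteq> {..<length b}"
    for b p
  proof -
    have "sat N ((!) (map g b)) p = sat N (\<lambda>x. g (b ! x)) p" by (rule sat_cong) (use that in auto)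
    then show ?thesis using sat_act[OF g(1) that(1), of M] g by simp
  qed
  have sat': "sat N ((!) (map g b)) (type_form a) \<longleftrightarrow> equiv_form L M a b" if "length b = length a"
    for a b
    using sat[OF type_form(1)[of a]] type_form(2)[of a] sat_type_form[OF that] that by simp
  have atom: "atom_eq L M a N (map g b)" if "equiv_form L M a b" for a b
  proof -
    have "sat M ((!) a) p = sat N ((!) (map g b)) p" if "wf_form L p" "fv p \<subseteq> {..<length a}" for p
      using \<open>equiv_form L M a b\<close> that sat[of p b] unfolding equiv_form_def by auto
    then show ?thesis by (rule atom_eqI)
  qed
  have "scott N"
    unfolding scott_def
  proof (intro conjI allI impI)
    show "sat N ((!) []) (type_form [])"
      using sat'[of "[]" "[]"] by (simp add: equiv_form_iff_sim sim_refl)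
    fix a b :: "nat list" assume len: "length b = length a" and s: "sat N ((!) b) (type_form a)"
    define b' where "b' = map (inv g) b"
    have b: "b = map g b'" and len': "length b' = length a"
      using g len by (auto simp: b'_def bij_is_surj surj_f_inv_f intro!: map_idI[symmetric])
    have eq: "equiv_form L M a b'" using s sat'[OF len'] b by simp
    show "\<exists>d. sat N ((!) (b @ [d])) (type_form (a @ [c]))" for c
    proof -
      obtain d where "equiv_form L M (a @ [c]) (b' @ [d])" using equiv_form_extend[OF eq] by blast
      then have "sat N ((!) (map g (b' @ [d]))) (type_form (a @ [c]))"
        using sat' len' by (metis length_append_singleton)
      then show ?thesis using b by auto
    qed
    show "\<exists>c. sat N ((!) (b @ [d])) (type_form (a @ [c]))" for d
    proof -
      obtain c where "equiv_form L M (a @ [c]) (b' @ [inv g d])"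
        using equiv_form_extend[OF equiv_form_sym[OF eq], of "inv g d"] equiv_form_sym by blast
      then have "sat N ((!) (map g (b' @ [inv g d]))) (type_form (a @ [c]))"
        using sat' len' by (metis length_append_singleton)
      then show ?thesis using b g by (auto simp: bij_is_surj surj_f_inv_f)
    qed
    show "a ! i = a ! j \<longleftrightarrow> b ! i = b ! j" if "i < length a" "j < length a" for i j
      using equiv_form_nth_eq[OF eq that] that g len' by (auto simp: b bij_is_inj inj_eq)
    show "atom_eq L M a N b" using atom[OF eq] b by simp
  qed
  then show "N \<in> {N \<in> Str L. scott N}" using N by simp
next
  fix N assume "N \<in> {N \<in> Str L. scott N}"
  then have N: "N \<in> Str L" and sc: "scott N" by auto
  define R where "R a b \<longleftrightarrow> length b = length a \<and> sat N ((!) b) (type_form a)" for a b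
  have R: "(\<forall>c. \<exists>d. R (a @ [c]) (b @ [d])) \<and> (\<forall>d. \<exists>c. R (a @ [c]) (b @ [d])) \<and>
      (\<forall>i<length a. \<forall>j<length a. a ! i = a ! j \<longleftrightarrow> b ! i = b ! j) \<and>
        atom_eq L M a N b" if "R a b" for a b
    using sc that unfolding scott_def R_def by simp
  have "\<exists>g. bij g \<and> (\<forall>n. \<exists>a b. R a b \<and> {..<n} \<subseteq> set a \<and> map g a = b)"
  proof (rule back_and_forth)
    show "R [] []" using sc by (simp add: R_def scott_def)
    show "length a = length b" if "R a b" for a b using that unfolding R_def by simp
  qed (use R in blast)+
  then obtain g where g: "bij g" "\<And>n. \<exists>a b. R a b \<and> {..<n} \<subseteq> set a \<and> map g a = b" by blast
  have "act L g M = N"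
  proof (rule act_eqI[OF M N g(1)])
    show "\<exists>a b. atom_eq L M a N b \<and> {..<n} \<subseteq> set a \<and> map g a = b" for n using g(2)[of n] R by blast
  qed
  then show "N \<in> orbit L M" using g unfolding orbit_def by blast
qed

section \<open>Measurability of the orbit\<close>

lemma sat_measurable:
  assumes "wf_form L p" "fv p \<subseteq> {..<length b}"
  shows "Measurable.pred (Str_borel L) (\<lambda>N. sat N ((!) b) p)"
proof -
  have "{N \<in> Str L. sat N ((!) b) p} \<in> basic_open L"
    using assms unfolding basic_open_def by blast
  then have "openin (Str_topology L) {N \<in> Str L. sat N ((!) b) p}"
    unfolding Str_topology_def by (rule topology_generated_by_Basis)
  then have "{N \<in> Str L. sat N ((!) b) p} \<in> sets (Str_borel L)"
    by (simp add: sets_Str_borel sigma_sets.Basic)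
  then show ?thesis by (simp add: pred_def space_Str_borel)
qed

text \<open>Countability of the language enters here: the quantifiers over symbols become countable
  intersections.\<close>

lemma atom_eq_measurable:
  assumes "length b = length a"
  shows "Measurable.pred (Str_borel L) (\<lambda>N. atom_eq L M a N b)"
proof -
  have c: "countable (Rels L)" "countable (Funs L)" using L by (auto simp: countable_language_def)
  have 1: "Measurable.pred (Str_borel L) (\<lambda>N. length is = rel_ar L r \<and> set is \<subseteq> {..<length a} \<longrightarrow>
        (map ((!) a) is \<in> rel_int M r \<longleftrightarrow> map ((!) b) is \<in> rel_int N r))" if "r \<in> Rels L" for r "is"
  proof (rule pred_intros_imp')
    assume "is": "length is = rel_ar L r \<and> set is \<subseteq> {..<length a}"
    have "map ((!) b) is \<in> rel_int N r \<longleftrightarrow> sat N ((!) b) (Atom r (map Var is))" for N ::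
      "('r, 'f) struct"
      by (simp add: comp_def)
    moreover have "Measurable.pred (Str_borel L) (\<lambda>N. sat N ((!) b) (Atom r (map Var is)))"
      by (rule sat_measurable) (use "is" that assms in \<open>auto simp: list_all_iff\<close>)
    ultimately show "Measurable.pred (Str_borel L) (\<lambda>N. map ((!) a) is \<in> rel_int M r \<longleftrightarrow>
      map ((!) b) is \<in> rel_int N r)"
      by (simp only:) (intro pred_intros_logic(6) measurable_const UNIV_I; simp)
  qed
  have 2: "Measurable.pred (Str_borel L) (\<lambda>N. length is = fun_ar L f \<and> set is \<subseteq> {..<length a} \<longrightarrow>
        (fun_int M f (map ((!) a) is) = a ! j \<longleftrightarrow> fun_int N f (map ((!) b) is) = b ! j))"
    if "f \<in> Funs L" "j \<in> {..<length a}" for f "is" j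
  proof (rule pred_intros_imp')
    assume "is": "length is = fun_ar L f \<and> set is \<subseteq> {..<length a}"
    have "fun_int N f (map ((!) b) is) = b ! j \<longleftrightarrow> sat N ((!) b) (Eq (App f (map Var is)) (Var j))"
      for N :: "('r, 'f) struct"
      by (simp add: comp_def)
    moreover have "Measurable.pred (Str_borel L) (\<lambda>N. sat N ((!) b) (Eq (App f (map Var is)) (Var
      j)))"
      by (rule sat_measurable) (use "is" that assms in \<open>auto simp: list_all_iff\<close>)
    ultimately show "Measurable.pred (Str_borel L) (\<lambda>N. fun_int M f (map ((!) a) is) = a ! j \<longleftrightarrow>
      fun_int N f (map ((!) b) is) = b ! j)"
      by (simp only:) (intro pred_intros_logic(6) measurable_const UNIV_I; simp)
  qed
  have "(\<lambda>N. atom_eq L M a N b) = (\<lambda>N. (\<forall>r\<in>Rels L. \<forall>is. length is = rel_ar L r \<and>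
    set is \<subseteq> {..<length a} \<longrightarrow>
        (map ((!) a) is \<in> rel_int M r \<longleftrightarrow> map ((!) b) is \<in> rel_int N r)) \<and>
     (\<forall>f\<in>Funs L. \<forall>is. \<forall>j\<in>{..<length a}. length is = fun_ar L f \<and> set is \<subseteq> {..<length a} \<longrightarrow>
        (fun_int M f (map ((!) a) is) = a ! j \<longleftrightarrow> fun_int N f (map ((!) b) is) = b ! j)))"
    by (auto simp: atom_eq_def fun_eq_iff)
  also have "Measurable.pred (Str_borel L) \<dots>"
  proof (rule pred_intros_logic(3))
    show "Measurable.pred (Str_borel L) (\<lambda>N. \<forall>r\<in>Rels L. \<forall>is. length is = rel_ar L r \<and>
      set is \<subseteq> {..<length a} \<longrightarrow>
        (map ((!) a) is \<in> rel_int M r \<longleftrightarrow> map ((!) b) is \<in> rel_int N r))"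
      unfolding pred_def
      by (rule sets.sets_Collect_countable_All'[OF _ c(1)], rule sets.sets_Collect_countable_All,
          fold pred_def, rule 1)
    show "Measurable.pred (Str_borel L) (\<lambda>N. \<forall>f\<in>Funs L. \<forall>is. \<forall>j\<in>{..<length a}. length is =
      fun_ar L f \<and> set is \<subseteq> {..<length a} \<longrightarrow>
        (fun_int M f (map ((!) a) is) = a ! j \<longleftrightarrow> fun_int N f (map ((!) b) is) = b ! j))"
      unfolding pred_def
      by (rule sets.sets_Collect_countable_All'[OF _ c(2)], rule sets.sets_Collect_countable_All,
          rule sets.sets_Collect_countable_All'[OF _ countable_finite], fold pred_def, rule 2)
            simp_all
  qed
  finally show ?thesis .
qed

lemma scott_measurable: "Measurable.pred (Str_borel L) scott"
proof -
  have 0: "Measurable.pred (Str_borel L) (\<lambda>N. sat N ((!) b) (type_form a))" if "length b = length a"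
    for a b
    by (rule sat_measurable) (use type_form that in auto)
  have 1: "Measurable.pred (Str_borel L) (\<lambda>N. length b = length a \<longrightarrow> sat N ((!) b) (type_form a) \<longrightarrow>
      (\<forall>c. \<exists>d. sat N ((!) (b @ [d])) (type_form (a @ [c]))) \<and>
      (\<forall>d. \<exists>c. sat N ((!) (b @ [d])) (type_form (a @ [c]))) \<and>
      (\<forall>i<length a. \<forall>j<length a. a ! i = a ! j \<longleftrightarrow> b ! i = b ! j) \<and> atom_eq L M a N b)" for a b
  proof (rule pred_intros_imp')
    assume True: "length b = length a"
    have [measurable]: "Measurable.pred (Str_borel L) (\<lambda>N. sat N ((!) b) (type_form a))"
      "\<And>c d. Measurable.pred (Str_borel L) (\<lambda>N. sat N ((!) (b @ [d])) (type_form (a @ [c])))"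
      "Measurable.pred (Str_borel L) (\<lambda>N. atom_eq L M a N b)"
      by (rule 0 atom_eq_measurable; simp add: True)+
    show "Measurable.pred (Str_borel L) (\<lambda>N. sat N ((!) b) (type_form a) \<longrightarrow>
      (\<forall>c. \<exists>d. sat N ((!) (b @ [d])) (type_form (a @ [c]))) \<and>
      (\<forall>d. \<exists>c. sat N ((!) (b @ [d])) (type_form (a @ [c]))) \<and>
      (\<forall>i<length a. \<forall>j<length a. a ! i = a ! j \<longleftrightarrow> b ! i = b ! j) \<and> atom_eq L M a N b)"
      by measurable
  qed
  have [measurable]: "Measurable.pred (Str_borel L) (\<lambda>N. sat N ((!) []) (type_form []))"
    by (rule 0) simp
  show ?thesis
    unfolding scott_def[abs_def] using 1 by measurable
qed

lemma orbit_measurable: "orbit L M \<in> sets (Str_borel L)"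
  using scott_measurable by (simp add: orbit_eq_scott pred_def space_Str_borel)

end

section \<open>Cylinder sets on the orbit\<close>

text \<open>For \<open>N = act L g M\<close> the map \<open>inv g\<close> is an isomorphism from
  \<open>N\<close> to \<open>M\<close>, so \<open>map (inv g) b\<close> is the copy in
  \<open>M\<close> of the tuple \<open>b\<close> of \<open>N\<close>.\<close>

definition cyl :: "('r, 'f) language \<Rightarrow> ('r, 'f) struct \<Rightarrow> nat list set \<Rightarrow> nat list \<Rightarrow> ('r, 'f) struct
  set" where
  "cyl L M A b = {act L g M | g. bij g \<and> map (inv g) b \<in> A}"

abbreviation cls :: "(nat \<Rightarrow> nat) set \<Rightarrow> nat list \<Rightarrow> nat list set" where
  "cls G a \<equiv> {b. sim G a b}"

abbreviation type_cyl :: "('r, 'f) language \<Rightarrow> ('r, 'f) struct \<Rightarrow> nat list \<Rightarrow> ('r, 'f) struct set"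
  where
  "type_cyl L M a \<equiv> cyl L M (cls (Aut L M) a) [0..<length a]"

lemma map_inv: "bij g \<Longrightarrow> map (inv g) (map g s) = s" "bij g \<Longrightarrow> map g (map (inv g) s) = s"
  by (auto simp: bij_is_inj bij_is_surj surj_f_inv_f intro!: map_idI)

lemma map_inv_comp: "bij g \<Longrightarrow> bij h \<Longrightarrow> map (inv (g \<circ> h)) s = map (inv h) (map (inv g) s)"
  by (simp add: o_inv_distrib)

lemma inv_set_Compl: "perm_group G \<Longrightarrow> inv_set G A \<Longrightarrow> inv_set G (- A)"
  by (metis ComplD ComplI inv_set_def perm_group.inv_set_iff sim_def)

lemma inv_set_UN: "(\<And>i. i \<in> I \<Longrightarrow> inv_set G (A i)) \<Longrightarrow> inv_set G (\<Union>i\<in>I. A i)"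
  unfolding inv_set_def by auto

lemma inv_set_reindex:
  assumes "inv_set G A" "set b \<subseteq> {..<k}"
  shows "inv_set G {a. length a = k \<and> map ((!) a) b \<in> A}"
  unfolding inv_set_def
proof (intro ballI CollectI)
  fix g a assume g: "g \<in> G" and a: "a \<in> {a. length a = k \<and> map ((!) a) b \<in> A}"
  have "map ((!) (map g a)) b = map g (map ((!) a) b)" using a assms by (auto simp: subset_iff)
  then show "length (map g a) = k \<and> map ((!) (map g a)) b \<in> A"
    using assms(1) g a unfolding inv_set_def by (simp del: map_map)
qed

lemma invariant_measures_on_orbitD:
  assumes "\<mu> \<in> invariant_measures_on_orbit L M"
  shows "prob_space \<mu>" "sets \<mu> = sets (Str_borel L)" "space \<mu> = Str L"
    "orbit L M \<in> sets \<mu>" "emeasure \<mu> (orbit L M) = 1"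
    "\<And>g B. bij g \<Longrightarrow> B \<in> sets \<mu> \<Longrightarrow> emeasure \<mu> (act L g ` B) = emeasure \<mu> B"
  using assms sets_eq_imp_space_eq[of \<mu> "Str_borel L"]
  unfolding invariant_measures_on_orbit_def borel_prob_def concentrated_on_def invariant_def
  by (auto simp: space_Str_borel)

context
  fixes L :: "('r, 'f) language" and M :: "('r, 'f) struct"
  assumes L: "countable_language L" and M: "M \<in> Str L"
begin

interpretation perm_group "Aut L M" using M by (rule perm_group_Aut)

lemma act_in_orbit: "bij g \<Longrightarrow> act L g M \<in> orbit L M"
  unfolding orbit_def by blast

lemma orbit_subset_Str: "orbit L M \<subseteq> Str L"
  unfolding orbit_def using M by (auto simp: act_in_Str)

lemma act_eq_imp:
  assumes "bij g" "bij h" "act L g M = act L h M"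
  shows "inv h \<circ> g \<in> Aut L M"
proof -
  have "act L (inv h \<circ> g) M = act L (inv h) (act L g M)"
    using assms(1,2) by (simp add: act_act bij_imp_bij_inv)
  also have "\<dots> = act L (inv h \<circ> h) M"
    unfolding assms(3) using assms(1,2) by (simp add: act_act bij_imp_bij_inv)
  also have "\<dots> = M" using assms by (simp add: bij_is_inj act_id[OF M])
  finally show ?thesis using assms by (simp add: Aut_iff_act[OF M] bij_comp bij_imp_bij_inv)
qed

text \<open>The permutation that produces a given structure is unique up to an automorphism of
  \<open>M\<close>, and \<open>A\<close> is closed under automorphisms.\<close>

lemma act_in_cyl: 
  assumes "bij g" "inv_set (Aut L M) A"
  shows "act L g M \<in> cyl L M A b \<longleftrightarrow> map (inv g) b \<in> A"
proof
  assume "act L g M \<in> cyl L M A b"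
  then obtain h where h: "bij h" "act L g M = act L h M" "map (inv h) b \<in> A"
    unfolding cyl_def by auto
  have "map (inv h \<circ> g) (map (inv g) b) = map (inv h) b"
    using map_inv(2)[OF assms(1), of b] by (metis map_map)
  then have "sim (Aut L M) (map (inv g) b) (map (inv h) b)"
    unfolding sim_def using act_eq_imp[OF assms(1) h(1,2)] by blast
  then show "map (inv g) b \<in> A" using inv_set_iff[OF assms(2)] h by blast
qed (use assms in \<open>auto simp: cyl_def\<close>)

lemma cyl_subset: "cyl L M A b \<subseteq> orbit L M"
  unfolding cyl_def orbit_def by auto

lemma cyl_eqI:
  assumes "inv_set (Aut L M) A" "X \<subseteq> orbit L M" "\<And>g. bij g \<Longrightarrow> act L g M \<in> X \<longleftrightarrow> map (inv g) b \<in> A"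
  shows "X = cyl L M A b"
  using assms unfolding cyl_def orbit_def by blast

lemma cyl_Compl: "inv_set (Aut L M) A \<Longrightarrow> orbit L M - cyl L M A b = cyl L M (- A) b"
  by (rule cyl_eqI) (auto simp: act_in_cyl act_in_orbit inv_set_Compl perm_group_axioms)

lemma cyl_UN: "(\<And>i. i \<in> I \<Longrightarrow> inv_set (Aut L M) (A i)) \<Longrightarrow> (\<Union>i\<in>I. cyl L M (A i) b) =
  cyl L M (\<Union>i\<in>I. A i) b"
  by (rule cyl_eqI) (use cyl_subset in \<open>auto simp: act_in_cyl inv_set_UN\<close>)

lemma cyl_eq_UN_cls:
  assumes "inv_set (Aut L M) A"
  shows "cyl L M A b = (\<Union>a\<in>A. cyl L M (cls (Aut L M) a) b)"
proof -
  have "(\<Union>a\<in>A. cls (Aut L M) a) = A" using inv_set_iff[OF assms] sim_refl by blast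
  then show ?thesis by (simp add: cyl_UN inv_set_sim)
qed

lemma cyl_reindex:
  assumes "inv_set (Aut L M) A" "set b \<subseteq> {..<k}"
  shows "cyl L M A b = cyl L M {a. length a = k \<and> map ((!) a) b \<in> A} [0..<k]"
proof (rule cyl_eqI[OF inv_set_reindex[OF assms] cyl_subset])
  fix g :: "nat \<Rightarrow> nat" assume "bij g"
  moreover have "map ((!) (map (inv g) [0..<k])) b = map (inv g) b"
    using assms by (auto simp: subset_iff)
  ultimately show "act L g M \<in> cyl L M A b \<longleftrightarrow> map (inv g) [0..<k] \<in> {a. length a = k \<and>
    map ((!) a) b \<in> A}"
    using assms(1) by (simp only: act_in_cyl mem_Collect_eq length_map length_upt) simp
qed

lemma cyl_act:
  assumes "bij h" "inv_set (Aut L M) A"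
  shows "act L h ` cyl L M A b = cyl L M A (map h b)"
proof (rule cyl_eqI[OF assms(2)])
  show "act L h ` cyl L M A b \<subseteq> orbit L M"
    unfolding cyl_def using assms by (auto simp: act_act bij_comp intro!: act_in_orbit)
  fix g :: "nat \<Rightarrow> nat" assume g: "bij g"
  have bi: "bij (inv h)" using assms(1) by (rule bij_imp_bij_inv)
  have "act L h ` cyl L M A b = {N \<in> Str L. act L (inv h) N \<in> cyl L M A b}"
    by (rule act_image_eq[OF assms(1)]) (use cyl_subset orbit_subset_Str in blast)
  then have "act L g M \<in> act L h ` cyl L M A b \<longleftrightarrow> act L (inv h \<circ> g) M \<in> cyl L M A b"
    using M g bi by (simp add: act_in_Str act_act)
  also have "\<dots> \<longleftrightarrow> map (inv (inv h \<circ> g)) b \<in> A"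
    by (rule act_in_cyl) (use g bi assms in \<open>auto simp: bij_comp\<close>)
  also have "map (inv (inv h \<circ> g)) b = map (inv g) (map h b)"
    using g bi assms by (simp only: map_inv_comp inv_inv_eq)
  finally show "act L g M \<in> act L h ` cyl L M A b \<longleftrightarrow> map (inv g) (map h b) \<in> A" .
qed

lemma sat_act_nth:
  assumes "bij g" "wf_form L p" "fv p \<subseteq> {..<length b}"
  shows "sat (act L g M) ((!) b) p \<longleftrightarrow> sat M ((!) (map (inv g) b)) p"
proof -
  have "sat (act L g M) ((!) b) p = sat (act L g M) (\<lambda>x. g (map (inv g) b ! x)) p"
    by (rule sat_cong) (use assms in \<open>auto simp: bij_is_surj surj_f_inv_f subset_iff\<close>)
  then show ?thesis using sat_act[OF assms(1,2)] by simp
qed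

lemma cyl_cls_sets: "cyl L M (cls (Aut L M) a) b \<in> sets (Str_borel L)"
proof (cases "length b = length a")
  case True
  have fv: "fv (type_form L M a) \<subseteq> {..<length b}" using type_form[OF L M] True by auto
  have "{N \<in> space (Str_borel L). sat N ((!) b) (type_form L M a)} \<in> sets (Str_borel L)"
    using sat_measurable[OF L M type_form(1)[OF L M] fv] by (simp add: pred_def)
  then have "orbit L M \<inter> {N \<in> space (Str_borel L). sat N ((!) b) (type_form L M a)} \<in> sets
    (Str_borel L)"
    using orbit_measurable[OF L M] by blast
  also have "orbit L M \<inter> {N \<in> space (Str_borel L). sat N ((!) b) (type_form L M a)} =
    cyl L M (cls (Aut L M) a) b"
  proof (rule cyl_eqI[OF inv_set_sim])
    fix g :: "nat \<Rightarrow> nat" assume g: "bij g"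
    have "sat (act L g M) ((!) b) (type_form L M a) \<longleftrightarrow> sim (Aut L M) a (map (inv g) b)"
      using sat_act_nth[OF g type_form(1)[OF L M] fv] sat_type_form[OF L M, of
        "map (inv g) b" a] True
      by (simp add: equiv_form_iff_sim[OF L M])
    then show "act L g M \<in> orbit L M \<inter> {N \<in> space (Str_borel L). sat N ((!) b) (type_form L M a)}
        \<longleftrightarrow> map (inv g) b \<in> cls (Aut L M) a"
      using g M by (auto simp: act_in_orbit space_Str_borel act_in_Str)
  qed auto
  finally show ?thesis .
next
  case False
  then have "cyl L M (cls (Aut L M) a) b = {}" unfolding cyl_def by (auto dest: sim_length)
  then show ?thesis by simp
qed

lemma cyl_sets: "inv_set (Aut L M) A \<Longrightarrow> cyl L M A b \<in> sets (Str_borel L)"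
  by (subst cyl_eq_UN_cls) (auto intro!: sets.countable_UN' cyl_cls_sets)

section \<open>The type cylinders as a generator that determines measures on the orbit\<close>

definition cyl_base :: "('r, 'f) struct set set" where
  "cyl_base = insert {} (range (\<lambda>a. type_cyl L M a))"

text \<open>Types of initial segments form a tree: of two cylinders, the one for the longer tuple is
  contained in the other or disjoint from it. The second case is why \<open>{}\<close> belongs to
  the base.\<close>

lemma Int_stable_cyl_base: "Int_stable cyl_base"
proof (rule Int_stableI)
  have *: "type_cyl L M a \<inter> type_cyl L M b \<in> cyl_base"
    if "length a \<le> length b" for a b
  proof (cases "type_cyl L M a \<inter> type_cyl L M b = {}")
    case False
    then obtain g where g: "bij g" "act L g M \<in> type_cyl L M a"
      "act L g M \<in> type_cyl L M b" using cyl_subset unfolding orbit_def by blast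
    have sg: "sim (Aut L M) a (map (inv g) [0..<length a])"
      "sim (Aut L M) b (map (inv g) [0..<length b])"
      using g by (simp_all add: act_in_cyl inv_set_sim)
    have "type_cyl L M b \<subseteq> type_cyl L M a"
    proof
      fix N assume N: "N \<in> type_cyl L M b"
      then obtain h where h: "bij h" "N = act L h M" using cyl_subset unfolding orbit_def by blast
      have "sim (Aut L M) b (map (inv h) [0..<length b])"
        using N h by (simp add: act_in_cyl inv_set_sim)
      then have "sim (Aut L M) (map (inv g) [0..<length b]) (map (inv h) [0..<length b])"
        using sg sim_sym sim_trans by blast
      moreover have "[0..<length b] = [0..<length a] @ [length a..<length b]" 
        using that by (metis le_Suc_ex upt_add_eq_append zero_le)
      ultimately have "sim (Aut L M) (map (inv g) [0..<length a]) (map (inv h) [0..<length a])"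
        by (auto intro: sim_append)
      then have "sim (Aut L M) a (map (inv h) [0..<length a])" using sg(1) sim_trans by blast
      then show "N \<in> type_cyl L M a" using h by (simp add: act_in_cyl inv_set_sim)
    qed
    then have "type_cyl L M a \<inter> type_cyl L M b = type_cyl L M b"
      by auto
    then show ?thesis unfolding cyl_base_def by auto
  qed (auto simp: cyl_base_def)
  fix X Y assume "X \<in> cyl_base" "Y \<in> cyl_base"
  then show "X \<inter> Y \<in> cyl_base"
    unfolding cyl_base_def
  proof (elim insertE rangeE)
    fix a b assume "X = type_cyl L M a" "Y = type_cyl L M b"
    then show "X \<inter> Y \<in> insert {} (range (\<lambda>a. type_cyl L M a))"
      using *[of a b] *[of b a]
      unfolding cyl_base_def[symmetric] by (metis Int_commute nat_le_linear)
  qed auto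
qed

lemma cyl_base_subset: "cyl_base \<subseteq> Pow (orbit L M)"
  using cyl_subset unfolding cyl_base_def by blast

lemma cyl_base_sets: "X \<in> cyl_base \<Longrightarrow> X \<in> sets (Str_borel L)"
  unfolding cyl_base_def using cyl_cls_sets by auto

lemma cyl_sigma:
  assumes "inv_set (Aut L M) A"
  shows "cyl L M A b \<in> sigma_sets (orbit L M) cyl_base"
proof -
  interpret S: sigma_algebra "orbit L M" "sigma_sets (orbit L M) cyl_base"
    by (rule sigma_algebra_sigma_sets[OF cyl_base_subset])
  have *: "cyl L M A [0..<k] \<in> sigma_sets (orbit L M) cyl_base" if "inv_set (Aut L M) A" for A k
  proof -
    have "cyl L M (cls (Aut L M) a) [0..<k] \<in> sigma_sets (orbit L M) cyl_base" for a
    proof (cases "length a = k")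
      case True
      then show ?thesis unfolding cyl_base_def by (intro sigma_sets.Basic) auto
    next
      case False
      then have "cyl L M (cls (Aut L M) a) [0..<k] = {}"
        unfolding cyl_def by (auto dest: sim_length)
      then show ?thesis by (simp add: sigma_sets.Empty)
    qed
    then show ?thesis unfolding cyl_eq_UN_cls[OF that] by (intro S.countable_UN'') auto
  qed
  have b: "set b \<subseteq> {..<Suc (Max (set b))}" by (auto simp: less_Suc_eq_le)
  show ?thesis unfolding cyl_reindex[OF assms b] by (rule *[OF inv_set_reindex[OF assms b]])
qed

text \<open>On the orbit a basic open set is a cylinder, because satisfaction in \<open>M\<close> is
  invariant under automorphisms. An open set may be an uncountable union of basic ones; its trace is
  still a countable union, namely of the cylinders of single types whose tuples and points are coded
  by \<open>I\<close>.\<close>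

lemma borel_trace:
  assumes "B \<in> sets (Str_borel L)"
  shows "B \<inter> orbit L M \<in> sigma_sets (orbit L M) cyl_base"
proof -
  interpret S: sigma_algebra "orbit L M" "sigma_sets (orbit L M) cyl_base"
    by (rule sigma_algebra_sigma_sets[OF cyl_base_subset])
  have basic: "\<exists>A b. inv_set (Aut L M) A \<and> U \<inter> orbit L M = cyl L M A b" if bo: "U \<in> basic_open L"
    for U
  proof -
    obtain p ns where p: "wf_form L p" "fv p \<subseteq> {..<length ns}"
      and U: "U = {N \<in> Str L. sat N ((!) ns) p}" using bo unfolding basic_open_def by blast
    define A where "A = {a. length a = length ns \<and> sat M ((!) a) p}"
    have A: "inv_set (Aut L M) A"
      unfolding inv_set_def A_def
    proof (intro ballI CollectI)
      fix g a assume g: "g \<in> Aut L M" "a \<in> {a. length a = length ns \<and> sat M ((!) a) p}"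
      then have "equiv_form L M a (map g a)"
        using equiv_form_iff_sim[OF L M] unfolding sim_def by blast
      then show "length (map g a) = length ns \<and> sat M ((!) (map g a)) p"
        using g p unfolding equiv_form_def by auto
    qed
    have "U \<inter> orbit L M = cyl L M A ns"
      by (rule cyl_eqI[OF A]) (use sat_act_nth[OF _ p] M in \<open>auto simp: A_def U act_in_Str
        act_in_orbit\<close>)
    then show ?thesis using A by blast
  qed
  have "B \<in> sigma_sets (Str L) {U. openin (Str_topology L) U}"
    using assms by (simp add: sets_Str_borel)
  then show ?thesis
  proof induction
    case (Basic U)
    then obtain K where K: "K \<subseteq> basic_open L" "\<Union>K = U"
      unfolding openin_Str_topology union_of_def arbitrary_def by auto
    define I where "I = {(a, b). cyl L M (cls (Aut L M) a) b \<subseteq> U}"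
    have "U \<inter> orbit L M = (\<Union>(a, b)\<in>I. cyl L M (cls (Aut L M) a) b)"
    proof (intro equalityI subsetI)
      fix N assume N: "N \<in> U \<inter> orbit L M"
      then obtain V where V: "V \<in> K" "N \<in> V \<inter> orbit L M" using K by blast
      then obtain A b where A: "inv_set (Aut L M) A" "V \<inter> orbit L M = cyl L M A b"
        using basic K by blast
      then obtain a where a: "a \<in> A" "N \<in> cyl L M (cls (Aut L M) a) b" using V cyl_eq_UN_cls by auto
      then have "cyl L M (cls (Aut L M) a) b \<subseteq> U" using A V K cyl_eq_UN_cls[OF A(1), of b] by blast
      then show "N \<in> (\<Union>(a, b)\<in>I. cyl L M (cls (Aut L M) a) b)" using a unfolding I_def by blast
    qed (use cyl_subset in \<open>auto simp: I_def\<close>)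
    also have "\<dots> \<in> sigma_sets (orbit L M) cyl_base"
      by (intro S.countable_UN'') (auto intro: cyl_sigma inv_set_sim)
    finally show ?case .
  next
    case (Compl B)
    have "(Str L - B) \<inter> orbit L M = orbit L M - B \<inter> orbit L M" using orbit_subset_Str by auto
    then show ?case using Compl by (simp add: sigma_sets.Compl)
  next
    case (Union B)
    then show ?case
      unfolding Int_UN_distrib2[symmetric] by (simp add: sigma_sets.Union flip: UN_simps(4))
  qed (simp add: sigma_sets.Empty)
qed

lemma emeasure_orbit_Int:
  assumes "prob_space \<mu>" "sets \<mu> = sets (Str_borel L)" "emeasure \<mu> (orbit L M) = 1" "B \<in> sets \<mu>"
  shows "emeasure \<mu> B = emeasure \<mu> (B \<inter> orbit L M)"
proof -
  interpret prob_space \<mu> by fact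
  have "orbit L M \<in> sets \<mu>" using orbit_measurable[OF L M] assms by simp
  then have "AE N in \<mu>. N \<in> orbit L M" using assms(3)
    by (intro AE_prob_1) (simp add: emeasure_eq_measure)
  then show ?thesis
    using assms \<open>orbit L M \<in> sets \<mu>\<close> by (intro emeasure_eq_AE) auto
qed

lemma measure_eqI_cyl:
  assumes \<mu>: "prob_space \<mu>" "sets \<mu> = sets (Str_borel L)" "emeasure \<mu> (orbit L M) = 1"
    and \<nu>: "prob_space \<nu>" "sets \<nu> = sets (Str_borel L)" "emeasure \<nu> (orbit L M) = 1"
    and eq: "\<And>a. emeasure \<mu> (type_cyl L M a) = emeasure \<nu> (type_cyl L M a)"
  shows "\<mu> = \<nu>"
proof (rule measure_eqI)
  interpret \<mu>: prob_space \<mu> by fact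
  interpret \<nu>: prob_space \<nu> by fact
  interpret S: sigma_algebra "orbit L M" "sigma_sets (orbit L M) cyl_base"
    by (rule sigma_algebra_sigma_sets[OF cyl_base_subset])
  have o: "orbit L M \<in> sets (Str_borel L)" by (rule orbit_measurable[OF L M])
  have sets: "X \<in> sets (Str_borel L)" if "X \<in> sigma_sets (orbit L M) cyl_base" for X
    using that o by induction (auto intro: cyl_base_sets)
  have *: "emeasure \<mu> X = emeasure \<nu> X" if "X \<in> sigma_sets (orbit L M) cyl_base" for X
    using Int_stable_cyl_base cyl_base_subset that
  proof (induction rule: sigma_sets_induct_disjoint)
    case (basic X)
    then show ?case using eq unfolding cyl_base_def by auto
  next
    case (compl X)
    then show ?case using sets[OF compl(1)] o \<mu> \<nu> S.sets_into_space
      by (subst (1 2) emeasure_Diff) auto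
  next
    case (union X)
    then have "range X \<subseteq> sets \<mu>" "range X \<subseteq> sets \<nu>" using sets \<mu> \<nu> by auto
    then show ?case using union by (simp add: suminf_emeasure[symmetric])
  qed simp
  show "sets \<mu> = sets \<nu>" using \<mu> \<nu> by simp
  fix B assume "B \<in> sets \<mu>"
  then show "emeasure \<mu> B = emeasure \<nu> B"
    using emeasure_orbit_Int[OF \<mu>, of B] emeasure_orbit_Int[OF \<nu>, of B] borel_trace[of B] * \<mu> \<nu>
    by simp
qed

lemma vimage_act:
  assumes "bij g" "B \<in> sets (Str_borel L)"
  shows "act L (inv g) -` B \<inter> Str L = act L g ` B"
  using sets.sets_into_space[OF assms(2)]
  by (subst act_image_eq[OF assms(1)]) (auto simp: space_Str_borel)

lemma act_measurable:
  assumes "bij g"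
  shows "act L (inv g) \<in> measurable (Str_borel L) (Str_borel L)"
  by (rule measurableI)
    (auto simp: space_Str_borel act_in_Str vimage_act[OF assms] act_image_sets[OF assms])

text \<open>The image of \<open>\<mu>\<close> under \<open>act L (inv g)\<close> is again
  concentrated on the orbit, so agreement on type cylinders identifies it with
  \<open>\<mu>\<close>.\<close>

lemma invariantI:
  assumes \<mu>: "prob_space \<mu>" "sets \<mu> = sets (Str_borel L)" "emeasure \<mu> (orbit L M) = 1"
    and eq: "\<And>g a. bij g \<Longrightarrow> emeasure \<mu> (cyl L M (cls (Aut L M) a) (map g [0..<length a])) =
      emeasure \<mu> (type_cyl L M a)"
  shows "invariant L \<mu>"
  unfolding invariant_def
proof (intro allI impI ballI)
  fix g :: "nat \<Rightarrow> nat" and B assume g: "bij g" and B: "B \<in> sets \<mu>"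
  interpret prob_space \<mu> by fact
  let ?\<nu> = "distr \<mu> (Str_borel L) (act L (inv g))"
  have m: "act L (inv g) \<in> measurable \<mu> (Str_borel L)"
    using act_measurable[OF g] measurable_cong_sets[OF \<mu>(2) refl] by blast
  have sp: "space \<mu> = Str L" using sets_eq_imp_space_eq[OF \<mu>(2)] by (simp add: space_Str_borel)
  have em: "emeasure ?\<nu> X = emeasure \<mu> (act L g ` X)" if "X \<in> sets (Str_borel L)" for X
    using that by (simp add: emeasure_distr[OF m] sp vimage_act[OF g])
  have "?\<nu> = \<mu>"
  proof (rule measure_eqI_cyl[OF _ _ _ \<mu>])
    show "prob_space ?\<nu>" by (rule prob_space_distr[OF m])
    have "orbit L M = cyl L M UNIV []" by (rule cyl_eqI) (auto simp: inv_set_def act_in_orbit)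
    then have "act L g ` orbit L M = orbit L M"
      using cyl_act[OF g, of UNIV "[]"] by (simp add: inv_set_def)
    then show "emeasure ?\<nu> (orbit L M) = 1" using em[OF orbit_measurable[OF L M]] \<mu> by simp
    show "emeasure ?\<nu> (type_cyl L M a) = emeasure \<mu> (type_cyl L M a)" for a
      by (subst em[OF cyl_cls_sets]) (simp add: cyl_act[OF g inv_set_sim] eq[OF g])
  qed simp
  then show "emeasure \<mu> (act L g ` B) = emeasure \<mu> B" using em[of B] B \<mu> by simp
qed

end

section \<open>Trivial definable closure and high homogeneity\<close>

lemma bij_extends_lists:
  fixes a b :: "'a list"
  assumes "length a = length b" "distinct a" "distinct b"
  shows "\<exists>g. bij g \<and> map g a = b"
  using assms
proof (induction a b rule: list_induct2)
  case (Cons x xs y ys)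
  then obtain g where g: "bij g" "map g xs = ys" by auto
  \<comment> \<open>Redirecting \<open>g x\<close> to \<open>y\<close> by a transposition leaves the
    tail alone, as neither of them lies in \<open>ys\<close>.\<close>
  have "g x \<notin> set ys" using Cons.prems g by (auto simp: bij_is_inj inj_eq)
  then have "map (Transposition.transpose (g x) y \<circ> g) xs = ys"
    using Cons.prems g(2)
    unfolding map_map[symmetric] g(2) by (intro map_idI) (auto simp: Transposition.transpose_def)
  moreover have "bij (Transposition.transpose (g x) y \<circ> g)" using g(1) by (intro bij_comp) auto
  moreover have "(Transposition.transpose (g x) y \<circ> g) x = y" by simp
  ultimately show ?case by (metis list.simps(9))
qed (auto intro!: exI[of _ id])

lemma (in prob_space) equal_disjoint_null:
  assumes I: "infinite I" and X: "\<And>i. i \<in> I \<Longrightarrow> X i \<in> events" and p: "\<And>i. i \<in> I \<Longrightarrow> prob (X i) = p"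
    and disj: "disjoint_family_on X I"
  shows "p = 0"
proof (rule ccontr)
  assume "p \<noteq> 0"
  have "p > 0" using p I \<open>p \<noteq> 0\<close> by (metis finite.emptyI ex_in_conv measure_nonneg order_le_less)
  then obtain n :: nat where n: "1 < real n * p" using reals_Archimedean3 by blast
  obtain J where J: "J \<subseteq> I" "finite J" "card J = n" using I by (meson infinite_arbitrarily_large)
  have "prob (\<Union>i\<in>J. X i) = (\<Sum>i\<in>J. prob (X i))"
    using J X disj by (intro finite_measure_finite_Union) (auto intro: disjoint_family_on_mono)
  also have "\<dots> = real n * p" using J p by (simp add: subset_iff)
  finally show False using n prob_le_1 by (metis not_le)
qed

definition high_hom :: "(nat \<Rightarrow> nat) set \<Rightarrow> bool" where
  "high_hom G \<longleftrightarrow> (\<forall>X Y. finite X \<longrightarrow> finite Y \<longrightarrow> card X = card Y \<longrightarrow> (\<exists>f\<in>G. f ` X = Y))"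

definition fixed_pts :: "(nat \<Rightarrow> nat) set \<Rightarrow> nat set \<Rightarrow> nat set" where
  "fixed_pts G A = {b. \<forall>g\<in>G. (\<forall>x\<in>A. g x = x) \<longrightarrow> g b = b}"

lemma highly_homogeneous_iff: "highly_homogeneous L M \<longleftrightarrow> high_hom (Aut L M)"
  unfolding highly_homogeneous_def high_hom_def by metis

lemma trivial_dcl_iff: "trivial_dcl L M \<longleftrightarrow> (\<forall>A. finite A \<longrightarrow> fixed_pts (Aut L M) A = A)"
proof -
  have "dcl L M a = fixed_pts (Aut L M) (set a)" for a unfolding dcl_def fixed_pts_def ..
  then show ?thesis unfolding trivial_dcl_def using finite_list by (metis finite_set)
qed

context perm_group
begin

lemma fixed_pts_subset: "A \<subseteq> fixed_pts G A"
  unfolding fixed_pts_def by auto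

lemma fixed_pts_mono: "A \<subseteq> B \<Longrightarrow> fixed_pts G A \<subseteq> fixed_pts G B"
  unfolding fixed_pts_def by blast

lemma fixed_pts_idem: "fixed_pts G (fixed_pts G A) = fixed_pts G A"
  unfolding fixed_pts_def by blast

lemma fixed_pts_image:
  assumes "f \<in> G" "fixed_pts G A = A"
  shows "fixed_pts G (f ` A) = f ` A"
proof
  have f: "bij f" using assms G_bij by auto
  show "fixed_pts G (f ` A) \<subseteq> f ` A"
  proof
    fix b assume b: "b \<in> fixed_pts G (f ` A)"
    have "inv f b \<in> fixed_pts G A"
      unfolding fixed_pts_def
    proof (intro CollectI ballI impI)
      fix g assume g: "g \<in> G" "\<forall>x\<in>A. g x = x"
      have "f \<circ> g \<circ> inv f \<in> G" using assms g by (simp add: G_comp G_inv)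
      moreover have "\<forall>x\<in>f ` A. (f \<circ> g \<circ> inv f) x = x" using g f by (simp add: bij_is_inj)
      ultimately have "f (g (inv f b)) = b" using b unfolding fixed_pts_def by fastforce
      then show "g (inv f b) = inv f b" using f by (metis bij_inv_eq_iff)
    qed
    then show "b \<in> f ` A" unfolding assms(2) using f
      by (intro image_eqI[of _ _ "inv f b"]) (simp_all add: bij_is_surj surj_f_inv_f)
  qed
qed (rule fixed_pts_subset)

text \<open>Move \<open>A\<close> together with a point \<open>b\<close> of its closure onto
  \<open>{..card A}\<close>. The enumeration \<open>a @ [b]\<close> then has one of finitely many
  images. If \<open>b\<close> and \<open>c\<close> give the same image, comparing the two moves
  yields an element of \<open>G\<close> that fixes \<open>A\<close> pointwise and takes
  \<open>b\<close> to \<open>c\<close>; as it must fix \<open>b\<close>, the two points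
  coincide.\<close>

lemma finite_fixed_pts:
  assumes hh: "high_hom G" and A: "finite A"
  shows "finite (fixed_pts G A)"
proof -
  obtain a where a: "set a = A" using A finite_list by blast
  define D where "D = fixed_pts G A - A"
  have "\<exists>f\<in>G. f ` insert b A = {..card A}" if "b \<in> D" for b
  proof -
    have "card (insert b A) = card {..card A}" "finite (insert b A)"
      using A that by (auto simp: D_def)
    then show ?thesis using hh unfolding high_hom_def by blast
  qed
  then obtain F where F: "\<And>b. b \<in> D \<Longrightarrow> F b \<in> G" "\<And>b. b \<in> D \<Longrightarrow> F b ` insert b A = {..card A}" by metis
  have "inj_on (\<lambda>b. map (F b) (a @ [b])) D"
  proof (rule inj_onI)
    fix b c assume b: "b \<in> D" and c: "c \<in> D" and eq: "map (F b) (a @ [b]) = map (F c) (a @ [c])"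
    let ?h = "inv (F c) \<circ> F b"
    have inj: "inj (F c)" using F c G_bij bij_is_inj by blast
    have "?h \<in> G" using F b c by (simp add: G_comp G_inv)
    moreover have "?h x = x" if "x \<in> A" for x
    proof -
      have "F b x = F c x" using eq that a by (auto simp: map_eq_conv)
      then show ?thesis using inj by simp
    qed
    ultimately have "?h b = b" using b unfolding D_def fixed_pts_def by blast
    moreover have "?h b = c" using eq inj by simp
    ultimately show "b = c" by simp
  qed
  moreover have "(\<lambda>b. map (F b) (a @ [b])) ` D \<subseteq> {xs. set xs \<subseteq> {..card A} \<and>
    length xs = Suc (length a)}"
    using F(2) a by auto
  ultimately have "finite D"
    by (rule inj_on_finite) (rule finite_lists_length_eq, simp)
  then show ?thesis using A by (auto simp: D_def)
qed

text \<open>The closure of \<open>A\<close> is closed and finite, and images of closed sets are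
  closed, so every set of the same size is closed. If the closure contained a new point
  \<open>b\<close>, padding \<open>A\<close> to that size while avoiding \<open>b\<close> would give
  a closed set that contains \<open>A\<close> but misses \<open>b\<close>.\<close>

lemma high_hom_fixed_pts:
  assumes hh: "high_hom G" and A: "finite A"
  shows "fixed_pts G A = A"
proof (rule ccontr)
  assume "fixed_pts G A \<noteq> A"
  then obtain b where b: "b \<in> fixed_pts G A" "b \<notin> A" using fixed_pts_subset by blast
  let ?D = "fixed_pts G A"
  have fin: "finite ?D" by (rule finite_fixed_pts[OF assms])
  have "card A \<le> card ?D" using fin fixed_pts_subset by (rule card_mono)
  moreover have "infinite (UNIV - insert b A)" using A by simp
  then obtain E where E: "E \<subseteq> UNIV - insert b A" "finite E" "card E = card ?D - card A"
    by (meson infinite_arbitrarily_large)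
  moreover have "card (A \<union> E) = card A + card E" using A E by (intro card_Un_disjoint) auto
  ultimately have "card ?D = card (A \<union> E)" by simp
  then obtain f where f: "f \<in> G" "f ` ?D = A \<union> E"
    using hh fin A E unfolding high_hom_def by (metis finite_Un)
  then have "fixed_pts G (A \<union> E) = A \<union> E" using fixed_pts_image[OF f(1) fixed_pts_idem] by metis
  then have "b \<in> A \<union> E" using b fixed_pts_mono[of A "A \<union> E"] by blast
  then show False using b E by blast
qed

end

section \<open>Upper bounds on the number of invariant measures\<close>

context
  fixes L :: "('r, 'f) language" and M :: "('r, 'f) struct"
  assumes L: "countable_language L" and M: "M \<in> Str L"
begin

interpretation perm_group "Aut L M" using M by (rule perm_group_Aut)

lemma highly_homogeneous_imp_trivial_dcl: "highly_homogeneous L M \<Longrightarrow> trivial_dcl L M"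
  unfolding highly_homogeneous_iff trivial_dcl_iff using high_hom_fixed_pts by blast

text \<open>The event \<open>X c d\<close> says that \<open>(c, d)\<close> looks like
  \<open>(a, b)\<close>. Countably many such events cover the orbit, so one has positive measure.
  For fixed \<open>c\<close> they are disjoint, because the copy of \<open>b\<close> is determined
  by the copy of \<open>a\<close>; they have equal measure, because a transposition exchanges their
  last points.\<close>

lemma nontrivial_dcl_no_measure:
  assumes "\<not> trivial_dcl L M"
  shows "\<mu> \<notin> invariant_measures_on_orbit L M"
proof
  assume "\<mu> \<in> invariant_measures_on_orbit L M"
  note \<mu> = invariant_measures_on_orbitD[OF this]
  interpret prob_space \<mu> by (rule \<mu>)
  obtain A b where A: "finite A" and b: "b \<in> fixed_pts (Aut L M) A" "b \<notin> A"
    using assms fixed_pts_subset unfolding trivial_dcl_iff by blast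
  obtain a where a: "set a = A" using A finite_list by blast
  let ?C = "cls (Aut L M) (a @ [b])"
  define X where "X c d = cyl L M ?C (c @ [d])" for c d
  have X: "X c d \<in> sets \<mu>" for c d unfolding X_def by (simp add: \<mu> cyl_cls_sets[OF L M])
  have "orbit L M \<subseteq> (\<Union>(c, d)\<in>UNIV. X c d)"
  proof
    fix N assume "N \<in> orbit L M"
    then obtain g where g: "bij g" "N = act L g M" unfolding orbit_def by blast
    then have "map (inv g) (map g (a @ [b])) = a @ [b]" by (simp only: map_inv)
    then have "N \<in> X (map g a) (g b)"
      using g by (simp add: X_def act_in_cyl[OF L M g(1) inv_set_sim] sim_refl)
    then show "N \<in> (\<Union>(c, d)\<in>UNIV. X c d)" by blast
  qed
  then have "emeasure \<mu> (\<Union>(c, d)\<in>UNIV. X c d) \<noteq> 0"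
  proof -
    have "(\<Union>(c, d)\<in>UNIV. X c d) \<in> sets \<mu>"
      unfolding case_prod_unfold by (rule sets.countable_UN') (auto intro: X)
    then have "1 \<le> emeasure \<mu> (\<Union>(c, d)\<in>UNIV. X c d)"
      using \<mu>(5) emeasure_mono[OF \<open>orbit L M \<subseteq> _\<close>, of \<mu>] by simp
    then show ?thesis by auto
  qed
  moreover have "emeasure \<mu> (\<Union>(c, d)\<in>UNIV. X c d) = 0" if "\<And>c d. emeasure \<mu> (X c d) = 0"
  proof -
    have "(\<Union>p\<in>UNIV. X (fst p) (snd p)) \<in> null_sets \<mu>"
      by (rule null_sets_UN') (use that X in auto)
    then show ?thesis by (simp add: case_prod_unfold null_sets_def)
  qed
  ultimately obtain c d where cd: "emeasure \<mu> (X c d) \<noteq> 0" by blast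
  then have "X c d \<noteq> {}" by auto
  then obtain g h where g: "h \<in> Aut L M" "map h (a @ [b]) = map (inv g) (c @ [d])"
    unfolding X_def cyl_def sim_def by blast
  \<comment> \<open>This allows the transposition of \<open>d\<close> and \<open>e\<close> below to
    fix \<open>c\<close>.\<close>
  have "d \<notin> set c"
  proof
    assume "d \<in> set c"
    then have "inv g d \<in> set (map (inv g) c)" by simp
    moreover have "map (inv g) c = map h a" "inv g d = h b" using g(2) by simp_all
    ultimately have "h b \<in> h ` A" using a by simp
    then show False using G_bij[OF g(1)] b by (auto simp: bij_is_inj inj_eq)
  qed
  have "measure \<mu> (X c d) = 0"
  proof (rule equal_disjoint_null)
    show "infinite (- set c)" by simp
    show "X c e \<in> sets \<mu>" for e by (rule X)
    show "measure \<mu> (X c e) = measure \<mu> (X c d)" if "e \<in> - set c" for e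
    proof -
      have "map (Transposition.transpose d e) c = c"
        using that \<open>d \<notin> set c\<close> by (intro map_idI) (auto simp: Transposition.transpose_def)
      then have "act L (Transposition.transpose d e) ` X c d = X c e"
        unfolding X_def by (subst cyl_act[OF L M bij_transpose inv_set_sim]) simp
      then have "emeasure \<mu> (X c e) = emeasure \<mu> (X c d)" using \<mu>(6)[OF bij_transpose X] by metis
      then show ?thesis by (simp add: measure_def)
    qed
    show "disjoint_family_on (X c) (- set c)"
      unfolding disjoint_family_on_def
    proof (intro ballI impI equals0I)
      fix e e' N assume ne: "e \<noteq> e'" and N: "N \<in> X c e \<inter> X c e'"
      then obtain h where h: "bij h" "N = act L h M" unfolding X_def cyl_def by blast
      have mem: "act L h M \<in> X c e \<longleftrightarrow> sim (Aut L M) (a @ [b]) (map (inv h) (c @ [e]))" for e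
        using act_in_cyl[OF L M h(1) inv_set_sim] unfolding X_def by simp
      obtain k where k: "k \<in> Aut L M" "map k (a @ [b]) = map (inv h) (c @ [e])"
        using mem[of "e"] N h(2) unfolding sim_def by blast
      obtain k' where k': "k' \<in> Aut L M" "map k' (a @ [b]) = map (inv h) (c @ [e'])"
        using mem[of "e'"] N h(2) unfolding sim_def by blast
      have "map k a = map k' a" using k k' by simp
      then have "\<forall>x\<in>A. k x = k' x" using a by auto
      moreover have bk: "inj k'" using k' G_bij bij_is_inj by blast
      ultimately have "\<forall>x\<in>A. (inv k' \<circ> k) x = x" by simp
      moreover have "inv k' \<circ> k \<in> Aut L M" using k k' by (simp add: G_comp G_inv)
      ultimately have "(inv k' \<circ> k) b = b" using b unfolding fixed_pts_def by blast
      then have "k b = k' b" using k' G_bij by (metis bij_inv_eq_iff comp_apply)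
      then have "inv h e = inv h e'" using k k' by simp
      then show False using ne h by (metis bij_inv_eq_iff)
    qed
  qed
  then show False using cd by (simp add: emeasure_eq_measure)
qed

lemma cls_eq: "sim (Aut L M) a b \<Longrightarrow> cls (Aut L M) a = cls (Aut L M) b"
  using sim_sym sim_trans by blast

lemma cyl_cls_permute:
  assumes "set is = {..<length a}"
  shows "type_cyl L M a = cyl L M (cls (Aut L M) (map ((!) a) is)) is"
proof (rule cyl_eqI[OF L M inv_set_sim cyl_subset[OF L M]])
  fix g :: "nat \<Rightarrow> nat" assume g: "bij g"
  have "sim (Aut L M) a (map (inv g) [0..<length a]) \<longleftrightarrow>
    sim (Aut L M) (map ((!) a) is) (map (inv g) is)"
  proof -
    have "map h a = map (inv g) [0..<length a] \<longleftrightarrow> map h (map ((!) a) is) = map (inv g) is" for h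
    proof -
      have "map h a = map (inv g) [0..<length a] \<longleftrightarrow> (\<forall>i\<in>{..<length a}. h (a ! i) = inv g i)"
      proof -
        have "map h a = map (\<lambda>i. h (a ! i)) [0..<length a]" by (rule nth_equalityI) auto
        then show ?thesis by (simp add: atLeast0LessThan)
      qed
      also have "\<dots> \<longleftrightarrow> (\<forall>i\<in>set is. h (a ! i) = inv g i)" using assms by auto
      finally show ?thesis by auto
    qed
    then show ?thesis unfolding sim_def by simp
  qed
  then show "act L g M \<in> type_cyl L M a \<longleftrightarrow> map (inv g) is \<in> cls (Aut L M) (map ((!) a) is)"
    using act_in_cyl[OF L M g inv_set_sim] by simp
qed

lemma sim_map: "f \<in> Aut L M \<Longrightarrow> sim (Aut L M) a (map f a)"
  unfolding sim_def by blast

text \<open>The value \<open>1 / card (U k)\<close> obtained for every type cylinder of distinct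
  \<open>k\<close>-tuples does not refer to the measure. Taking \<open>U k\<close> as a set of
  cylinders counts equivalent tuples once.\<close>

lemma highly_homogeneous_at_most_one:
  assumes hh: "highly_homogeneous L M"
    and \<mu>: "\<mu> \<in> invariant_measures_on_orbit L M" and \<nu>: "\<nu> \<in> invariant_measures_on_orbit L M"
  shows "\<mu> = \<nu>"
proof -
  define U where "U k = (\<lambda>a. cyl L M (cls (Aut L M) a) [0..<k]) ` {a. distinct a \<and>
    length a = k}" for k
  have hom: "\<exists>f\<in>Aut L M. f ` X = Y" if "finite X" "finite Y" "card X = card Y" for X Y
    using hh that unfolding highly_homogeneous_iff high_hom_def by blast
  \<comment> \<open>Every \<open>k\<close>-set can be moved onto \<open>{..<k}\<close>, so each type
    has a representative in a finite set of lists.\<close>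
  have finU: "finite (U k)" for k
  proof -
    have "U k \<subseteq> (\<lambda>c. cyl L M (cls (Aut L M) c) [0..<k]) ` {c. set c \<subseteq> {..<k} \<and> length c = k}"
    proof
      fix X assume "X \<in> U k"
      then obtain a where a: "distinct a" "length a = k" "X = cyl L M (cls (Aut L M) a) [0..<k]"
        unfolding U_def by auto
      then obtain f where "f \<in> Aut L M" "f ` set a = {..<k}"
        using hom[of "set a" "{..<k}"] by (auto simp: distinct_card)
      then show "X \<in> (\<lambda>c. cyl L M (cls (Aut L M) c) [0..<k]) ` {c. set c \<subseteq> {..<k} \<and> length c = k}"
        using a cls_eq[of a "map f a"] by (intro image_eqI[of _ _ "map f a"]) (auto simp: sim_map)
    qed
    then show ?thesis by (rule finite_subset) (intro finite_imageI finite_lists_length_eq, simp)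
  qed
  have val: "emeasure \<mu> (type_cyl L M a) = ennreal (1 / card (U (length a)))"
    if \<mu>: "\<mu> \<in> invariant_measures_on_orbit L M" and a: "distinct a" for \<mu> a
  proof -
    note \<mu> = invariant_measures_on_orbitD[OF \<mu>]
    interpret prob_space \<mu> by (rule \<mu>)
    let ?k = "length a"
    let ?v = "measure \<mu> (cyl L M (cls (Aut L M) a) [0..<?k])"
    have eq: "measure \<mu> X = ?v" if X: "X \<in> U ?k" for X
    proof -
      obtain b where b: "distinct b" "length b = ?k" "X = cyl L M (cls (Aut L M) b) [0..<?k]"
        using X unfolding U_def by auto
      obtain f where f: "f \<in> Aut L M" "f ` set a = set b"
        using hom[of "set a" "set b"] a b by (auto simp: distinct_card)
      obtain "is" where "is": "length is = length b" "set is \<subseteq> {..<length (map f a)}"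
        "map ((!) (map f a)) is = b"
        using list_indices[of b "map f a"] f by auto
      have "distinct is" using "is"(3) b(1) by (metis distinct_map)
      then have "set is = {..<length (map f a)}"
        using "is" b by (intro card_subset_eq) (auto simp: distinct_card)
      then have "cyl L M (cls (Aut L M) (map f a)) [0..<length (map f a)] =
        cyl L M (cls (Aut L M) b) is"
        using cyl_cls_permute[of "is" "map f a"] "is" by simp
      moreover have "cls (Aut L M) (map f a) = cls (Aut L M) a"
        using cls_eq[of a "map f a"] sim_map f by blast
      \<comment> \<open>Reordering the tuple amounts to permuting the points
        \<open>[0..<?k]\<close>, and invariance applies to any extension of that
        permutation.\<close>
      moreover obtain g where g: "bij g" "map g [0..<?k] = is"
        using bij_extends_lists[of "[0..<?k]" "is"] \<open>distinct is\<close> "is" b by auto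
      have "act L g ` X = cyl L M (cls (Aut L M) b) is"
        using b g by (simp add: cyl_act[OF L M g(1) inv_set_sim])
      ultimately have "act L g ` X = cyl L M (cls (Aut L M) a) [0..<?k]" by simp
      moreover have "X \<in> sets \<mu>" using b by (simp add: \<mu> cyl_cls_sets[OF L M])
      ultimately show ?thesis using \<mu>(6)[OF g(1), of X] by (simp add: measure_def)
    qed
    have Un: "\<Union>(U ?k) = orbit L M"
    proof (intro equalityI subsetI)
      fix N assume "N \<in> orbit L M"
      then obtain g where g: "bij g" "N = act L g M" unfolding orbit_def by blast
      let ?c = "map (inv g) [0..<?k]"
      have "N \<in> cyl L M (cls (Aut L M) ?c) [0..<?k]"
        using g by (simp add: act_in_cyl[OF L M g(1) inv_set_sim] sim_refl)
      moreover have "distinct ?c"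
        using g by (simp add: distinct_map bij_imp_bij_inv bij_is_inj inj_on_subset[OF bij_is_inj])
      ultimately show "N \<in> \<Union>(U ?k)"
        unfolding U_def by (intro UnionI[of "cyl L M (cls (Aut L M) ?c) [0..<?k]"]) auto
    qed (use cyl_subset[OF L M] in \<open>auto simp: U_def\<close>)
    have disj: "disjoint_family_on (\<lambda>X. X) (U ?k)"
      unfolding disjoint_family_on_def
    proof (intro ballI impI)
      fix X Y assume "X \<in> U ?k" "Y \<in> U ?k" "X \<noteq> Y"
      then obtain b c where b: "X = cyl L M (cls (Aut L M) b) [0..<?k]" and c: "Y =
        cyl L M (cls (Aut L M) c) [0..<?k]" unfolding U_def by auto
      show "X \<inter> Y = {}"
      proof (rule equals0I)
        fix N assume N: "N \<in> X \<inter> Y"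
        then obtain g where g: "bij g" "N = act L g M" unfolding b cyl_def by blast
        then have "sim (Aut L M) b (map (inv g) [0..<?k])" "sim (Aut L M) c (map (inv g) [0..<?k])"
          using N b c act_in_cyl[OF L M g(1) inv_set_sim] by simp_all
        then have "sim (Aut L M) b c" using sim_sym sim_trans by blast
        then show False using \<open>X \<noteq> Y\<close> b c cls_eq by simp
      qed
    qed
    have "1 = measure \<mu> (\<Union>X\<in>U ?k. X)" using Un \<mu>(5) by (simp add: measure_def)
    also have "\<dots> = (\<Sum>X\<in>U ?k. measure \<mu> X)"
      using finU disj
      by (intro finite_measure_finite_Union) (auto simp: U_def \<mu> cyl_cls_sets[OF L M])
    also have "\<dots> = card (U ?k) * ?v" using eq by simp
    finally have "?v = 1 / card (U ?k)"
      by (metis mult_eq_0_iff nonzero_eq_divide_eq mult.commute zero_neq_one)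
    then show ?thesis by (simp add: emeasure_eq_measure)
  qed
  show ?thesis
  proof (rule measure_eqI_cyl[OF L M])
    fix a
    show "emeasure \<mu> (type_cyl L M a) = emeasure \<nu> (type_cyl L M a)"
    proof (cases "distinct a")
      case False
      have "distinct (map (inv g) [0..<length a])" if "bij g" for g :: "nat \<Rightarrow> nat"
        using inj_on_subset[OF bij_is_inj[OF bij_imp_bij_inv[OF that]] subset_UNIV]
        by (simp add: distinct_map)
      then have "type_cyl L M a = {}" using False sim_distinct unfolding cyl_def by auto
      then show ?thesis by simp
    qed (simp add: val \<mu> \<nu>)
  qed (use invariant_measures_on_orbitD[OF \<mu>] invariant_measures_on_orbitD[OF \<nu>] in auto)
qed

text \<open>A measure is determined by countably many reals, the probabilities of types. Their
  Dedekind cuts together form one subset of a countable set.\<close>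

lemma invariant_measures_on_orbit_lepoll: "invariant_measures_on_orbit L M \<lesssim> (UNIV :: real set)"
proof -
  define \<Phi> where "\<Phi> \<mu> = to_nat ` {(a, q :: rat). of_rat q < measure \<mu> (type_cyl L M a)}" for \<mu>
  have "inj_on \<Phi> (invariant_measures_on_orbit L M)"
  proof (rule inj_onI)
    fix \<mu> \<nu> assume \<mu>: "\<mu> \<in> invariant_measures_on_orbit L M" and \<nu>:
      "\<nu> \<in> invariant_measures_on_orbit L M"
      and eq: "\<Phi> \<mu> = \<Phi> \<nu>"
    have "{(a, q :: rat). of_rat q < measure \<mu> (type_cyl L M a)} =
        {(a, q :: rat). of_rat q < measure \<nu> (type_cyl L M a)}"
      using eq unfolding \<Phi>_def by (simp add: inj_image_eq_iff)
    then have iff: "of_rat q < measure \<mu> (type_cyl L M a) \<longleftrightarrow>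
        of_rat q < measure \<nu> (type_cyl L M a)" for a and q :: rat
      by (auto simp: set_eq_iff)
    have "measure \<mu> (type_cyl L M a) = measure \<nu> (type_cyl L M a)" for a
    proof (rule ccontr)
      let ?x = "measure \<mu> (type_cyl L M a)"
      let ?y = "measure \<nu> (type_cyl L M a)"
      assume "?x \<noteq> ?y"
      then obtain q where "?x < of_rat q \<and> of_rat q < ?y \<or> ?y < of_rat q \<and> of_rat q < ?x"
        using of_rat_dense[of ?x ?y] of_rat_dense[of ?y ?x] by (metis linorder_neqE_linordered_idom)
      then show False using iff[of q a] by auto
    qed
    then have eq': "emeasure \<mu> (type_cyl L M a) = emeasure \<nu> (type_cyl L M a)" for a
      using invariant_measures_on_orbitD(1)[OF \<mu>] invariant_measures_on_orbitD(1)[OF \<nu>]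
      by (simp add: finite_measure.emeasure_eq_measure prob_space_def)
    show "\<mu> = \<nu>"
      by (rule measure_eqI_cyl[OF L M _ _ _ _ _ _ eq'])
        (use invariant_measures_on_orbitD[OF \<mu>] invariant_measures_on_orbitD[OF \<nu>] in auto)
  qed
  then have "invariant_measures_on_orbit L M \<lesssim> (UNIV :: nat set set)" unfolding lepoll_def by blast
  then show ?thesis using nat_sets_eqpoll_reals lepoll_trans2 by blast
qed

end

section \<open>The duplication tree\<close>

text \<open>A finite stage of the tree is a list with one pair per node: the element of
  \<open>M\<close> labelling it, and the node that it copies, with \<open>None\<close> for a
  root.\<close>

definition lbl :: "(nat \<times> nat option) list \<Rightarrow> nat \<Rightarrow> nat" where "lbl s i = fst (s ! i)"
definition prt :: "(nat \<times> nat option) list \<Rightarrow> nat \<Rightarrow> nat option" where "prt s i = snd (s ! i)"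

lemma lbl_append: "i < length s \<Longrightarrow> lbl (s @ t) i = lbl s i"
  and prt_append: "i < length s \<Longrightarrow> prt (s @ t) i = prt s i"
  by (auto simp: lbl_def prt_def nth_append)

lemma map_lbl_append: "set c \<subseteq> {..<length s} \<Longrightarrow> map (lbl (s @ t)) c = map (lbl s) c"
  by (auto simp: lbl_append subset_iff)

locale trivial_perm_group = perm_group +
  assumes trivial: "finite A \<Longrightarrow> fixed_pts G A = A"
begin

text \<open>The orbit of \<open>b\<close> under the pointwise stabiliser of \<open>A\<close> is
  infinite. If it were finite, triviality over \<open>A\<close> and the rest of the orbit would give
  a \<open>g\<close> that fixes these and moves \<open>b\<close>. But \<open>g b\<close> is then one
  of the fixed points, contradicting injectivity.\<close>

lemma move_out:
  assumes A: "finite A" and b: "b \<notin> A" and E: "finite E"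
  shows "\<exists>g\<in>G. (\<forall>x\<in>A. g x = x) \<and> g b \<notin> E"
proof (rule ccontr)
  assume no: "\<not> ?thesis"
  define O' where "O' = {g b | g. g \<in> G \<and> (\<forall>x\<in>A. g x = x)}"
  have "O' \<subseteq> E" using no unfolding O'_def by blast
  then have fin: "finite O'" using E by (rule finite_subset)
  have "b \<notin> fixed_pts G (A \<union> (O' - {b}))" using trivial[of "A \<union> (O' - {b})"] A fin b by auto
  then obtain g where g: "g \<in> G" "\<forall>x\<in>A \<union> (O' - {b}). g x = x" "g b \<noteq> b"
    unfolding fixed_pts_def by blast
  then have "g b \<in> O' - {b}" unfolding O'_def by blast
  then have "g (g b) = g b" using g by blast
  then show False using g G_bij[OF g(1)] by (auto simp: bij_is_inj inj_eq)
qed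

section \<open>Finite stages and their extensions\<close>

definition valid :: "(nat \<times> nat option) list \<Rightarrow> bool" where
  "valid s \<longleftrightarrow> distinct (map fst s) \<and> (\<forall>n<length s. \<forall>i. prt s n = Some i \<longrightarrow>
     i < n \<and> (\<exists>g\<in>G. g (lbl s i) = lbl s n \<and> (\<forall>j<n. j \<noteq> i \<longrightarrow> g (lbl s j) = lbl s j)))"

lemma valid_snoc:
  assumes "valid s" "x \<notin> fst ` set s"
    "\<And>i. v = Some i \<Longrightarrow> i < length s \<and> (\<exists>g\<in>G. g (lbl s i) = x \<and> (\<forall>j<length s. j \<noteq> i \<longrightarrow>
      g (lbl s j) = lbl s j))"
  shows "valid (s @ [(x, v)])"
  unfolding valid_def
proof (intro conjI allI impI)
  show "distinct (map fst (s @ [(x, v)]))" using assms unfolding valid_def by auto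
  fix n i assume n: "n < length (s @ [(x, v)])" and p: "prt (s @ [(x, v)]) n = Some i"
  have "i < n \<and> (\<exists>g\<in>G. g (lbl (s @ [(x, v)]) i) = lbl (s @ [(x, v)]) n \<and> (\<forall>j<n. j \<noteq> i \<longrightarrow>
    g (lbl (s @ [(x, v)]) j) = lbl (s @ [(x, v)]) j))"
  proof (cases "n < length s")
    case True
    then have "i < n \<and> (\<exists>g\<in>G. g (lbl s i) = lbl s n \<and> (\<forall>j<n. j \<noteq> i \<longrightarrow> g (lbl s j) = lbl s j))"
      using assms(1) p unfolding valid_def by (simp add: prt_append)
    then show ?thesis using True by (simp add: lbl_append)
  next
    case False
    then have [simp]: "n = length s" using n by simp
    have "lbl (s @ [(x, v)]) n = x" "v = Some i" using p by (auto simp: lbl_def prt_def)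
    then show ?thesis using assms(3)[of i] by (auto simp: lbl_append)
  qed
  then show "i < n" "\<exists>g\<in>G. g (lbl (s @ [(x, v)]) i) = lbl (s @ [(x, v)]) n \<and> (\<forall>j<n. j \<noteq> i \<longrightarrow>
    g (lbl (s @ [(x, v)]) j) = lbl (s @ [(x, v)]) j)"
    by auto
qed

text \<open>One element of \<open>G\<close> carries \<open>d\<close> to \<open>e\<close>; a second
  one fixes \<open>e\<close> and moves the image of \<open>b\<close> off the elements in
  use.\<close>

lemma add_root:
  assumes "valid s" "sim G d e" "b \<notin> set d"
  shows "\<exists>x. valid (s @ [(x, None)]) \<and> sim G (d @ [b]) (e @ [x])"
proof -
  obtain g where g: "g \<in> G" "map g d = e" using assms unfolding sim_def by blast
  have "g b \<notin> set e" using g G_bij[OF g(1)] assms(3) by (auto simp: bij_is_inj inj_eq)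
  then obtain h where h: "h \<in> G" "\<forall>x\<in>set e. h x = x" "h (g b) \<notin> fst ` set s"
    using move_out[of "set e" "g b" "fst ` set s"] by auto
  have "map (h \<circ> g) (d @ [b]) = e @ [h (g b)]"
    using g h by (auto simp flip: map_map intro: map_idI)
  then have "sim G (d @ [b]) (e @ [h (g b)])" unfolding sim_def using G_comp[OF h(1) g(1)] by blast
  then show ?thesis using valid_snoc[OF assms(1) h(3), of None] by blast
qed

lemma add_split:
  assumes "valid s" "i < length s"
  shows "\<exists>x. valid (s @ [(x, Some i)])"
proof -
  let ?A = "lbl s ` ({..<length s} - {i})"
  have inj: "inj_on (lbl s) {..<length s}"
  proof (rule inj_onI)
    fix x y assume "x \<in> {..<length s}" "y \<in> {..<length s}" "lbl s x = lbl s y"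
    then show "x = y" using assms(1) nth_eq_iff_index_eq[of "map fst s" x y] unfolding valid_def
      by (simp add: lbl_def)
  qed
  then have "lbl s i \<notin> ?A" using assms(2) by (auto simp: inj_on_def)
  then obtain g where g: "g \<in> G" "\<forall>x\<in>?A. g x = x" "g (lbl s i) \<notin> fst ` set s"
    using move_out[of ?A "lbl s i" "fst ` set s"] by auto
  have "valid (s @ [(g (lbl s i), Some i)])"
    by (rule valid_snoc[OF assms(1) g(3)]) (use g assms in auto)
  then show ?thesis by blast
qed

lemma add_roots:
  assumes "finite R" "valid s"
    "\<And>c d b. (c, d, b) \<in> R \<Longrightarrow> set c \<subseteq> {..<length s} \<and> sim G d (map (lbl s) c) \<and> b \<notin> set d"
  shows "\<exists>t. valid (s @ t) \<and> (\<forall>p\<in>set t. snd p = None) \<and>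
    (\<forall>(c, d, b)\<in>R. \<exists>m. length s \<le> m \<and> m < length (s @ t) \<and>
      sim G (d @ [b]) (map (lbl (s @ t)) c @ [lbl (s @ t) m]))"
  using assms(1,3)
proof (induction R)
  case empty
  show ?case by (rule exI[of _ "[]"]) (simp add: assms)
next
  case (insert r R)
  obtain c d b where r: "r = (c, d, b)" by (cases r)
  have cdb: "set c \<subseteq> {..<length s}" "sim G d (map (lbl s) c)" "b \<notin> set d"
    using insert.prems[of c d b] r by auto
  obtain t where t: "valid (s @ t)" "\<forall>p\<in>set t. snd p = None"
    "\<forall>(c, d, b)\<in>R. \<exists>m. length s \<le> m \<and> m < length (s @ t) \<and>
      sim G (d @ [b]) (map (lbl (s @ t)) c @ [lbl (s @ t) m])"
    using insert.IH insert.prems by blast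
  obtain x where x: "valid ((s @ t) @ [(x, None)])" "sim G (d @ [b]) (map (lbl s) c @ [x])"
    using add_root[OF t(1) cdb(2,3)] by blast
  let ?t = "t @ [(x, None)]"
  have "\<exists>m. length s \<le> m \<and> m < length (s @ ?t) \<and>
    sim G (d' @ [b']) (map (lbl (s @ ?t)) c' @ [lbl (s @ ?t) m])"
    if "(c', d', b') \<in> insert r R" for c' d' b'
  proof (cases "(c', d', b') = r")
    case True
    then show ?thesis using x cdb r
      by (intro exI[of _ "length (s @ t)"]) (simp add: map_lbl_append, simp add: lbl_def nth_append)
  next
    case False
    then have "(c', d', b') \<in> R" using that by auto
    then obtain m where m: "length s \<le> m" "m < length (s @ t)" "sim G (d' @ [b']) (map (lbl (s @ t))
      c' @ [lbl (s @ t) m])"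
      using t(3) by blast
    have "set c' \<subseteq> {..<length (s @ t)}" using insert.prems[of c' d' b'] that by auto
    then have "map (lbl (s @ ?t)) c' = map (lbl (s @ t)) c'" "lbl (s @ ?t) m = lbl (s @ t) m"
      using m map_lbl_append[of c' "s @ t" "[(x, None)]"] lbl_append[of m "s @ t" "[(x, None)]"]
      by simp_all
    then show ?thesis using m by (intro exI[of _ m]) (simp del: map_eq_conv)
  qed
  then show ?case using x t by (intro exI[of _ ?t]) auto
qed

lemma add_splits:
  assumes "valid s" "n \<le> length s"
  shows "\<exists>t. valid (s @ t) \<and> (\<forall>i<n. Some i \<in> snd ` set t)"
  using assms(2)
proof (induction n)
  case 0
  show ?case by (rule exI[of _ "[]"]) (simp add: assms)
next
  case (Suc n)
  then obtain t where t: "valid (s @ t)" "\<forall>i<n. Some i \<in> snd ` set t" by auto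
  obtain x where "valid ((s @ t) @ [(x, Some n)])" using add_split[OF t(1), of n] Suc.prems by auto
  then show ?case using t by (intro exI[of _ "t @ [(x, Some n)]"]) (auto simp: less_Suc_eq)
qed

text \<open>One round of the construction. A request \<open>(d, b)\<close>, coded by a number
  \<open>q\<close>, asks for a witness of \<open>d @ [b]\<close> over every tuple of present nodes
  that realises \<open>d\<close>. The witnesses come as roots at the beginning of the round, before
  the old nodes are split. Since all codes below \<open>k\<close> are served, a request recurs in
  every sufficiently late round.\<close>

definition phase :: "nat \<Rightarrow> (nat \<times> nat option) list \<Rightarrow> (nat \<times> nat option) list \<Rightarrow> bool" where
  "phase k s t \<longleftrightarrow> (\<exists>u. t = s @ u) \<and> length s < length t \<and>
    (\<forall>q<k. \<forall>d b c. from_nat q = (d, b) \<and> b \<notin> set d \<and> set c \<subseteq> {..<length s} \<and>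
      sim G d (map (lbl s) c) \<longrightarrow>
       (\<exists>m<length t. length s \<le> m \<and> (\<forall>j. length s \<le> j \<and> j \<le> m \<longrightarrow> prt t j = None) \<and>
          sim G (d @ [b]) (map (lbl t) c @ [lbl t m]))) \<and>
    (\<forall>i<length s. \<exists>m<length t. length s \<le> m \<and> prt t m = Some i) \<and>
    (\<exists>m<length t. length s \<le> m \<and> prt t m = None)"

lemma phase_exists:
  assumes s: "valid s"
  shows "\<exists>t. valid t \<and> phase k s t"
proof -
  define R where "R = {(c, d, b). (\<exists>q<k. from_nat q = (d, b)) \<and> b \<notin> set d \<and> set c \<subseteq> {..<length s} \<and>
    sim G d (map (lbl s) c)}"
  \<comment> \<open>Equivalent tuples have the same length, so the code of a request bounds the
    length of the tuples \<open>c\<close> to be served.\<close>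
  have "R \<subseteq> (\<Union>q<k. {c. set c \<subseteq> {..<length s} \<and>
    length c = length (fst (from_nat q :: nat list \<times> nat))} \<times> {from_nat q})"
  proof
    fix r assume "r \<in> R"
    then obtain c d b q where r: "r = (c, d, b)" "q < k" "from_nat q = (d, b)" "set c \<subseteq>
      {..<length s}" "sim G d (map (lbl s) c)"
      unfolding R_def by blast
    then have "length c = length d" using sim_length by force
    then show "r \<in> (\<Union>q<k. {c. set c \<subseteq> {..<length s} \<and>
      length c = length (fst (from_nat q :: nat list \<times> nat))} \<times> {from_nat q})"
      using r by (intro UN_I[of q]) auto
  qed
  then have "finite R"
    by (rule finite_subset) (intro finite_UN_I finite_cartesian_product finite_lists_length_eq;
      simp)
  then obtain t where t: "valid (s @ t)" "\<forall>p\<in>set t. snd p = None"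
    "\<forall>(c, d, b)\<in>R. \<exists>m. length s \<le> m \<and> m < length (s @ t) \<and>
      sim G (d @ [b]) (map (lbl (s @ t)) c @ [lbl (s @ t) m])"
    using add_roots[of R s] s unfolding R_def by blast
  \<comment> \<open>One further root guarantees that the cell \<open>None\<close> is halved even in
    a round without requests.\<close>
  obtain x where x: "valid ((s @ t) @ [(x, None)])"
    using add_root[OF t(1) sim_refl[of "[]"], of 0] by auto
  obtain u where u: "valid (((s @ t) @ [(x, None)]) @ u)" "\<forall>i<length s. Some i \<in> snd ` set u"
    using add_splits[OF x, of "length s"] by auto
  let ?v = "(s @ t) @ ([(x, None)] @ u)"
  have none: "prt ?v j = None" if "length s \<le> j" "j < length (s @ t)" for j
  proof -
    have "prt ?v j = snd (t ! (j - length s))" using that by (auto simp: prt_def nth_append)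
    then show ?thesis using t(2) that by auto
  qed
  have "phase k s ?v"
    unfolding phase_def
  proof (intro conjI allI impI)
    show "\<exists>u. ?v = s @ u" by simp
    show "length s < length ?v" by simp
    show "\<exists>m<length ?v. length s \<le> m \<and> prt ?v m = None"
      by (intro exI[of _ "length (s @ t)"]) (simp add: prt_def nth_append)
    show "\<exists>m<length ?v. length s \<le> m \<and> prt ?v m = Some i" if i: "i < length s" for i
    proof -
      obtain j where "j < length u" "snd (u ! j) = Some i"
        using u(2) i by (metis (no_types, lifting) image_iff in_set_conv_nth)
      then show ?thesis by (intro exI[of _ "length (s @ t) + 1 + j"]) (simp add: prt_def nth_append)
    qed
    fix q d b c assume q: "q < k" "from_nat q = (d, b) \<and> b \<notin> set d \<and> set c \<subseteq> {..<length s} \<and>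
      sim G d (map (lbl s) c)"
    then have "(c, d, b) \<in> R" unfolding R_def by blast
    then obtain m where m: "length s \<le> m" "m < length (s @ t)" "sim G (d @ [b]) (map (lbl (s @ t)) c
      @ [lbl (s @ t) m])"
      using t(3) by blast
    have "set c \<subseteq> {..<length (s @ t)}" using q by auto
    have "sim G (d @ [b]) (map (lbl ?v) c @ [lbl ?v m])"
      unfolding map_lbl_append[OF \<open>set c \<subseteq> {..<length (s @ t)}\<close>] lbl_append[OF m(2)] by (rule m(3))
    then show "\<exists>m<length ?v. length s \<le> m \<and> (\<forall>j. length s \<le> j \<and> j \<le> m \<longrightarrow> prt ?v j = None) \<and>
          sim G (d @ [b]) (map (lbl ?v) c @ [lbl ?v m])"
      using m none by (intro exI[of _ m]) (simp del: append_assoc)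
  qed
  then show ?thesis using u(1) by (metis append_assoc)
qed

text \<open>The elements \<open>lab 0, lab 1, \<dots>\<close> are added one by one; \<open>par n = Some i\<close> says that \<open>lab n\<close> is a
  copy of \<open>lab i\<close> over all the other earlier elements, \<open>par n =
    None\<close> that it is a new root. The last
  clause requires each type to be realised over the current nodes before any of them is split
  again.\<close>

definition tower :: "(nat \<Rightarrow> nat) \<Rightarrow> (nat \<Rightarrow> nat option) \<Rightarrow> bool" where
  "tower lab par \<longleftrightarrow> inj lab \<and>
     (\<forall>n i. par n = Some i \<longrightarrow> i < n \<and> (\<exists>g\<in>G. g (lab i) = lab n \<and> (\<forall>j<n. j \<noteq> i \<longrightarrow>
       g (lab j) = lab j))) \<and>
     (\<forall>v n. \<exists>m\<ge>n. par m = v) \<and>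
     (\<forall>d b. b \<notin> set d \<longrightarrow> (\<forall>n0. \<exists>n\<ge>n0. \<forall>c. set c \<subseteq> {..<n} \<and> sim G d (map lab c) \<longrightarrow>
        (\<exists>m\<ge>n. (\<forall>j. n \<le> j \<and> j \<le> m \<longrightarrow> par j = None) \<and> sim G (d @ [b]) (map lab c @ [lab m]))))"

lemma tower_exists: "\<exists>lab par. tower lab par"
proof -
  have "\<exists>S. \<forall>k. valid (S k) \<and> phase k (S k) (S (Suc k))"
    by (rule dependent_nat_choice) (use phase_exists in \<open>auto simp: valid_def intro!: exI[of _
      "[]"]\<close>)
  then obtain S where S: "\<And>k. valid (S k)" "\<And>k. phase k (S k) (S (Suc k))" by blast
  have len: "length (S k) < length (S (Suc k))" for k using S(2) unfolding phase_def by blast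
  have len': "k \<le> length (S k)" for k by (induction k) (use len le_less_trans Suc_leI in \<open>blast+\<close>)
  have pre: "\<exists>u. S (k + m) = S k @ u" for k m
  proof (induction m)
    case (Suc m)
    moreover have "\<exists>u. S (Suc (k + m)) = S (k + m) @ u" using S(2) unfolding phase_def by blast
    ultimately show ?case by auto
  qed simp
  define lab where "lab n = lbl (S (Suc n)) n" for n
  define par where "par n = prt (S (Suc n)) n" for n
  have eq: "lbl (S k) n = lab n \<and> prt (S k) n = par n" if "n < length (S k)" for n k
  proof (cases "k \<le> Suc n")
    case True
    then obtain u where "S (Suc n) = S k @ u" using pre[of k "Suc n - k"] by auto
    then show ?thesis using that by (simp add: lab_def par_def lbl_append prt_append)
  next
    case False
    then obtain u where "S k = S (Suc n) @ u" using pre[of "Suc n" "k - Suc n"] by auto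
    moreover have "n < length (S (Suc n))" using len'[of "Suc n"] by simp
    ultimately show ?thesis by (simp add: lab_def par_def lbl_append prt_append)
  qed
  have "inj lab"
  proof (rule injI)
    fix i j assume "lab i = lab j"
    let ?k = "Suc (max i j)"
    have ij: "i < length (S ?k)" "j < length (S ?k)" using len'[of ?k] by auto
    then have "lbl (S ?k) i = lbl (S ?k) j" using \<open>lab i = lab j\<close> eq by simp
    then have "map fst (S ?k) ! i = map fst (S ?k) ! j" using ij by (simp add: lbl_def)
    then show "i = j" using S(1)[of ?k] ij nth_eq_iff_index_eq[of "map fst (S ?k)" i j]
      unfolding valid_def by (simp only: length_map)
  qed
  moreover have "i < n \<and> (\<exists>g\<in>G. g (lab i) = lab n \<and> (\<forall>j<n. j \<noteq> i \<longrightarrow> g (lab j) = lab j))" if "par n =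
    Some i" for n i
  proof -
    let ?k = "Suc n"
    have n: "n < length (S ?k)" using len'[of ?k] by simp
    then have "i < n \<and> (\<exists>g\<in>G. g (lbl (S ?k) i) = lbl (S ?k) n \<and> (\<forall>j<n. j \<noteq> i \<longrightarrow> g (lbl (S ?k) j) =
      lbl (S ?k) j))"
      using S(1)[of ?k] eq that unfolding valid_def by simp
    moreover from this have "i < length (S ?k)" using n by auto
    ultimately show ?thesis using n eq by simp
  qed
  moreover have "\<exists>m\<ge>n. par m = v" for v n
  proof -
    define k where "k = (case v of None \<Rightarrow> n | Some i \<Rightarrow> Suc (max i n))"
    have k: "n \<le> length (S k)" "\<And>i. v = Some i \<Longrightarrow> i < length (S k)" 
    proof -
      have "n \<le> k" "\<And>i. v = Some i \<Longrightarrow> i < k" by (auto simp: k_def split: option.splits)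
      then show "n \<le> length (S k)" "\<And>i. v = Some i \<Longrightarrow> i < length (S k)"
        using len'[of k] by (auto intro: less_le_trans)
    qed
    have "\<exists>m<length (S (Suc k)). length (S k) \<le> m \<and> prt (S (Suc k)) m = v"
      using S(2)[of k] k(2) unfolding phase_def by (cases v) auto
    then show ?thesis using eq k(1) by (metis order_trans)
  qed
  moreover have "\<exists>n\<ge>n0. \<forall>c. set c \<subseteq> {..<n} \<and> sim G d (map lab c) \<longrightarrow>
        (\<exists>m\<ge>n. (\<forall>j. n \<le> j \<and> j \<le> m \<longrightarrow> par j = None) \<and> sim G (d @ [b]) (map lab c @ [lab m]))"
    if b: "b \<notin> set d" for d b n0
  proof -
    \<comment> \<open>A round that starts no earlier than \<open>n0\<close> and whose bound exceeds
      the code of the request.\<close>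
    define k where "k = max n0 (Suc (to_nat (d, b)))"
    let ?n = "length (S k)"
    have "n0 \<le> ?n" using len'[of k] by (simp add: k_def)
    moreover have "\<exists>m\<ge>?n. (\<forall>j. ?n \<le> j \<and> j \<le> m \<longrightarrow> par j = None) \<and>
      sim G (d @ [b]) (map lab c @ [lab m])"
      if c: "set c \<subseteq> {..<?n}" "sim G d (map lab c)" for c
    proof -
      have 1: "map (lbl (S k)) c = map lab c" "map (lbl (S (Suc k))) c = map lab c"
        using c(1) eq len[of k] by (auto simp: subset_iff intro: less_trans)
      have "to_nat (d, b) < k" "from_nat (to_nat (d, b)) = (d, b)" by (auto simp: k_def)
      then obtain m where m: "m < length (S (Suc k))" "?n \<le> m" "\<forall>j. ?n \<le> j \<and> j \<le> m \<longrightarrow>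
        prt (S (Suc k)) j = None"
          "sim G (d @ [b]) (map (lbl (S (Suc k))) c @ [lbl (S (Suc k)) m])"
        using S(2)[of k] b c 1 unfolding phase_def by metis
      moreover have "par j = None" if "?n \<le> j" "j \<le> m" for j
        using m(1,3) that eq[of j "Suc k"] by auto
      ultimately show ?thesis using 1 eq by metis
    qed
    ultimately show ?thesis by blast
  qed
  ultimately show ?thesis unfolding tower_def by blast
qed

end

section \<open>Sampling from the duplication tree\<close>

text \<open>The parameter \<open>n1\<close> is the number of nodes that have a cell of their own at
  level 0. Varying the initial weights over these cells will vary the measure.\<close>

locale sampler = trivial_perm_group +
  fixes lab :: "nat \<Rightarrow> nat" and par :: "nat \<Rightarrow> nat option" and n1 :: nat
  assumes tower: "tower lab par"
begin

lemma lab_inj: "inj lab" using tower unfolding tower_def by blast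

lemma par_less: "par n = Some i \<Longrightarrow> i < n" using tower unfolding tower_def by blast

lemma par_move: "par n = Some i \<Longrightarrow> \<exists>g\<in>G. g (lab i) = lab n \<and> (\<forall>j<n. j \<noteq> i \<longrightarrow> g (lab j) = lab j)"
  using tower unfolding tower_def by blast

lemma par_frequently: "\<exists>m\<ge>n. par m = v" using tower unfolding tower_def by blast

lemma tower_ext:
  assumes "b \<notin> set d"
  obtains n where "n \<ge> n0" "\<And>c. set c \<subseteq> {..<n} \<Longrightarrow> sim G d (map lab c) \<Longrightarrow>
        \<exists>m\<ge>n. (\<forall>j. n \<le> j \<and> j \<le> m \<longrightarrow> par j = None) \<and> sim G (d @ [b]) (map lab c @ [lab m])"
proof -
  have "\<exists>n\<ge>n0. \<forall>c. set c \<subseteq> {..<n} \<and> sim G d (map lab c) \<longrightarrow>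
        (\<exists>m\<ge>n. (\<forall>j. n \<le> j \<and> j \<le> m \<longrightarrow> par j = None) \<and> sim G (d @ [b]) (map lab c @ [lab m]))"
    using tower assms unfolding tower_def by blast
  then show thesis using that by blast
qed

text \<open>Levels below \<open>n1\<close> change nothing, since the nodes they would create are
  present from the start; hence \<open>max n n1\<close>.\<close>

definition born :: "nat \<Rightarrow> nat option set" where
  "born n = insert None (Some ` {..<max n n1})"

lemma finite_born: "finite (born n)" by (simp add: born_def)

lemma None_born: "None \<in> born n" by (simp add: born_def)

lemma Some_born: "Some i \<in> born n \<longleftrightarrow> i < max n n1" by (auto simp: born_def)

lemma born_mono: "n \<le> m \<Longrightarrow> born n \<subseteq> born m" by (auto simp: born_def)

lemma par_born: "par n \<in> born n"
  by (cases "par n") (auto simp: None_born Some_born dest: par_less)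

lemma born_Suc: "n1 \<le> n \<Longrightarrow> born (Suc n) = insert (Some n) (born n)"
  by (auto simp: born_def less_Suc_eq image_iff)

lemma born_Suc_less: "n < n1 \<Longrightarrow> born (Suc n) = born n"
  by (simp add: born_def max_def)

lemma not_born: "n1 \<le> n \<Longrightarrow> Some n \<notin> born n" by (auto simp: born_def)

text \<open>\<open>ivl n v = (r, a, b)\<close>: at level \<open>n\<close>, the points in cell \<open>v\<close> are the pairs \<open>(r, y)\<close> with
  \<open>a \<le> y < b\<close>. The initial cells are \<open>None\<close> (not yet labelled) and \<open>Some i\<close>
    for \<open>i < n1\<close>; level \<open>Suc n\<close>
  halves the cell \<open>par n\<close>, and its left half becomes \<open>Some n\<close>.\<close>

primrec ivl :: "nat \<Rightarrow> nat option \<Rightarrow> nat option \<times> real \<times> real" where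
  "ivl 0 v = (v, 0, if v \<in> born 0 then 1 else 0)"
| "ivl (Suc n) v =
    (if n < n1 then ivl n v
     else let (r, a, b) = ivl n (par n) in
       if v = Some n then (r, a, (a + b) / 2) else if v = par n then (r, (a + b) / 2, b) else ivl n
         v)"

definition anc :: "nat \<Rightarrow> nat option \<Rightarrow> nat option" where "anc n v = fst (ivl n v)"
definition lo :: "nat \<Rightarrow> nat option \<Rightarrow> real" where "lo n v = fst (snd (ivl n v))"
definition hi :: "nat \<Rightarrow> nat option \<Rightarrow> real" where "hi n v = snd (snd (ivl n v))"

lemma ivl_0: "anc 0 v = v" "lo 0 v = 0" "hi 0 v = (if v \<in> born 0 then 1 else 0)"
  by (simp_all add: anc_def lo_def hi_def)

lemma ivl_Suc_less: "n < n1 \<Longrightarrow> anc (Suc n) v = anc n v" "n < n1 \<Longrightarrow> lo (Suc n) v = lo n v"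
  "n < n1 \<Longrightarrow> hi (Suc n) v = hi n v"
  by (simp_all add: anc_def lo_def hi_def)

lemma ivl_Suc:
  assumes "n1 \<le> n"
  shows "anc (Suc n) v = (if v = Some n then anc n (par n) else anc n v)"
    "lo (Suc n) v = (if v = Some n then lo n (par n) else if v =
      par n then (lo n v + hi n v) / 2 else lo n v)"
    "hi (Suc n) v = (if v = Some n then (lo n (par n) + hi n (par n)) / 2 else hi n v)"
  using assms by (auto simp: anc_def lo_def hi_def Let_def case_prod_unfold)

lemma ivl_unborn: "v \<notin> born n \<Longrightarrow> lo n v = 0 \<and> hi n v = 0"
proof (induction n)
  case (Suc n)
  show ?case
  proof (cases "n < n1")
    case True
    then show ?thesis using Suc by (simp add: ivl_Suc_less born_Suc_less)
  next
    case False
    then have "v \<notin> born n" "v \<noteq> Some n" "v \<noteq> par n"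
      using Suc.prems par_born by (auto simp: born_Suc)
    then show ?thesis using Suc.IH False by (simp add: ivl_Suc)
  qed
qed (simp add: ivl_0)

lemma ivl_born: "v \<in> born n \<Longrightarrow> anc n v \<in> born 0 \<and> 0 \<le> lo n v \<and> lo n v < hi n v \<and> hi n v \<le> 1"
proof (induction n arbitrary: v)
  case (Suc n)
  show ?case
  proof (cases "n < n1")
    case True
    then show ?thesis using Suc by (simp add: ivl_Suc_less born_Suc_less)
  next
    case False
    then have n: "n1 \<le> n" by simp
    show ?thesis using Suc.IH[OF par_born] Suc.IH[of v] Suc.prems n
      by (auto simp: ivl_Suc born_Suc field_simps)
  qed
qed (simp add: ivl_0)

primrec cell :: "nat \<Rightarrow> nat option \<Rightarrow> real \<Rightarrow> nat option" where
  "cell 0 j y = j"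
| "cell (Suc n) j y =
    (if n1 \<le> n \<and> cell n j y = par n \<and> y < (lo n (par n) + hi n (par n)) / 2 then Some n else cell n
      j y)"

text \<open>The recursion describes how a point moves between levels, while intervals give events
  and their probabilities. At level \<open>n\<close> the interval of \<open>Some n\<close> is still
  empty, so the new cell takes all its points from \<open>par n\<close>.\<close>

lemma cell_iff:
  assumes "j \<in> born 0" "0 \<le> y" "y < 1"
  shows "cell n j y = v \<longleftrightarrow> anc n v = j \<and> lo n v \<le> y \<and> y < hi n v"
proof (induction n arbitrary: v)
  case 0
  then show ?case using assms by (auto simp: ivl_0)
next
  case (Suc n)
  show ?case
  proof (cases "n < n1")
    case True
    then show ?thesis using Suc by (simp add: ivl_Suc_less)
  next
    case False
    then have n: "n1 \<le> n" by simp
    let ?p = "par n"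
    let ?mid = "(lo n ?p + hi n ?p) / 2"
    have p: "lo n ?p < ?mid" "?mid < hi n ?p" using ivl_born[OF par_born[of n]] by auto
    have un: "cell n j y \<noteq> Some n" using Suc.IH[of "Some n"] ivl_unborn[OF not_born[OF n]] by auto
    have np: "?p \<noteq> Some n" using par_born not_born[OF n] by metis
    consider "v = Some n" | "v = ?p" "v \<noteq> Some n" | "v \<noteq> ?p" "v \<noteq> Some n" by blast
    then show ?thesis
    proof cases
      case 1
      then have "cell (Suc n) j y = v \<longleftrightarrow> cell n j y = ?p \<and> y < ?mid" using un n by auto
      also have "\<dots> \<longleftrightarrow> anc n ?p = j \<and> lo n ?p \<le> y \<and> y < ?mid" using Suc.IH[of ?p] p by auto
      finally show ?thesis using 1 n by (simp add: ivl_Suc)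
    next
      case 2
      then have "cell (Suc n) j y = v \<longleftrightarrow> cell n j y = ?p \<and> \<not> y < ?mid" using n by auto
      also have "\<dots> \<longleftrightarrow> anc n ?p = j \<and> ?mid \<le> y \<and> y < hi n ?p" using Suc.IH[of ?p] p by auto
      finally show ?thesis using 2 n by (simp add: ivl_Suc)
    next
      case 3
      then have "cell (Suc n) j y = v \<longleftrightarrow> cell n j y = v" using n by auto
      then show ?thesis using Suc.IH[of v] 3 n by (simp add: ivl_Suc)
    qed
  qed
qed

lemma cell_born:
  assumes "j \<in> born 0" "0 \<le> y" "y < 1"
  shows "cell n j y \<in> born n"
  using cell_iff[OF assms, of n "cell n j y"] ivl_unborn[of "cell n j y" n] by force

end

type_synonym sample = "(nat \<Rightarrow> nat option) \<times> (nat \<Rightarrow> real)"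

context sampler
begin

section \<open>Labels of points and the stability of their types\<close>

definition cl :: "nat \<Rightarrow> sample \<Rightarrow> nat \<Rightarrow> nat option" where
  "cl n \<omega> i = cell n (fst \<omega> i) (snd \<omega> i)"

definition lb :: "nat \<Rightarrow> sample \<Rightarrow> nat \<Rightarrow> nat" where
  "lb n \<omega> i = lab (the (cl n \<omega> i))"

definition sep :: "nat \<Rightarrow> sample \<Rightarrow> nat set \<Rightarrow> bool" where
  "sep n \<omega> I \<longleftrightarrow> (\<forall>i\<in>I. cl n \<omega> i \<noteq> None) \<and> inj_on (cl n \<omega>) I"

definition ok :: "sample \<Rightarrow> bool" where
  "ok \<omega> \<longleftrightarrow> (\<forall>i. fst \<omega> i \<in> born 0 \<and> 0 \<le> snd \<omega> i \<and> snd \<omega> i < 1)"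

definition generic :: "sample \<Rightarrow> bool" where
  "generic \<omega> \<longleftrightarrow> ok \<omega> \<and> (\<forall>i. \<exists>n. cl n \<omega> i \<noteq> None) \<and> (\<forall>i j. i \<noteq> j \<longrightarrow> (\<exists>n. cl n \<omega> i \<noteq> cl n \<omega> j)) \<and>
     (\<forall>n. \<forall>v\<in>born n. \<exists>l. cl n \<omega> l = v)"

lemma cl_born: "ok \<omega> \<Longrightarrow> cl n \<omega> i \<in> born n"
  unfolding cl_def ok_def by (intro cell_born) auto

lemma cl_Suc: "cl (Suc n) \<omega> i = cl n \<omega> i \<or> n1 \<le> n \<and> cl n \<omega> i = par n \<and> cl (Suc n) \<omega> i = Some n"
  unfolding cl_def by auto

lemma cl_Suc_par: "n1 \<le> n \<Longrightarrow> cl n \<omega> i \<noteq> par n \<Longrightarrow> cl (Suc n) \<omega> i = cl n \<omega> i"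
  using cl_Suc by metis

lemma cl_labelled_mono:
  assumes "cl n \<omega> i \<noteq> None" "n \<le> m"
  shows "cl m \<omega> i \<noteq> None"
  using assms(2)
proof (induction m rule: dec_induct)
  case (step m)
  then show ?case using cl_Suc[of m \<omega> i] by auto
qed (rule assms)

lemma cl_separate_mono:
  assumes "ok \<omega>" "cl n \<omega> i \<noteq> cl n \<omega> j" "n \<le> m"
  shows "cl m \<omega> i \<noteq> cl m \<omega> j"
  using assms(3)
proof (induction m rule: dec_induct)
  case base
  then show ?case by (rule assms)
next
  case (step m)
  show ?case
  proof (cases "n1 \<le> m")
    case True
    then have "cl m \<omega> i \<noteq> Some m" "cl m \<omega> j \<noteq> Some m"
      using cl_born[OF assms(1), of m] not_born by metis+
    then show ?thesis using cl_Suc[of m \<omega> i] cl_Suc[of m \<omega> j] step.IH by metis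
  next
    case False
    then show ?thesis using cl_Suc[of m \<omega> i] cl_Suc[of m \<omega> j] step.IH by metis
  qed
qed

lemma sep_mono: 
  assumes "ok \<omega>" "sep n \<omega> I" "n \<le> m"
  shows "sep m \<omega> I"
  unfolding sep_def
proof (intro conjI ballI inj_onI)
  fix i assume i: "i \<in> I"
  then show "cl m \<omega> i \<noteq> None"
    using assms(2) cl_labelled_mono[OF _ assms(3), of \<omega> i] unfolding sep_def by blast
  fix j assume j: "j \<in> I" "cl m \<omega> i = cl m \<omega> j"
  then have "cl n \<omega> i = cl n \<omega> j" using cl_separate_mono[OF assms(1) _ assms(3), of i j] by blast
  then show "i = j" using assms(2) i j(1) unfolding sep_def by (auto dest: inj_onD)
qed

text \<open>Only the cell \<open>par n\<close> is halved, and separation allows at most one point of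
  \<open>I\<close> in it. If that point moves to node \<open>n\<close>, the automorphism attached to
  the copy \<open>n\<close> performs the move and fixes the labels of all other points, whose nodes
  are below \<open>n\<close>.\<close>

lemma sep_move_Suc:
  assumes ok: "ok \<omega>" and sep: "sep n \<omega> I"
  shows "\<exists>g\<in>G. \<forall>i\<in>I. lb (Suc n) \<omega> i = g (lb n \<omega> i)"
proof (cases "\<exists>i\<in>I. cl (Suc n) \<omega> i \<noteq> cl n \<omega> i")
  case False
  then show ?thesis using G_id by (intro bexI[of _ id]) (auto simp: lb_def)
next
  case True
  then obtain i where i: "i \<in> I" "cl (Suc n) \<omega> i \<noteq> cl n \<omega> i" by blast
  then have n: "n1 \<le> n" "cl n \<omega> i = par n" "cl (Suc n) \<omega> i = Some n" using cl_Suc by metis+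
  obtain p where p: "par n = Some p" using n i sep unfolding sep_def by (metis option.exhaust)
  obtain g where g: "g \<in> G" "g (lab p) = lab n" "\<forall>j<n. j \<noteq> p \<longrightarrow> g (lab j) = lab j"
    using par_move[OF p] by blast
  have "lb (Suc n) \<omega> j = g (lb n \<omega> j)" if j: "j \<in> I" for j
  proof (cases "j = i")
    case True
    then show ?thesis using n p g by (simp add: lb_def)
  next
    case False
    then have ne: "cl n \<omega> j \<noteq> par n" using sep i j n(2) unfolding sep_def inj_on_def by metis
    obtain q where q: "cl n \<omega> j = Some q" using sep j unfolding sep_def by blast
    have "q < n" using cl_born[OF ok, of n j] q n(1) by (simp add: Some_born)
    then show ?thesis using cl_Suc_par[OF n(1) ne] q g(3) ne p by (simp add: lb_def)
  qed
  then show ?thesis using g(1) by blast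
qed

lemma sep_move:
  assumes ok: "ok \<omega>" and sep: "sep n \<omega> I" and "n \<le> m"
  shows "\<exists>g\<in>G. \<forall>i\<in>I. lb m \<omega> i = g (lb n \<omega> i)"
  using assms(3)
proof (induction m rule: dec_induct)
  case base
  show ?case using G_id by (intro bexI[of _ id]) auto
next
  case (step m)
  then obtain g where g: "g \<in> G" "\<forall>i\<in>I. lb m \<omega> i = g (lb n \<omega> i)" by blast
  obtain h where h: "h \<in> G" "\<forall>i\<in>I. lb (Suc m) \<omega> i = h (lb m \<omega> i)"
    using sep_move_Suc[OF ok sep_mono[OF ok sep step(1)]] by blast
  show ?case using g h by (intro bexI[of _ "h \<circ> g"]) (auto intro: G_comp)
qed

lemma sep_sim:
  assumes "ok \<omega>" "sep n \<omega> (set a)" "n \<le> m"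
  shows "sim G (map (lb n \<omega>) a) (map (lb m \<omega>) a)"
proof -
  obtain g where "g \<in> G" "\<forall>i\<in>set a. lb m \<omega> i = g (lb n \<omega> i)" using sep_move[OF assms] by blast
  then show ?thesis unfolding sim_def by (intro bexI[of _ g]) auto
qed

text \<open>For invariant \<open>A\<close> this is monotone in \<open>n\<close>, so its truth at
  some level is the truth in the limit structure.\<close>

definition realized :: "nat list set \<Rightarrow> nat list \<Rightarrow> sample \<Rightarrow> nat \<Rightarrow> bool" where
  "realized A b \<omega> n \<longleftrightarrow> sep n \<omega> (set b) \<and> map (lb n \<omega>) b \<in> A"

lemma realized_mono:
  assumes "ok \<omega>" "inv_set G A" "realized A b \<omega> n" "n \<le> m"
  shows "realized A b \<omega> m"
  using assms(3) sep_mono[OF assms(1) _ assms(4)] sep_sim[OF assms(1) _ assms(4)]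
    inv_set_iff[OF assms(2)] unfolding realized_def by metis

lemma realized_iff:
  assumes "ok \<omega>" "inv_set G A" "sep n \<omega> (set b)"
  shows "(\<exists>m. realized A b \<omega> m) \<longleftrightarrow> map (lb n \<omega>) b \<in> A"
proof
  assume "\<exists>m. realized A b \<omega> m"
  then obtain m where m: "realized A b \<omega> m" by blast
  then have "realized A b \<omega> (max m n)" using realized_mono assms by auto
  then have "map (lb (max m n) \<omega>) b \<in> A" unfolding realized_def by simp
  moreover have "sim G (map (lb n \<omega>) b) (map (lb (max m n) \<omega>) b)"
    by (rule sep_sim[OF assms(1,3)]) simp
  ultimately show "map (lb n \<omega>) b \<in> A" using inv_set_iff[OF assms(2)] by blast
qed (use assms in \<open>auto simp: realized_def\<close>)

lemma generic_sep:
  assumes gen: "generic \<omega>" and fin: "finite I"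
  shows "\<exists>n\<ge>m. sep n \<omega> I"
proof -
  have ok: "ok \<omega>" using gen unfolding generic_def by blast
  obtain N where N: "\<And>i. cl (N i) \<omega> i \<noteq> None" using gen unfolding generic_def by metis
  obtain K where K: "\<And>i j. i \<noteq> j \<Longrightarrow> cl (K i j) \<omega> i \<noteq> cl (K i j) \<omega> j"
    using gen unfolding generic_def by metis
  have "finite (insert m (N ` I \<union> (\<lambda>(i, j). K i j) ` (I \<times> I)))" using fin by simp
  then obtain n where n: "\<And>k. k \<in> insert m (N ` I \<union> (\<lambda>(i, j). K i j) ` (I \<times> I)) \<Longrightarrow> k \<le> n"
    by (meson finite_nat_set_iff_bounded_le)
  have "sep n \<omega> I"
    unfolding sep_def inj_on_def
  proof (intro conjI ballI impI)
    fix i assume i: "i \<in> I"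
    show "cl n \<omega> i \<noteq> None" by (rule cl_labelled_mono[OF N[of i]]) (use n i in auto)
    fix j assume j: "j \<in> I" "cl n \<omega> i = cl n \<omega> j"
    show "i = j"
    proof (rule ccontr)
      assume ij: "i \<noteq> j"
      have "cl n \<omega> i \<noteq> cl n \<omega> j" by (rule cl_separate_mono[OF ok K[OF ij]]) (use n i j in auto)
      then show False using j by simp
    qed
  qed
  then show ?thesis using n by blast
qed

text \<open>The bijection \<open>h\<close> will be the isomorphism from the limit structure onto
  \<open>M\<close>. Forth: wait until the new point is separated from the old ones and transport its
  label. Back: the tower offers a root realising the required type over the current labels. Up to
  its birth only \<open>None\<close> is halved, so these labels do not move, and some point falls
  into the new cell.\<close>

lemma generic_bij:
  assumes gen: "generic \<omega>"
  shows "\<exists>h. bij h \<and> (\<forall>b. \<exists>n. sep n \<omega> (set b) \<and> sim G (map (lb n \<omega>) b) (map h b))"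
proof -
  have ok: "ok \<omega>" using gen unfolding generic_def by blast
  define R where "R a e \<longleftrightarrow> (\<exists>n. sep n \<omega> (set a) \<and> sim G (map (lb n \<omega>) a) e)" for a e
  have len: "length a = length e" if "R a e" for a e
    using that sim_length unfolding R_def by force
  have lbinj: "lb n \<omega> i = lb n \<omega> j \<longleftrightarrow> i = j" if "sep n \<omega> I" "i \<in> I" "j \<in> I" for n I i j
    using that lab_inj unfolding sep_def lb_def by (metis inj_eq inj_on_def option.expand)
  have eq: "a ! i = a ! j \<longleftrightarrow> e ! i = e ! j" if Re: "R a e" and ij: "i < length a" "j < length a"
    for a e i j
  proof -
    obtain n where n: "sep n \<omega> (set a)" "sim G (map (lb n \<omega>) a) e" using Re unfolding R_def by blast
    have "a ! i = a ! j \<longleftrightarrow> map (lb n \<omega>) a ! i = map (lb n \<omega>) a ! j"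
      using lbinj[OF n(1)] ij by simp
    then show ?thesis using sim_nth_eq[OF n(2)] ij by simp
  qed
  have "\<exists>h. bij h \<and> (\<forall>n. \<exists>a b. R a b \<and> {..<n} \<subseteq> set a \<and> map h a = b)"
  proof (rule back_and_forth)
    show "R [] []" unfolding R_def sep_def by (simp add: sim_refl)
    show "\<exists>d. R (a @ [x]) (e @ [d])" if Re: "R a e" for a e x
    proof -
      obtain n where n: "sep n \<omega> (set a)" "sim G (map (lb n \<omega>) a) e"
        using Re unfolding R_def by blast
      obtain m where m: "m \<ge> n" "sep m \<omega> (set (a @ [x]))"
        using generic_sep[OF gen, of "set (a @ [x])" n] by auto
      have "sim G (map (lb m \<omega>) a) e" using sep_sim[OF ok n(1) m(1)] n(2) sim_sym sim_trans by blast
      then obtain h where h: "h \<in> G" "map h (map (lb m \<omega>) a) = e" unfolding sim_def by blast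
      then have "sim G (map (lb m \<omega>) (a @ [x])) (e @ [h (lb m \<omega> x)])"
        unfolding sim_def by (intro bexI[of _ h]) auto
      then show ?thesis using m unfolding R_def by blast
    qed
    show "\<exists>c. R (a @ [c]) (e @ [d])" if Re: "R a e" for a e d
    \<comment> \<open>The tower provides witnesses only for elements outside the tuple; a repeated
      element is matched by repeating its point.\<close>
    proof (cases "d \<in> set e")
      case True
      obtain n where n: "sep n \<omega> (set a)" "sim G (map (lb n \<omega>) a) e"
        using Re unfolding R_def by blast
      obtain i where i: "i < length e" "e ! i = d" using True by (meson in_set_conv_nth)
      have l: "length a = length e" using len Re by blast
      obtain h where h: "h \<in> G" "map h (map (lb n \<omega>) a) = e" using n unfolding sim_def by blast
      then have "h (lb n \<omega> (a ! i)) = d" using i l by (metis length_map nth_map)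
      then have "sim G (map (lb n \<omega>) (a @ [a ! i])) (e @ [d])"
        using h unfolding sim_def by (intro bexI[of _ h]) auto
      moreover have "set (a @ [a ! i]) = set a" using i l by auto
      ultimately show ?thesis using n unfolding R_def by metis
    next
      case False
      obtain n where n: "sep n \<omega> (set a)" "sim G (map (lb n \<omega>) a) e"
        using Re unfolding R_def by blast
      let ?d = "map (lb n \<omega>) a"
      obtain g where g: "g \<in> G" "map g ?d = e" using n unfolding sim_def by blast
      define b where "b = inv g d"
      have gb: "g b = d" using G_bij[OF g(1)] by (simp add: b_def bij_is_surj surj_f_inv_f)
      have "b \<notin> set ?d" using False g(2) gb by auto
      then obtain n' where n': "n' \<ge> max n n1" "\<And>c. set c \<subseteq> {..<n'} \<Longrightarrow> sim G ?d (map lab c) \<Longrightarrow>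
        \<exists>m\<ge>n'. (\<forall>j. n' \<le> j \<and> j \<le> m \<longrightarrow> par j = None) \<and> sim G (?d @ [b]) (map lab c @ [lab m])"
        using tower_ext[of b ?d "max n n1"] by metis
      let ?c = "map (\<lambda>i. the (cl n' \<omega> i)) a"
      have sep': "sep n' \<omega> (set a)" using sep_mono[OF ok n(1)] n' by simp
      have cl': "the (cl n' \<omega> i) < n'" if "i \<in> set a" for i
        using sep' that cl_born[OF ok, of n' i] n'(1) unfolding sep_def by (auto simp: Some_born)
      then have "set ?c \<subseteq> {..<n'}" by auto
      moreover have labc: "map lab ?c = map (lb n' \<omega>) a" by (simp add: lb_def)
      have "sim G ?d (map lab ?c)" unfolding labc using sep_sim[OF ok n(1), of n'] n'(1) by simp
      ultimately obtain m where m: "m \<ge> n'" "\<And>j. n' \<le> j \<Longrightarrow> j \<le> m \<Longrightarrow> par j = None"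
        "sim G (?d @ [b]) (map lab ?c @ [lab m])" using n'(2) by blast
      have stay: "cl k \<omega> i = cl n' \<omega> i" if i: "i \<in> set a" and k: "n' \<le> k" "k \<le> Suc m" for k i
        using k
      proof (induction k rule: dec_induct)
        case (step k)
        then have "par k = None" using m(2) by simp
        moreover have "cl k \<omega> i \<noteq> None" using step i sep' unfolding sep_def by simp
        ultimately show ?case using cl_Suc[of k \<omega> i] step by (metis Suc_leD)
      qed simp
      have "Some m \<in> born (Suc m)" by (simp add: Some_born)
      \<comment> \<open>Genericity ensures that no cell stays without a point; this is what turns a
        node into a member of the random structure.\<close>
      then obtain l where l: "cl (Suc m) \<omega> l = Some m" using gen unfolding generic_def by blast
      have neq: "cl (Suc m) \<omega> i \<noteq> Some m" if "i \<in> set a" for i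
        using stay[OF that, of "Suc m"] cl'[OF that] m(1) by auto
      have "sep (Suc m) \<omega> (set a)" using sep_mono[OF ok sep'] m(1) by simp
      then have sepl: "sep (Suc m) \<omega> (set (a @ [l]))"
        using l neq unfolding sep_def by (auto simp: inj_on_def)
      have "map (lb (Suc m) \<omega>) a = map lab ?c" 
        using stay[of _ "Suc m"] m(1) by (simp add: lb_def)
      then have "map (lb (Suc m) \<omega>) (a @ [l]) = map lab ?c @ [lab m]" using l by (simp add: lb_def)
      moreover have "sim G (?d @ [b]) (e @ [d])"
        unfolding sim_def using g gb by (intro bexI[of _ g]) auto
      ultimately have "sim G (map (lb (Suc m) \<omega>) (a @ [l])) (e @ [d])"
        using m(3) sim_sym sim_trans by metis
      then show ?thesis using sepl unfolding R_def by blast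
    qed
  qed (use len eq in auto)
  then obtain h where h: "bij h" "\<And>n. \<exists>a b. R a b \<and> {..<n} \<subseteq> set a \<and> map h a = b" by blast
  have "\<exists>n. sep n \<omega> (set b) \<and> sim G (map (lb n \<omega>) b) (map h b)" for b
  proof -
    obtain a where a: "R a (map h a)" "{..<Suc (Max (set b))} \<subseteq> set a" using h(2) by metis
    then obtain n where n: "sep n \<omega> (set a)" "sim G (map (lb n \<omega>) a) (map h a)"
      unfolding R_def by blast
    have "set b \<subseteq> {..<Suc (Max (set b))}" by (auto simp: less_Suc_eq_le)
    then have ba: "set b \<subseteq> set a" using a by blast
    then have "sep n \<omega> (set b)" using n unfolding sep_def by (auto intro: inj_on_subset)
    moreover obtain g where "g \<in> G" "map g (map (lb n \<omega>) a) = map h a"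
      using n unfolding sim_def by blast
    then have "sim G (map (lb n \<omega>) b) (map h b)"
      unfolding sim_def using ba by (intro bexI[of _ g]) auto
    ultimately show ?thesis by blast
  qed
  then show ?thesis using h by blast
qed

end

section \<open>The probability space of samples\<close>

definition tuples :: "'b set \<Rightarrow> nat \<Rightarrow> 'b list set" where
  "tuples B k = {v. set v \<subseteq> B \<and> length v = k}"

lemma finite_tuples: "finite B \<Longrightarrow> finite (tuples B k)"
  unfolding tuples_def by (rule finite_lists_length_eq)

context sampler
begin

definition U :: "real measure" where "U = restrict_space lborel {0..<1}"

definition PU :: "(nat \<Rightarrow> real) measure" where "PU = PiM UNIV (\<lambda>_. U)"

lemma prob_space_U: "prob_space U"
  unfolding U_def by (rule prob_space_restrict_space) auto

end

locale sampler_pmf = sampler +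
  fixes w :: "nat option pmf"
  assumes set_w: "set_pmf w = born 0"
begin

definition mass :: "nat \<Rightarrow> nat option \<Rightarrow> real" where
  "mass n v = pmf w (anc n v) * (hi n v - lo n v)"

lemma mass_unborn: "v \<notin> born n \<Longrightarrow> mass n v = 0"
  using ivl_unborn[of v n] by (simp add: mass_def)

lemma mass_pos: "v \<in> born n \<Longrightarrow> 0 < mass n v"
  using ivl_born[of v n] set_w unfolding mass_def by (intro mult_pos_pos) (auto simp: pmf_positive)

lemma mass_nonneg: "0 \<le> mass n v"
  using mass_pos[of v n] mass_unborn[of v n] by (cases "v \<in> born n") auto

lemma mass_Suc_less: "n < n1 \<Longrightarrow> mass (Suc n) v = mass n v"
  by (simp add: mass_def ivl_Suc_less)

lemma mass_Suc:
  assumes "n1 \<le> n"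
  shows "mass (Suc n) v = (if v = Some n \<or> v = par n then mass n (par n) / 2 else mass n v)"
  using assms par_born[of n] not_born[OF assms] by (auto simp: mass_def ivl_Suc field_simps)

text \<open>A halving replaces one term by two. The function \<open>f\<close> will be the identity
  for the total mass and the square for the collision probability.\<close>

lemma sum_born_Suc:
  assumes n: "n1 \<le> n"
  shows "(\<Sum>v\<in>born (Suc n). f (mass (Suc n) v)) =
    (\<Sum>v\<in>born n. f (mass n v)) - f (mass n (par n)) + 2 * (f (mass n (par n) / 2) :: real)"
proof -
  have np: "par n \<noteq> Some n" using par_born not_born[OF n] by metis
  have "(\<Sum>v\<in>born (Suc n). f (mass (Suc n) v)) = f (mass n (par n) / 2) + (\<Sum>v\<in>born n. f (mass (Suc n)
    v))"
    using n finite_born not_born[OF n] by (simp add: born_Suc mass_Suc)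
  also have "(\<Sum>v\<in>born n. f (mass (Suc n) v)) = f (mass n (par n) / 2) + (\<Sum>v\<in>born n - {par n}. f
    (mass (Suc n) v))"
    using finite_born par_born by (subst sum.remove[of _ "par n"]) (auto simp: mass_Suc[OF n])
  also have "(\<Sum>v\<in>born n - {par n}. f (mass (Suc n) v)) = (\<Sum>v\<in>born n - {par n}. f (mass n v))"
    by (intro sum.cong refl) (use not_born[OF n] in \<open>auto simp: mass_Suc[OF n]\<close>)
  also have "\<dots> = (\<Sum>v\<in>born n. f (mass n v)) - f (mass n (par n))"
    using finite_born par_born by (subst sum_diff1) auto
  finally show ?thesis by simp
qed

lemma sum_mass: "(\<Sum>v\<in>born n. mass n v) = 1"
proof (induction n)
  case 0
  have "(\<Sum>v\<in>born 0. mass 0 v) = (\<Sum>v\<in>born 0. pmf w v)" by (rule sum.cong) (auto simp: mass_def ivl_0)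
  also have "\<dots> = 1" using set_w finite_born by (intro sum_pmf_eq_1) auto
  finally show ?case .
next
  case (Suc n)
  then show ?case using sum_born_Suc[of n "\<lambda>x. x"]
    by (cases "n1 \<le> n") (auto simp: mass_Suc_less born_Suc_less)
qed

text \<open>The probability that two independent points lie in the same cell. Each halving of a cell
  of mass \<open>m\<close> decreases it by \<open>m\<^sup>2 / 2\<close>, so cells of large mass are halved only finitely often;
  as every cell is halved infinitely often, no large cell survives.\<close>

definition coll :: "nat \<Rightarrow> real" where "coll n = (\<Sum>v\<in>born n. (mass n v)\<^sup>2)"

lemma coll_Suc: "n1 \<le> n \<Longrightarrow> coll (Suc n) = coll n - (mass n (par n))\<^sup>2 / 2"
  using sum_born_Suc[of n "\<lambda>x. x\<^sup>2"] by (simp add: coll_def power2_eq_square)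

lemma coll_nonneg: "0 \<le> coll n" unfolding coll_def by (intro sum_nonneg) simp

lemma coll_le: "v \<in> born n \<Longrightarrow> (mass n v)\<^sup>2 \<le> coll n"
  unfolding coll_def using finite_born by (intro member_le_sum) auto

lemma coll_decseq: "decseq (\<lambda>n. coll (n1 + n))"
  by (rule decseq_SucI) (simp add: coll_Suc)

lemma coll_tendsto: "coll \<longlonglongrightarrow> 0"
proof -
  obtain L where L: "(\<lambda>n. coll (n1 + n)) \<longlonglongrightarrow> L" "\<And>n. L \<le> coll (n1 + n)"
    using decseq_convergent[OF coll_decseq, of 0] coll_nonneg by blast
  have "L \<le> 0"
  proof (rule ccontr)
    assume "\<not> L \<le> 0"
    then have L0: "0 < L" by simp
    have "(\<lambda>n. coll (n1 + n) - coll (n1 + Suc n)) \<longlonglongrightarrow> L - L"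
      using L(1) LIMSEQ_Suc[OF L(1)] by (rule tendsto_diff)
    then have "(\<lambda>n. (mass (n1 + n) (par (n1 + n)))\<^sup>2 / 2) \<longlonglongrightarrow> 0" by (simp add: coll_Suc)
    then have "\<forall>\<^sub>F n in sequentially. (mass (n1 + n) (par (n1 + n)))\<^sup>2 / 2 < L\<^sup>2 / 2"
      by (rule order_tendstoD) (use L0 in simp)
    then obtain N where N: "\<And>n. n \<ge> N \<Longrightarrow> (mass (n1 + n) (par (n1 + n)))\<^sup>2 < L\<^sup>2"
      unfolding eventually_sequentially by auto
    have small: "mass n (par n) < L" if "n \<ge> n1 + N" for n
      using N[of "n - n1"] that L0 power2_less_imp_less[of "mass n (par n)" L] by simp
    let ?M = "n1 + N"
    \<comment> \<open>The masses sum to 1, so \<open>coll\<close> is a weighted mean of the masses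
      and cannot exceed the largest one.\<close>
    have "\<exists>v\<in>born ?M. L \<le> mass ?M v"
    proof (rule ccontr)
      assume "\<not> ?thesis"
      then have less: "\<And>v. v \<in> born ?M \<Longrightarrow> mass ?M v < L" by auto
      have "coll ?M < (\<Sum>v\<in>born ?M. mass ?M v * L)"
        unfolding coll_def
      proof (rule sum_strict_mono)
        show "(mass ?M v)\<^sup>2 < mass ?M v * L" if "v \<in> born ?M" for v
          using less[OF that] mass_pos[OF that] by (simp add: power2_eq_square)
      qed (use finite_born None_born in auto)
      also have "\<dots> = L" using sum_mass[of ?M] by (simp flip: sum_distrib_right)
      finally show False using L(2)[of N] by simp
    qed
    then obtain v where v: "v \<in> born ?M" "L \<le> mass ?M v" by blast
    \<comment> \<open>From level \<open>?M\<close> on only cells lighter than \<open>L\<close> are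
      halved, so the heavy cell \<open>v\<close> keeps its mass, although every cell has to be
      halved again and again.\<close>
    have "v \<in> born n \<and> L \<le> mass n v" if "n \<ge> ?M" for n
      using that
    proof (induction n rule: dec_induct)
      case (step n)
      then have "v \<noteq> par n" "v \<noteq> Some n" using small[of n] not_born[of n] by auto
      then show ?case using step born_mono[of n "Suc n"] by (auto simp: mass_Suc)
    qed (use v in simp)
    moreover obtain n where "n \<ge> ?M" "par n = v" using par_frequently by blast
    ultimately show False using small[of n] by force
  qed
  moreover have "0 \<le> L" using L(1) coll_nonneg by (intro LIMSEQ_le_const) auto
  ultimately have "(\<lambda>n. coll (n + n1)) \<longlonglongrightarrow> 0" using L(1) by (simp add: add.commute)
  then show ?thesis by (rule LIMSEQ_offset)
qed

lemma mass_None_tendsto: "(\<lambda>n. mass n None) \<longlonglongrightarrow> 0"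
proof -
  have "(\<lambda>n. sqrt (coll n)) \<longlonglongrightarrow> sqrt 0" using coll_tendsto by (rule tendsto_real_sqrt)
  moreover have "norm (mass n None) \<le> sqrt (coll n)" for n
    using real_sqrt_le_mono[OF coll_le[OF None_born[of n]]] mass_nonneg[of n None] by simp
  ultimately show ?thesis
    by (intro Lim_null_comparison[of "\<lambda>n. mass n None" "\<lambda>n. sqrt (coll n)"]) auto
qed

text \<open>The restriction to \<open>born 0\<close> makes every sample satisfy \<open>ok\<close>,
  not just almost every one.\<close>

definition W :: "nat option measure" where "W = restrict_space (measure_pmf w) (born 0)"

definition PW :: "(nat \<Rightarrow> nat option) measure" where "PW = PiM UNIV (\<lambda>_. W)"

definition P :: "sample measure" where "P = PW \<Otimes>\<^sub>M PU"

lemma prob_space_W: "prob_space W"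
  unfolding W_def
proof (rule prob_space_restrict_space)
  show "emeasure (measure_pmf w) (born 0) = 1" using measure_pmf.emeasure_space_1[of w] set_w
    by (metis emeasure_pmf)
qed simp

sublocale W: prob_space W by (rule prob_space_W)
sublocale U: prob_space U by (rule prob_space_U)
sublocale PW: product_prob_space "\<lambda>_. W" UNIV by unfold_locales
sublocale PU: product_prob_space "\<lambda>_. U" UNIV by unfold_locales

lemma prob_space_P: "prob_space P"
proof -
  interpret A: prob_space PW unfolding PW_def by (rule prob_space_PiM) (rule prob_space_W)
  interpret B: prob_space PU unfolding PU_def by (rule prob_space_PiM) (rule prob_space_U)
  interpret pair_prob_space PW PU by unfold_locales
  show ?thesis unfolding P_def by unfold_locales
qed

sublocale P: prob_space P by (rule prob_space_P)

lemma space_W: "space W = born 0" by (simp add: W_def space_restrict_space)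
lemma space_U: "space U = {0..<1}" by (simp add: U_def space_restrict_space)
lemma space_PW: "J \<in> space PW \<longleftrightarrow> (\<forall>i. J i \<in> born 0)" by (auto simp: PW_def space_PiM space_W)
lemma space_PU: "Y \<in> space PU \<longleftrightarrow> (\<forall>i. 0 \<le> Y i \<and> Y i < 1)"
  by (auto simp: PU_def space_PiM space_U PiE_iff)

lemma space_P: "\<omega> \<in> space P \<longleftrightarrow> ok \<omega>"
  by (cases \<omega>) (auto simp: P_def space_pair_measure space_PW space_PU ok_def)

lemma sets_W: "A \<subseteq> born 0 \<Longrightarrow> A \<in> sets W"
  by (auto simp: W_def sets_restrict_space)

lemma emeasure_W: "emeasure W ({a} \<inter> born 0) = ennreal (pmf w a)"
proof (cases "a \<in> born 0")
  case True
  then show ?thesis by (simp add: W_def emeasure_restrict_space emeasure_pmf_single)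
next
  case False
  then have "pmf w a = 0" using set_w pmf_eq_0_set_pmf by metis
  then show ?thesis using False by simp
qed

lemma emeasure_U:
  assumes "0 \<le> a" "a \<le> b" "b \<le> 1"
  shows "emeasure U ({a..<b} \<inter> {0..<1}) = ennreal (b - a)"
proof -
  have "{a..<b} \<inter> {0..<1} = {a..<b}" using assms by auto
  then show ?thesis using assms by (simp add: U_def emeasure_restrict_space)
qed

definition root_box :: "nat set \<Rightarrow> (nat \<Rightarrow> nat option) \<Rightarrow> (nat \<Rightarrow> nat option) set" where
  "root_box I u = {J \<in> space PW. \<forall>i\<in>I. J i \<in> {u i} \<inter> born 0}"

lemma root_box: 
  assumes "finite I"
  shows "root_box I u \<in> sets PW" "emeasure PW (root_box I u) = ennreal (\<Prod>i\<in>I. pmf w (u i))"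
proof -
  show "root_box I u \<in> sets PW"
    unfolding root_box_def PW_def using assms sets_W by measurable
  show "emeasure PW (root_box I u) = ennreal (\<Prod>i\<in>I. pmf w (u i))"
    unfolding root_box_def PW_def using assms sets_W
    by (subst PW.emeasure_PiM_Collect) (auto simp: emeasure_W prod_ennreal)
qed

definition pos_box :: "nat set \<Rightarrow> nat \<Rightarrow> (nat \<Rightarrow> nat option) \<Rightarrow> (nat \<Rightarrow> real) set" where
  "pos_box I n v = {Y \<in> space PU. \<forall>i\<in>I. Y i \<in> {lo n (v i)..<hi n (v i)} \<inter> {0..<1}}"

lemma lo_hi: "0 \<le> lo n v" "lo n v \<le> hi n v" "hi n v \<le> 1"
  using ivl_born[of v n] ivl_unborn[of v n] by (cases "v \<in> born n"; force)+

lemma pos_box: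
  assumes "finite I"
  shows "pos_box I n v \<in> sets PU" "emeasure PU (pos_box I n v) = ennreal (\<Prod>i\<in>I. hi n (v i) - lo n (v
    i))"
proof -
  have s: "{a..<b} \<inter> {0..<1} \<in> sets U" for a b :: real
    unfolding U_def sets_restrict_space by (intro image_eqI[of _ _ "{a..<b}"]) auto
  show "pos_box I n v \<in> sets PU"
    unfolding pos_box_def PU_def using assms s by measurable
  show "emeasure PU (pos_box I n v) = ennreal (\<Prod>i\<in>I. hi n (v i) - lo n (v i))"
  proof -
    have "emeasure PU (pos_box I n v) = (\<Prod>i\<in>I. emeasure U ({lo n (v i)..<hi n (v i)} \<inter> {0..<1}))"
      unfolding pos_box_def PU_def by (rule PU.emeasure_PiM_Collect[OF subset_UNIV assms s])
    also have "\<dots> = (\<Prod>i\<in>I. ennreal (hi n (v i) - lo n (v i)))"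
      by (intro prod.cong refl emeasure_U lo_hi)
    finally show ?thesis using lo_hi by (simp add: prod_ennreal)
  qed
qed

text \<open>Being in a given cell is one condition on the root and one on the position, so the event
  is a rectangle and its probability factorises.\<close>

lemma cl_box: "{\<omega> \<in> space P. \<forall>i\<in>I. cl n \<omega> i = v i} = root_box I (\<lambda>i. anc n (v i)) \<times> pos_box I n v"
proof -
  have "cl n \<omega> i = v \<longleftrightarrow> anc n v = fst \<omega> i \<and> lo n v \<le> snd \<omega> i \<and> snd \<omega> i < hi n v" if "ok \<omega>" for \<omega> i v
    using that unfolding cl_def ok_def by (intro cell_iff) auto
  note iff = this
  show ?thesis
  proof (intro set_eqI)
    fix \<omega> :: sample
    show "\<omega> \<in> {\<omega> \<in> space P. \<forall>i\<in>I. cl n \<omega> i = v i} \<longleftrightarrow>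
      \<omega> \<in> root_box I (\<lambda>i. anc n (v i)) \<times> pos_box I n v"
    proof (cases "ok \<omega>")
      case True
      then show ?thesis using iff[OF True]
        by (cases \<omega>) (auto simp: space_P root_box_def pos_box_def space_PW space_PU ok_def)
    next
      case False
      then show ?thesis
        by (cases \<omega>) (auto simp: space_P root_box_def pos_box_def space_PW space_PU ok_def)
    qed
  qed
qed

lemma cl_prob_Pi:
  assumes "finite I"
  shows "{\<omega> \<in> space P. \<forall>i\<in>I. cl n \<omega> i = v i} \<in> sets P"
    "measure P {\<omega> \<in> space P. \<forall>i\<in>I. cl n \<omega> i = v i} = (\<Prod>i\<in>I. mass n (v i))"
proof -
  interpret A: prob_space PW unfolding PW_def by (rule prob_space_PiM) (rule prob_space_W)
  interpret B: prob_space PU unfolding PU_def by (rule prob_space_PiM) (rule prob_space_U)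
  show "{\<omega> \<in> space P. \<forall>i\<in>I. cl n \<omega> i = v i} \<in> sets P"
    unfolding cl_box unfolding P_def using root_box(1)[OF assms] pos_box(1)[OF assms]
    by (rule pair_measureI)
  have "emeasure P {\<omega> \<in> space P. \<forall>i\<in>I. cl n \<omega> i = v i} =
      ennreal (\<Prod>i\<in>I. pmf w (anc n (v i))) * ennreal (\<Prod>i\<in>I. hi n (v i) - lo n (v i))"
    unfolding cl_box unfolding P_def using root_box[OF assms] pos_box[OF assms]
    by (subst B.emeasure_pair_measure_Times) auto
  also have "\<dots> = ennreal (\<Prod>i\<in>I. mass n (v i))"
    using lo_hi by (simp add: mass_def prod.distrib prod_nonneg flip: ennreal_mult)
  finally show "measure P {\<omega> \<in> space P. \<forall>i\<in>I. cl n \<omega> i = v i} = (\<Prod>i\<in>I. mass n (v i))"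
    by (simp add: measure_def prod_nonneg mass_nonneg)
qed

lemma cl_measurable [measurable]: "(\<lambda>\<omega>. cl n \<omega> i) \<in> measurable P (count_space UNIV)"
proof -
  have "(\<lambda>\<omega>. cl n \<omega> i) -` {v} \<inter> space P = {\<omega> \<in> space P. \<forall>j\<in>{i}. cl n \<omega> j = v}" for v by auto
  then have "(\<lambda>\<omega>. cl n \<omega> i) -` {v} \<inter> space P \<in> sets P" for v
    using cl_prob_Pi(1)[of "{i}" n "\<lambda>_. v"] by simp
  then show ?thesis by (subst measurable_count_space_eq2_countable) auto
qed

definition cls_at :: "nat \<Rightarrow> nat list \<Rightarrow> sample \<Rightarrow> nat option list" where
  "cls_at n b \<omega> = map (cl n \<omega>) b"

lemma cls_at_sets: "{\<omega> \<in> space P. cls_at n b \<omega> = v} \<in> sets P"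
proof -
  have "{\<omega> \<in> space P. cls_at n b \<omega> = v} =
    {\<omega> \<in> space P. length b = length v \<and> (\<forall>i\<in>{..<length b}. cl n \<omega> (b ! i) = v ! i)}"
    by (auto simp: cls_at_def list_eq_iff_nth_eq)
  also have "\<dots> \<in> sets P" by measurable
  finally show ?thesis .
qed

lemma cls_at_prob:
  assumes "distinct b" "length v = length b"
  shows "measure P {\<omega> \<in> space P. cls_at n b \<omega> = v} = prod_list (map (mass n) v)"
proof -
  define u where "u i = the (map_of (zip b v) i)" for i
  have u: "v = map u b"
  proof (rule nth_equalityI)
    fix i assume "i < length v"
    then show "v ! i = map u b ! i" using assms by (simp add: u_def map_of_zip_nth)
  qed (use assms in simp)
  have "{\<omega> \<in> space P. cls_at n b \<omega> = v} = {\<omega> \<in> space P. \<forall>i\<in>set b. cl n \<omega> i = u i}"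
    by (auto simp: cls_at_def u)
  then show ?thesis using cl_prob_Pi(2)[of "set b" n u] assms
    by (simp add: u prod.distinct_set_conv_list comp_def)
qed

lemma cls_at_tuples: "\<omega> \<in> space P \<Longrightarrow> cls_at n b \<omega> \<in> tuples (born n) (length b)"
  by (auto simp: cls_at_def tuples_def space_P cl_born)

lemma cls_at_prob_set:
  assumes "distinct b"
  shows "{\<omega> \<in> space P. cls_at n b \<omega> \<in> X} \<in> sets P"
    "measure P {\<omega> \<in> space P. cls_at n b \<omega> \<in> X} = (\<Sum>v\<in>tuples (born n) (length b) \<inter> X. prod_list (map
      (mass n) v))"
proof -
  let ?T = "tuples (born n) (length b) \<inter> X"
  have fin: "finite ?T" using finite_tuples[OF finite_born] by blast
  have eq: "{\<omega> \<in> space P. cls_at n b \<omega> \<in> X} = (\<Union>v\<in>?T. {\<omega> \<in> space P. cls_at n b \<omega> = v})"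
    using cls_at_tuples by auto
  show "{\<omega> \<in> space P. cls_at n b \<omega> \<in> X} \<in> sets P" unfolding eq using fin cls_at_sets by auto
  have "measure P (\<Union>v\<in>?T. {\<omega> \<in> space P. cls_at n b \<omega> = v}) = (\<Sum>v\<in>?T. measure P {\<omega> \<in> space P. cls_at
    n b \<omega> = v})"
    using fin cls_at_sets
    by (intro P.finite_measure_finite_Union) (auto simp: disjoint_family_on_def)
  also have "\<dots> = (\<Sum>v\<in>?T. prod_list (map (mass n) v))"
    by (intro sum.cong refl cls_at_prob[OF assms]) (auto simp: tuples_def)
  finally show "measure P {\<omega> \<in> space P. cls_at n b \<omega> \<in> X} = (\<Sum>v\<in>?T. prod_list (map (mass n) v))"
    unfolding eq .
qed

end

lemma sum_tuples:
  fixes m :: "'b \<Rightarrow> real"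
  assumes "finite B"
  shows "(\<Sum>u\<in>tuples B k. prod_list (map m u)) = (\<Sum>v\<in>B. m v) ^ k"
proof (induction k)
  case 0
  have "tuples B 0 = {[]}" by (auto simp: tuples_def)
  then show ?case by simp
next
  case (Suc k)
  have eq: "tuples B (Suc k) = (\<lambda>(v, u). v # u) ` (B \<times> tuples B k)"
    by (auto simp: tuples_def length_Suc_conv image_iff)
  have "inj_on (\<lambda>(v, u). v # u) (B \<times> tuples B k)" by (auto simp: inj_on_def)
  then have "(\<Sum>u\<in>tuples B (Suc k). prod_list (map m u)) = (\<Sum>(v, u)\<in>B \<times> tuples B k. m v * prod_list
    (map m u))"
    unfolding eq by (subst sum.reindex) (auto simp: case_prod_unfold)
  also have "\<dots> = (\<Sum>v\<in>B. m v) * (\<Sum>u\<in>tuples B k. prod_list (map m u))"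
    by (simp add: sum_product sum.cartesian_product)
  finally show ?case using Suc by simp
qed

section \<open>Limit events: independence, exchangeability and genericity\<close>

context sampler_pmf
begin

definition lab_tuples :: "nat list set \<Rightarrow> nat option list set" where
  "lab_tuples A = {v. None \<notin> set v \<and> distinct v \<and> map (\<lambda>c. lab (the c)) v \<in> A}"

text \<open>By \<open>prob_cls_at\<close> this is the probability that \<open>k\<close> distinct
  points have their cells at level \<open>n\<close> in \<open>X\<close>. That it depends only on the
  number of points is the source of exchangeability.\<close>

definition fsum :: "nat \<Rightarrow> nat \<Rightarrow> nat option list set \<Rightarrow> real" where
  "fsum n k X = (\<Sum>v\<in>tuples (born n) k \<inter> X. prod_list (map (mass n) v))"

lemma realized_iff_lab_tuples:
  "distinct b \<Longrightarrow> realized A b \<omega> n \<longleftrightarrow> cls_at n b \<omega> \<in> lab_tuples A"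
proof -
  assume "distinct b"
  moreover have "None \<notin> set (map (cl n \<omega>) b) \<longleftrightarrow> (\<forall>i\<in>set b. cl n \<omega> i \<noteq> None)"
    unfolding set_map image_iff by (metis (no_types, lifting))
  moreover have "map (\<lambda>c. lab (the c)) (map (cl n \<omega>) b) = map (lb n \<omega>) b" by (simp add: lb_def)
  ultimately show ?thesis
    unfolding realized_def cls_at_def lab_tuples_def sep_def mem_Collect_eq distinct_map
    by presburger
qed

lemma prob_cls_at: "distinct b \<Longrightarrow> P.prob {\<omega> \<in> space P. cls_at n b \<omega> \<in> X} = fsum n (length b) X"
  unfolding fsum_def by (rule cls_at_prob_set)

definition tset :: "nat list set \<Rightarrow> nat list \<Rightarrow> sample set" where
  "tset A b = {\<omega> \<in> space P. \<exists>n. realized A b \<omega> n}"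

lemma tset_eq: "distinct b \<Longrightarrow> tset A b = (\<Union>n. {\<omega> \<in> space P. cls_at n b \<omega> \<in> lab_tuples A})"
  unfolding tset_def by (auto simp: realized_iff_lab_tuples)

lemma tset_sets: "distinct b \<Longrightarrow> tset A b \<in> sets P"
  using cls_at_prob_set(1) by (auto simp: tset_eq)

lemma incseq_stage:
  assumes "inv_set G A" "distinct b"
  shows "incseq (\<lambda>n. {\<omega> \<in> space P. cls_at n b \<omega> \<in> lab_tuples A})"
  unfolding incseq_def
proof (intro allI impI subsetI CollectI conjI)
  fix m n \<omega> assume mn: "m \<le> n" and \<omega>: "\<omega> \<in> {\<omega> \<in> space P. cls_at m b \<omega> \<in> lab_tuples A}"
  then show "\<omega> \<in> space P" by simp
  have "realized A b \<omega> m" using \<omega> realized_iff_lab_tuples[OF assms(2)] by simp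
  then have "realized A b \<omega> n"
    by (rule realized_mono[OF _ assms(1) _ mn, rotated]) (use \<omega> space_P in simp)
  then show "cls_at n b \<omega> \<in> lab_tuples A" using realized_iff_lab_tuples[OF assms(2)] by simp
qed

lemma tset_tendsto:
  assumes "inv_set G A" "distinct b"
  shows "(\<lambda>n. fsum n (length b) (lab_tuples A)) \<longlonglongrightarrow> P.prob (tset A b)"
  unfolding tset_eq[OF assms(2)] prob_cls_at[OF assms(2), symmetric]
  by (rule P.finite_Lim_measure_incseq) (use incseq_stage[OF assms] cls_at_prob_set(1)[OF assms(2)]
    in auto)

lemma fsum_append:
  "fsum n (k + k') {v @ v' | v v'. v \<in> X \<and> length v = k \<and> v' \<in> X'} = fsum n k X * fsum n k' X'"
proof -
  let ?A = "tuples (born n) k \<inter> X" and ?A' = "tuples (born n) k' \<inter> X'"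
  have eq: "tuples (born n) (k + k') \<inter> {v @ v' | v v'. v \<in> X \<and> length v = k \<and>
    v' \<in> X'} = (\<lambda>(v, v'). v @ v') ` (?A \<times> ?A')"
    by (auto simp: tuples_def image_iff)
  have "inj_on (\<lambda>(v, v'). v @ v') (?A \<times> ?A')" by (auto simp: inj_on_def tuples_def)
  then have "fsum n (k + k') {v @ v' | v v'. v \<in> X \<and> length v = k \<and> v' \<in> X'} =
      (\<Sum>(v, v')\<in>?A \<times> ?A'. prod_list (map (mass n) v) * prod_list (map (mass n) v'))"
    unfolding fsum_def eq by (subst sum.reindex) (auto simp: case_prod_unfold)
  then show ?thesis unfolding fsum_def by (simp add: sum_product sum.cartesian_product)
qed

lemma tset_joint_tendsto:
  assumes A: "inv_set G A" and A': "inv_set G A'" and d: "distinct (b @ b')"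
  shows "(\<lambda>n. fsum n (length b) (lab_tuples A) * fsum n (length b') (lab_tuples A')) \<longlonglongrightarrow> P.prob (tset
    A b \<inter> tset A' b')"
proof -
  have db: "distinct b" "distinct b'" using d by auto
  let ?E = "\<lambda>n. {\<omega> \<in> space P. cls_at n b \<omega> \<in> lab_tuples A} \<inter> {\<omega> \<in> space P. cls_at n b' \<omega> \<in>
    lab_tuples A'}"
  let ?X = "{v @ v' | v v'. v \<in> lab_tuples A \<and> length v = length b \<and> v' \<in> lab_tuples A'}"
  have inc: "incseq ?E" using incseq_stage[OF A db(1)] incseq_stage[OF A' db(2)]
    unfolding incseq_def by blast
  have E: "?E n = {\<omega> \<in> space P. cls_at n (b @ b') \<omega> \<in> ?X}" for n
    by (auto simp: cls_at_def) (metis length_map append_eq_append_conv)+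
  have "P.prob (?E n) = fsum n (length b) (lab_tuples A) * fsum n (length b') (lab_tuples A')" for n
    unfolding E prob_cls_at[OF d] length_append by (rule fsum_append)
  moreover have "(\<lambda>n. P.prob (?E n)) \<longlonglongrightarrow> P.prob (\<Union>n. ?E n)"
    by (rule P.finite_Lim_measure_incseq) (use inc cls_at_prob_set(1)[OF db(1)]
      cls_at_prob_set(1)[OF db(2)] in auto)
  moreover have "(\<Union>n. ?E n) = tset A b \<inter> tset A' b'"
  proof (intro equalityI subsetI)
    fix \<omega> assume "\<omega> \<in> tset A b \<inter> tset A' b'"
    then obtain n n' where "\<omega> \<in> {\<omega> \<in> space P. cls_at n b \<omega> \<in> lab_tuples A}"
      "\<omega> \<in> {\<omega> \<in> space P. cls_at n' b' \<omega> \<in> lab_tuples A'}"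
      unfolding tset_eq[OF db(1)] tset_eq[OF db(2)] by blast
    then have "\<omega> \<in> ?E (max n n')"
      using incseqD[OF incseq_stage[OF A db(1)], of n "max n n'"] incseqD[OF incseq_stage[OF A'
        db(2)], of n' "max n n'"]
      by (meson IntI max.cobounded1 max.cobounded2 subsetD)
    then show "\<omega> \<in> (\<Union>n. ?E n)" by blast
  qed (auto simp: tset_eq[OF db(1)] tset_eq[OF db(2)])
  ultimately show ?thesis by simp
qed

text \<open>Disjoint tuples are independent at every level, and the product formula survives in the
  limit.\<close>

lemma tset_indep:
  assumes "inv_set G A" "inv_set G A'" "distinct (b @ b')"
  shows "P.prob (tset A b \<inter> tset A' b') = P.prob (tset A b) * P.prob (tset A' b')"
proof (rule LIMSEQ_unique[OF tset_joint_tendsto[OF assms]])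
  show "(\<lambda>n. fsum n (length b) (lab_tuples A) * fsum n (length b') (lab_tuples A')) \<longlonglongrightarrow> P.prob (tset A
    b) * P.prob (tset A' b')"
    by (intro tendsto_mult tset_tendsto) (use assms in auto)
qed

lemma tset_exchangeable:
  assumes "inv_set G A" "distinct b" "distinct b'" "length b = length b'"
  shows "P.prob (tset A b) = P.prob (tset A b')"
  using tset_tendsto[OF assms(1,2)] tset_tendsto[OF assms(1,3)] LIMSEQ_unique
  unfolding assms(4) by blast

lemma AE_not_if_small:
  assumes E: "\<And>n. E n \<in> sets P" and lim: "(\<lambda>n. P.prob (E n)) \<longlonglongrightarrow> 0"
  shows "AE \<omega> in P. \<exists>n. \<omega> \<notin> E n"
proof (rule AE_I')
  have "P.prob (\<Inter>n. E n) \<le> P.prob (E n)" for n by (rule P.finite_measure_mono) (use E in auto)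
  then have "P.prob (\<Inter>n. E n) \<le> 0" using lim by (intro LIMSEQ_le_const[OF lim]) auto
  then show "(\<Inter>n. E n) \<in> null_sets P"
    using E by (intro null_setsI) (auto simp: P.emeasure_eq_measure measure_le_0_iff)
qed auto

lemma AE_labelled: "AE \<omega> in P. \<exists>n. cl n \<omega> i \<noteq> None"
proof -
  have "AE \<omega> in P. \<exists>n. \<omega> \<notin> {\<omega> \<in> space P. cls_at n [i] \<omega> \<in> {[None]}}"
  proof (rule AE_not_if_small)
    have "tuples (born n) (length [i]) \<inter> {[None]} = {[None]}" for n
      by (auto simp: tuples_def None_born)
    then show "(\<lambda>n. P.prob {\<omega> \<in> space P. cls_at n [i] \<omega> \<in> {[None]}}) \<longlonglongrightarrow> 0"
      by (subst prob_cls_at) (use mass_None_tendsto in \<open>simp_all add: fsum_def\<close>)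
  qed (intro cls_at_prob_set(1), simp)
  then show ?thesis using AE_space by eventually_elim (auto simp: cls_at_def)
qed

lemma AE_separate:
  assumes "i \<noteq> j"
  shows "AE \<omega> in P. \<exists>n. cl n \<omega> i \<noteq> cl n \<omega> j"
proof -
  let ?D = "range (\<lambda>v. [v, v])"
  have "AE \<omega> in P. \<exists>n. \<omega> \<notin> {\<omega> \<in> space P. cls_at n [i, j] \<omega> \<in> ?D}"
  proof (rule AE_not_if_small)
    have "tuples (born n) (length [i, j]) \<inter> ?D = (\<lambda>v. [v, v]) ` born n" for n
      by (auto simp: tuples_def)
    then have "fsum n (length [i, j]) ?D = coll n" for n
      unfolding fsum_def coll_def
      by (simp only:) (subst sum.reindex, auto simp: inj_on_def power2_eq_square)
    then show "(\<lambda>n. P.prob {\<omega> \<in> space P. cls_at n [i, j] \<omega> \<in> ?D}) \<longlonglongrightarrow> 0"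
      using coll_tendsto assms by (subst prob_cls_at) simp_all
  qed (intro cls_at_prob_set(1), use assms in simp)
  then show ?thesis using AE_space by eventually_elim (auto simp: cls_at_def)
qed

lemma AE_hit:
  assumes v: "v \<in> born n"
  shows "AE \<omega> in P. \<exists>l. cl n \<omega> l = v"
proof -
  let ?D = "{u. v \<notin> set u}"
  \<comment> \<open>The level \<open>n\<close> is fixed here; the events shrink with the number
    \<open>k\<close> of points, all of which miss the cell.\<close>
  have "AE \<omega> in P. \<exists>k. \<omega> \<notin> {\<omega> \<in> space P. cls_at n [0..<k] \<omega> \<in> ?D}"
  proof (rule AE_not_if_small)
    have "tuples (born n) k \<inter> ?D = tuples (born n - {v}) k" for k by (auto simp: tuples_def)
    then have "fsum n k ?D = (1 - mass n v) ^ k" for k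
      unfolding fsum_def using sum_tuples[of "born n - {v}" "mass n" k] finite_born v sum_mass[of n]
      by (simp add: sum_diff1)
    moreover have "mass n v \<le> 1"
      using sum_mass[of n] member_le_sum[of v "born n" "mass n"] v finite_born mass_nonneg by simp
    then have "(\<lambda>k. (1 - mass n v) ^ k) \<longlonglongrightarrow> 0"
      using mass_pos[OF v] by (intro LIMSEQ_realpow_zero) auto
    ultimately show "(\<lambda>k. P.prob {\<omega> \<in> space P. cls_at n [0..<k] \<omega> \<in> ?D}) \<longlonglongrightarrow> 0"
      by (subst prob_cls_at) simp_all
  qed (intro cls_at_prob_set(1), simp)
  then show ?thesis using AE_space by eventually_elim (auto simp: cls_at_def)
qed

lemma generic_sets: "{\<omega> \<in> space P. generic \<omega>} \<in> sets P"
proof -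
  have "{\<omega> \<in> space P. generic \<omega>} = {\<omega> \<in> space P. (\<forall>i. \<exists>n. cl n \<omega> i \<noteq> None) \<and> (\<forall>i j. i \<noteq> j \<longrightarrow>
    (\<exists>n. cl n \<omega> i \<noteq> cl n \<omega> j)) \<and>
     (\<forall>n. \<forall>v\<in>born n. \<exists>l. cl n \<omega> l = v)}"
    by (auto simp: generic_def space_P)
  also have "\<dots> \<in> sets P" by measurable
  finally show ?thesis .
qed

lemma AE_generic: "AE \<omega> in P. generic \<omega>"
proof -
  have "AE \<omega> in P. \<forall>i. \<exists>n. cl n \<omega> i \<noteq> None" using AE_labelled by (simp add: AE_all_countable)
  moreover have "AE \<omega> in P. \<forall>i j. i \<noteq> j \<longrightarrow> (\<exists>n. cl n \<omega> i \<noteq> cl n \<omega> j)"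
    unfolding AE_all_countable using AE_separate by (auto intro: AE_mp)
  moreover have "AE \<omega> in P. \<forall>n v. v \<in> born n \<longrightarrow> (\<exists>l. cl n \<omega> l = v)"
    unfolding AE_all_countable using AE_hit by (auto intro: AE_mp)
  ultimately show ?thesis using AE_space by eventually_elim (auto simp: generic_def space_P)
qed

end

section \<open>Ergodicity and the law of the sampled structure\<close>

lemma (in finite_measure) measure_le_sym_diff:
  assumes "X \<in> sets M" "Y \<in> sets M"
  shows "measure M X \<le> measure M Y + measure M (sym_diff X Y)"
proof -
  have "measure M X \<le> measure M (Y \<union> sym_diff X Y)" using assms by (intro finite_measure_mono) auto
  also have "\<dots> \<le> measure M Y + measure M (sym_diff X Y)" using assms by (intro measure_Un_le) auto
  finally show ?thesis .
qed

lemma (in finite_measure) measure_abs_diff_le: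
  assumes "X \<in> sets M" "Y \<in> sets M"
  shows "\<bar>measure M X - measure M Y\<bar> \<le> measure M (sym_diff X Y)"
  using measure_le_sym_diff[OF assms] measure_le_sym_diff[OF assms(2,1)]
  by (simp add: Un_commute abs_le_iff)

lemma (in finite_measure) measure_sym_diff_trans:
  assumes "X \<in> sets M" "Y \<in> sets M" "Z \<in> sets M"
  shows "measure M (sym_diff X Z) \<le> measure M (sym_diff X Y) + measure M (sym_diff Y Z)"
proof -
  have "measure M (sym_diff X Z) \<le> measure M (sym_diff X Y \<union> sym_diff Y Z)"
    using assms by (intro finite_measure_mono) auto
  also have "\<dots> \<le> measure M (sym_diff X Y) + measure M (sym_diff Y Z)"
    using assms by (intro measure_Un_le) auto
  finally show ?thesis .
qed

definition block_swap :: "nat \<Rightarrow> nat \<Rightarrow> nat" where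
  "block_swap k i = (if i < k then i + k else if i < 2 * k then i - k else i)"

lemma block_swap_idem: "block_swap k \<circ> block_swap k = id"
  by (auto simp: block_swap_def fun_eq_iff)

lemma bij_block_swap: "bij (block_swap k)"
  using block_swap_idem by (metis o_bij)

lemma inv_block_swap: "inv (block_swap k) = block_swap k"
  using block_swap_idem by (metis inv_unique_comp)

lemma map_block_swap: "map (block_swap k) [0..<k] = [k..<2 * k]"
  by (rule nth_equalityI) (auto simp: block_swap_def)

context
  fixes L :: "('r, 'f) language" and M :: "('r, 'f) struct"
  assumes L: "countable_language L" and M: "M \<in> Str L"
begin

interpretation perm_group "Aut L M" using M by (rule perm_group_Aut)

lemma cyl_lift:
  assumes "inv_set (Aut L M) A" "k \<le> K"
  shows "\<exists>A'. inv_set (Aut L M) A' \<and> cyl L M A [0..<k] = cyl L M A' [0..<K]"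
proof -
  have "set [0..<k] \<subseteq> {..<K}" using assms(2) by auto
  then show ?thesis using cyl_reindex[OF L M assms(1)] inv_set_reindex[OF assms(1)] by blast
qed

text \<open>The approximable sets form a sigma-algebra. A countable union is cut off after finitely
  many members, whose approximating cylinders are lifted to a common length; their union is then
  again a cylinder.\<close>

lemma cyl_approx:
  assumes \<mu>: "prob_space \<mu>" "sets \<mu> = sets (Str_borel L)"
    and B: "B \<in> sigma_sets (orbit L M) (cyl_base L M)" and \<epsilon>: "0 < \<epsilon>"
  shows "\<exists>A k. inv_set (Aut L M) A \<and> measure \<mu> (sym_diff B (cyl L M A [0..<k])) < \<epsilon>"
proof -
  interpret prob_space \<mu> by fact
  interpret S: sigma_algebra "orbit L M" "sigma_sets (orbit L M) (cyl_base L M)"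
    by (rule sigma_algebra_sigma_sets[OF cyl_base_subset[OF L M]])
  have sets: "X \<in> sets \<mu>" if "X \<in> sigma_sets (orbit L M) (cyl_base L M)" for X
    using that orbit_measurable[OF L M]
    unfolding \<mu>(2) by induction (auto intro: cyl_base_sets[OF L M])
  have csets: "cyl L M A [0..<k] \<in> sets \<mu>" if "inv_set (Aut L M) A" for A k
    using cyl_sets[OF L M that] \<mu> by simp
  show ?thesis using B \<epsilon>
  proof (induction arbitrary: \<epsilon>)
    case (Basic X)
    have "inv_set (Aut L M) {}" by (simp add: inv_set_def)
    then have "\<exists>A k. inv_set (Aut L M) A \<and> X = cyl L M A [0..<k]"
      using Basic(1) inv_set_sim unfolding cyl_base_def[OF L M] by (auto simp: cyl_def)
    then obtain A k where A: "inv_set (Aut L M) A" "X = cyl L M A [0..<k]" by blast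
    then have "prob (sym_diff X (cyl L M A [0..<k])) = 0" by simp
    then show ?case using A(1) Basic(2) by metis
  next
    case Empty
    have "inv_set (Aut L M) {}" "cyl L M {} [0..<0] = {}" by (auto simp: inv_set_def cyl_def)
    then show ?case using Empty by (intro exI[of _ "{}"] exI[of _ 0]) simp
  next
    case (Compl X)
    then obtain A k where A: "inv_set (Aut L M) A" "measure \<mu> (sym_diff X (cyl L M A [0..<k])) < \<epsilon>"
      by blast
    have "sym_diff (orbit L M - X) (cyl L M (- A) [0..<k]) = sym_diff X (cyl L M A [0..<k])"
      using S.sets_into_space[OF Compl(1)] cyl_subset[OF L M, of A "[0..<k]"]
      unfolding cyl_Compl[OF L M A(1), symmetric] by blast
    then show ?case using A inv_set_Compl[OF perm_group_axioms] by metis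
  next
    case (Union X)
    have Xs: "X i \<in> sets \<mu>" for i using Union.hyps sets by blast
    have "(\<lambda>n. prob (\<Union>i<n. X i)) \<longlonglongrightarrow> prob (\<Union>n. \<Union>i<n. X i)"
    proof (rule finite_Lim_measure_incseq)
      show "incseq (\<lambda>n. \<Union>i<n. X i)" unfolding incseq_def by (intro allI impI UN_mono) auto
    qed (use Xs in auto)
    moreover have "(\<Union>n. \<Union>i<n. X i) = (\<Union>i. X i)" by auto
    ultimately have "\<forall>\<^sub>F n in sequentially. prob (\<Union>i. X i) - \<epsilon> / 2 < prob (\<Union>i<n. X i)"
      using Union.prems by (intro order_tendstoD(1)) auto
    then obtain n where n: "prob (\<Union>i. X i) - \<epsilon> / 2 < prob (\<Union>i<n. X i)"
      unfolding eventually_sequentially by blast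
    have rest: "prob ((\<Union>i. X i) - (\<Union>i<n. X i)) < \<epsilon> / 2"
      using n Xs by (subst finite_measure_Diff) auto
    \<comment> \<open>Half of the error pays for the tail and the other half is shared by the
      \<open>n\<close> members kept; \<open>Suc n\<close> avoids a division by zero.\<close>
    have "\<exists>A k. inv_set (Aut L M) A \<and> measure \<mu> (sym_diff (X i) (cyl L M A [0..<k])) < \<epsilon> / (2 * Suc
      n)" for i
      using Union.prems by (intro Union.IH) simp
    then obtain A k where A: "\<And>i. inv_set (Aut L M) (A i)"
      "\<And>i. measure \<mu> (sym_diff (X i) (cyl L M (A i) [0..<k i])) < \<epsilon> / (2 * Suc n)" by metis
    define K where "K = Max (insert 0 (k ` {..<n}))"
    have "\<exists>A'. inv_set (Aut L M) A' \<and> (i < n \<longrightarrow> cyl L M (A i) [0..<k i] = cyl L M A' [0..<K])" for i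
    proof (cases "i < n")
      case True
      then have "k i \<le> K" by (auto simp: K_def)
      then show ?thesis using cyl_lift[OF A(1)[of i], of "k i" K] by auto
    next
      case False
      then show ?thesis using A(1) by blast
    qed
    then obtain A' where A': "\<And>i. inv_set (Aut L M) (A' i)"
      "\<And>i. i < n \<Longrightarrow> cyl L M (A i) [0..<k i] = cyl L M (A' i) [0..<K]" by metis
    let ?C = "\<lambda>i. cyl L M (A' i) [0..<K]"
    have Un: "cyl L M (\<Union>i<n. A' i) [0..<K] = (\<Union>i<n. ?C i)"
      using cyl_UN[OF L M, of "{..<n}" A'] A'(1) by simp
    have "measure \<mu> (sym_diff (\<Union>i. X i) (\<Union>i<n. ?C i)) \<le>
        measure \<mu> (((\<Union>i. X i) - (\<Union>i<n. X i)) \<union> (\<Union>i<n. sym_diff (X i) (?C i)))"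
      using Xs csets[OF A'(1)] by (intro finite_measure_mono) auto
    also have "\<dots> \<le> measure \<mu> ((\<Union>i. X i) - (\<Union>i<n. X i)) + measure \<mu> (\<Union>i<n. sym_diff (X i) (?C i))"
      using Xs csets[OF A'(1)] by (intro measure_Un_le) auto
    also have "measure \<mu> (\<Union>i<n. sym_diff (X i) (?C i)) \<le> (\<Sum>i<n. measure \<mu> (sym_diff (X i) (?C i)))"
      using Xs csets[OF A'(1)] by (intro measure_UNION_le) auto
    also have "\<dots> \<le> (\<Sum>i<n. \<epsilon> / (2 * Suc n))"
    proof (rule sum_mono)
      fix i assume "i \<in> {..<n}"
      then show "measure \<mu> (sym_diff (X i) (?C i)) \<le> \<epsilon> / (2 * Suc n)"
        using less_imp_le[OF A(2)[of i]] A'(2)[of i] by simp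
    qed
    also have "\<dots> \<le> \<epsilon> / 2" using Union.prems by (simp add: field_simps)
    finally have "measure \<mu> (sym_diff (\<Union>i. X i) (\<Union>i<n. ?C i)) < \<epsilon>" using rest by simp
    moreover have "inv_set (Aut L M) (\<Union>i<n. A' i)" using A'(1) by (intro inv_set_UN)
    ultimately show ?case unfolding Un[symmetric] by blast
  qed
qed

text \<open>Approximate an invariant set \<open>B\<close> by a cylinder \<open>C\<close> on the first \<open>k\<close> points and swap these with
  the next \<open>k\<close>: then \<open>B\<close> is also close to the intersection of two independent copies of \<open>C\<close>.\<close>

lemma ergodicI:
  assumes \<mu>: "prob_space \<mu>" "sets \<mu> = sets (Str_borel L)" "emeasure \<mu> (orbit L M) = 1"
    and inv: "invariant L \<mu>"
    and mix: "\<And>A k. inv_set (Aut L M) A \<Longrightarrow>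
      measure \<mu> (cyl L M A [0..<k] \<inter> cyl L M A [k..<2 * k]) = (measure \<mu> (cyl L M A [0..<k]))\<^sup>2"
  shows "ergodic L \<mu>"
  unfolding ergodic_def
proof (intro ballI impI)
  interpret prob_space \<mu> by fact
  fix B assume B: "B \<in> sets \<mu>"
    and Binv: "\<forall>g. bij g \<longrightarrow> emeasure \<mu> (sym_diff B (act L (inv g) ` B)) = 0"
  have BL: "B \<in> sets (Str_borel L)" using B \<mu> by simp
  have actsets: "act L g ` X \<in> sets \<mu>" if "bij g" "X \<in> sets \<mu>" for g X
    using act_image_sets[OF that(1), of X L] that \<mu> by simp
  let ?p = "prob B"
  \<comment> \<open>Up to \<open>2 * \<epsilon>\<close> comes from replacing \<open>B\<close> by the
    intersection of two copies of the cylinder, and another \<open>2 * \<epsilon>\<close> from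
    comparing the squares, as both probabilities are at most 1.\<close>
  have close: "\<bar>?p - ?p\<^sup>2\<bar> \<le> 4 * \<epsilon>" if \<epsilon>: "0 < \<epsilon>" for \<epsilon> :: real
  proof -
    obtain A k where A: "inv_set (Aut L M) A"
      "prob (sym_diff (B \<inter> orbit L M) (cyl L M A [0..<k])) < \<epsilon>"
      using cyl_approx[OF \<mu>(1,2) borel_trace[OF L M BL] \<epsilon>] by blast
    let ?C = "cyl L M A [0..<k]"
    let ?g = "block_swap k"
    have C: "?C \<in> sets \<mu>" using cyl_sets[OF L M A(1)] \<mu> by simp
    have "prob (sym_diff B ?C) = prob (sym_diff B ?C \<inter> orbit L M)"
      using emeasure_orbit_Int[OF L M \<mu>, of "sym_diff B ?C"] B C by (simp add: measure_def)
    also have "sym_diff B ?C \<inter> orbit L M = sym_diff (B \<inter> orbit L M) ?C"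
      using cyl_subset[OF L M] by blast
    finally have BC: "prob (sym_diff B ?C) < \<epsilon>" using A(2) by simp
    have gC: "act L ?g ` ?C = cyl L M A [k..<2 * k]"
      using cyl_act[OF L M bij_block_swap A(1), of k "[0..<k]"] by (simp only: map_block_swap)
    have "prob (sym_diff B (act L ?g ` B)) = 0"
      using Binv bij_block_swap[of k] inv_block_swap[of k]
      by (metis measure_eq_emeasure_eq_ennreal ennreal_0 order_refl)
    moreover have "prob (sym_diff (act L ?g ` B) (act L ?g ` ?C)) < \<epsilon>"
    proof -
      have X: "X \<in> sets (Str_borel L) \<Longrightarrow> act L ?g ` X = act L (inv ?g) -` X \<inter> Str L" for X
        using vimage_act[OF L M bij_block_swap] by blast
      have "sym_diff (act L ?g ` B) (act L ?g ` ?C) = act L ?g ` (sym_diff B ?C)"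
        using X[of B] X[of ?C] X[of "sym_diff B ?C"] BL C \<mu>(2) by auto
      moreover have "emeasure \<mu> (act L ?g ` (sym_diff B ?C)) = emeasure \<mu> (sym_diff B ?C)"
        using inv bij_block_swap B C unfolding invariant_def by blast
      ultimately show ?thesis using BC by (simp add: measure_def)
    qed
    ultimately have BgC: "prob (sym_diff B (act L ?g ` ?C)) < \<epsilon>"
      using measure_sym_diff_trans[OF B actsets[OF bij_block_swap B] actsets[OF bij_block_swap
        C], of k k] by simp
    have gCs: "act L ?g ` ?C \<in> sets \<mu>" using actsets[OF bij_block_swap C] .
    have "prob (sym_diff B (?C \<inter> act L ?g ` ?C)) \<le> prob (sym_diff B ?C \<union> sym_diff B (act L ?g `
      ?C))"
      using B C gCs by (intro finite_measure_mono) auto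
    also have "\<dots> \<le> prob (sym_diff B ?C) + prob (sym_diff B (act L ?g ` ?C))"
      using B C gCs by (intro measure_Un_le) auto
    finally have 1: "\<bar>?p - prob (?C \<inter> act L ?g ` ?C)\<bar> \<le> 2 * \<epsilon>"
      using measure_abs_diff_le[OF B sets.Int[OF C gCs]] BC BgC by simp
    have 2: "\<bar>?p - prob ?C\<bar> \<le> \<epsilon>" using measure_abs_diff_le[OF B C] BC by simp
    have "(prob ?C)\<^sup>2 - ?p\<^sup>2 = (prob ?C - ?p) * (prob ?C + ?p)"
      by (simp add: power2_eq_square algebra_simps)
    then have "\<bar>(prob ?C)\<^sup>2 - ?p\<^sup>2\<bar> = \<bar>?p - prob ?C\<bar> * (prob ?C + ?p)"
      by (simp add: abs_mult abs_minus_commute)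
    also have "\<dots> \<le> \<epsilon> * 2" 
      using 2 \<epsilon> add_mono[OF prob_le_1[of ?C] prob_le_1[of B]] by (intro mult_mono) auto
    finally show ?thesis using 1 mix[OF A(1), of k] unfolding gC by linarith
  qed
  have "?p - ?p\<^sup>2 = 0"
  proof (rule ccontr)
    assume "?p - ?p\<^sup>2 \<noteq> 0"
    then show False using close[of "\<bar>?p - ?p\<^sup>2\<bar> / 8"] by simp
  qed
  then have "?p = 0 \<or> ?p = 1" by (simp add: power2_eq_square)
  then show "emeasure \<mu> B = 0 \<or> emeasure \<mu> B = 1" by (auto simp: emeasure_eq_measure)
qed

end

section \<open>The random structure and its law\<close>

locale str_sampler = sampler_pmf "Aut L M" lab par n1 w
  for L :: "('r, 'f) language" and M :: "('r, 'f) struct" and lab par n1 w +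
  assumes L: "countable_language L" and M: "M \<in> Str L"
begin

definition relabel :: "sample \<Rightarrow> nat \<Rightarrow> nat" where
  "relabel \<omega> = (SOME h. bij h \<and> (\<forall>b. \<exists>n. sep n \<omega> (set b) \<and>
    sim (Aut L M) (map (lb n \<omega>) b) (map h b)))"

text \<open>The relabelling is an arbitrary choice, made without regard to measurability. By
  \<open>rstr_cyl\<close>, membership in cylinders does not depend on it. The default
  \<open>M\<close> keeps all values in the orbit.\<close>

definition rstr :: "sample \<Rightarrow> ('r, 'f) struct" where
  "rstr \<omega> = (if generic \<omega> then act L (inv (relabel \<omega>)) M else M)"

definition law :: "('r, 'f) struct measure" where
  "law = distr P (Str_borel L) rstr"

lemma relabel:
  assumes "generic \<omega>"
  shows "bij (relabel \<omega>)" "\<And>b. \<exists>n. sep n \<omega> (set b) \<and>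
    sim (Aut L M) (map (lb n \<omega>) b) (map (relabel \<omega>) b)"
  using someI_ex[OF generic_bij[OF assms]] unfolding relabel_def by blast+

lemma rstr_orbit: "rstr \<omega> \<in> orbit L M"
proof (cases "generic \<omega>")
  case True
  then show ?thesis
    using relabel(1) unfolding rstr_def by (simp add: act_in_orbit[OF L M] bij_imp_bij_inv)
next
  case False
  then show ?thesis using act_in_orbit[OF L M, of id] M by (simp add: rstr_def act_id)
qed

lemma rstr_cyl:
  assumes gen: "generic \<omega>" and A: "inv_set (Aut L M) A"
  shows "rstr \<omega> \<in> cyl L M A b \<longleftrightarrow> (\<exists>n. realized A b \<omega> n)"
proof -
  obtain n where n: "sep n \<omega> (set b)" "sim (Aut L M) (map (lb n \<omega>) b) (map (relabel \<omega>) b)"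
    using relabel(2)[OF gen] by blast
  have "rstr \<omega> \<in> cyl L M A b \<longleftrightarrow> map (relabel \<omega>) b \<in> A"
    using gen relabel(1)[OF gen] act_in_cyl[OF L M bij_imp_bij_inv A, of "relabel \<omega>" b]
    by (simp add: rstr_def inv_inv_eq)
  also have "\<dots> \<longleftrightarrow> map (lb n \<omega>) b \<in> A" using inv_set_iff[OF A n(2)] by simp
  also have "\<dots> \<longleftrightarrow> (\<exists>n. realized A b \<omega> n)"
    using realized_iff[OF _ A n(1)] gen unfolding generic_def by simp
  finally show ?thesis .
qed

lemma generic_tset: "generic \<omega> \<Longrightarrow> \<omega> \<in> tset A b \<longleftrightarrow> (\<exists>n. realized A b \<omega> n)"
  by (simp add: tset_def generic_def space_P)

lemma rstr_cyl_sets: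
  assumes A: "inv_set (Aut L M) A" and b: "distinct b"
  shows "rstr -` cyl L M A b \<inter> space P \<in> sets P"
proof -
  have "rstr -` cyl L M A b \<inter> space P = ({\<omega> \<in> space P. generic \<omega>} \<inter> tset A b) \<union>
     ((space P - {\<omega> \<in> space P. generic \<omega>}) \<inter> (if M \<in> cyl L M A b then space P else {}))"
  proof (intro set_eqI)
    fix \<omega>
    show "\<omega> \<in> rstr -` cyl L M A b \<inter> space P \<longleftrightarrow> \<omega> \<in> ({\<omega> \<in> space P. generic \<omega>} \<inter> tset A b) \<union>
     ((space P - {\<omega> \<in> space P. generic \<omega>}) \<inter> (if M \<in> cyl L M A b then space P else {}))"
    proof (cases "generic \<omega>")
      case True
      then have "rstr \<omega> \<in> cyl L M A b \<longleftrightarrow> \<omega> \<in> tset A b"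
        by (simp only: rstr_cyl[OF True A] generic_tset)
      then show ?thesis using True by (simp add: generic_def space_P)
    next
      case False
      then have "rstr \<omega> = M" by (simp add: rstr_def)
      then show ?thesis using False by simp
    qed
  qed
  also have "\<dots> \<in> sets P" using generic_sets tset_sets[OF b] by auto
  finally show ?thesis .
qed

text \<open>All values lie in the orbit, where Borel sets are generated by type cylinders, so
  preimages of these suffice.\<close>

lemma rstr_measurable: "rstr \<in> measurable P (Str_borel L)"
proof -
  have "rstr \<in> measurable P (sigma (orbit L M) (cyl_base L M))"
  proof (rule measurable_measure_of[OF cyl_base_subset[OF L M]])
    show "rstr \<in> space P \<rightarrow> orbit L M" using rstr_orbit by blast
    fix X assume "X \<in> cyl_base L M"
    then show "rstr -` X \<inter> space P \<in> sets P"
      unfolding cyl_base_def[OF L M] using rstr_cyl_sets[OF inv_set_sim] by auto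
  qed
  then have 1: "rstr -` X \<inter> space P \<in> sets P" if "X \<in> sigma_sets (orbit L M) (cyl_base L M)" for X
    using that cyl_base_subset[OF L M] by (simp add: measurable_sets)
  show ?thesis
  proof (rule measurableI)
    show "rstr \<omega> \<in> space (Str_borel L)" for \<omega>
      using subsetD[OF orbit_subset_Str[OF L M] rstr_orbit] by (simp add: space_Str_borel)
    fix B assume "B \<in> sets (Str_borel L)"
    moreover have "rstr -` B \<inter> space P = rstr -` (B \<inter> orbit L M) \<inter> space P" using rstr_orbit by auto
    ultimately show "rstr -` B \<inter> space P \<in> sets P" using 1[OF borel_trace[OF L M]] by metis
  qed
qed

lemma prob_space_law: "prob_space law"
  unfolding law_def by (rule P.prob_space_distr[OF rstr_measurable])

lemma sets_law: "sets law = sets (Str_borel L)"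
  by (simp add: law_def)

lemma law_eq:
  assumes "X \<in> sets (Str_borel L)" "Y \<in> sets P" "\<And>\<omega>. generic \<omega> \<Longrightarrow> rstr \<omega> \<in> X \<longleftrightarrow> \<omega> \<in> Y"
  shows "emeasure law X = emeasure P Y"
proof -
  have "emeasure law X = emeasure P (rstr -` X \<inter> space P)"
    unfolding law_def by (rule emeasure_distr[OF rstr_measurable assms(1)])
  also have "\<dots> = emeasure P Y"
  proof (rule emeasure_eq_AE)
    show "AE \<omega> in P. \<omega> \<in> rstr -` X \<inter> space P \<longleftrightarrow> \<omega> \<in> Y"
      using AE_generic AE_space by eventually_elim (use assms(3) in auto)
  qed (use assms rstr_measurable in auto)
  finally show ?thesis .
qed

lemma law_cyl:
  assumes "inv_set (Aut L M) A" "distinct b"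
  shows "emeasure law (cyl L M A b) = P.prob (tset A b)"
  using law_eq[OF cyl_sets[OF L M assms(1)] tset_sets[OF assms(2)]] rstr_cyl[OF _ assms(1)]
    generic_tset
  by (simp add: P.emeasure_eq_measure)

lemma law_orbit: "emeasure law (orbit L M) = 1"
  using law_eq[OF orbit_measurable[OF L M] sets.top] rstr_orbit P.emeasure_space_1
  by (simp add: generic_def space_P)

lemma law_invariant: "invariant L law"
proof (rule invariantI[OF L M prob_space_law sets_law law_orbit])
  fix g :: "nat \<Rightarrow> nat" and a :: "nat list" assume "bij g"
  then have d: "distinct (map g [0..<length a])"
    by (simp add: distinct_map inj_on_subset[OF bij_is_inj])
  show "emeasure law (cyl L M (cls (Aut L M) a) (map g [0..<length a])) =
      emeasure law (type_cyl L M a)"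
    using tset_exchangeable[OF inv_set_sim d, of "[0..<length a]"]
    by (simp add: law_cyl inv_set_sim d)
qed

lemma law_in: "law \<in> invariant_measures_on_orbit L M"
  unfolding invariant_measures_on_orbit_def borel_prob_def concentrated_on_def
  using prob_space_law sets_law law_invariant law_orbit orbit_measurable[OF L M] by simp

lemma law_ergodic: "ergodic L law"
proof (rule ergodicI[OF L M prob_space_law sets_law law_orbit law_invariant])
  fix A :: "nat list set" and k assume A: "inv_set (Aut L M) A"
  let ?b = "[0..<k]" and ?b' = "[k..<2 * k]"
  have d: "distinct (?b @ ?b')" "distinct ?b" "distinct ?b'" by auto
  have "emeasure law (cyl L M A ?b \<inter> cyl L M A ?b') = emeasure P (tset A ?b \<inter> tset A ?b')"
    by (rule law_eq) (use cyl_sets[OF L M A] tset_sets d rstr_cyl[OF _ A] generic_tset in auto)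
  then have "measure law (cyl L M A ?b \<inter> cyl L M A ?b') = P.prob (tset A ?b \<inter> tset A ?b')"
    by (simp add: measure_def)
  also have "\<dots> = P.prob (tset A ?b) * P.prob (tset A ?b')" by (rule tset_indep[OF A A d(1)])
  also have "P.prob (tset A ?b') = P.prob (tset A ?b)" by (rule tset_exchangeable[OF A]) auto
  also have "P.prob (tset A ?b) = measure law (cyl L M A ?b)"
    using law_cyl[OF A d(2)] by (simp add: measure_def)
  finally show "measure law (cyl L M A ?b \<inter> cyl L M A ?b') = (measure law (cyl L M A ?b))\<^sup>2"
    by (simp add: power2_eq_square)
qed

end

section \<open>Homogeneous forms on the open simplex, with one coefficient for each word in the
  variables\<close>

definition wsum :: "'v set \<Rightarrow> nat \<Rightarrow> ('v list \<Rightarrow> real) \<Rightarrow> ('v \<Rightarrow> real) \<Rightarrow> real" where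
  "wsum V k q p = (\<Sum>u\<in>tuples V k. prod_list (map p u) * q u)"

lemma tendsto_prod_list:
  fixes f :: "'a \<Rightarrow> 'v \<Rightarrow> real"
  assumes "\<And>v. v \<in> set u \<Longrightarrow> ((\<lambda>x. f x v) \<longlongrightarrow> l v) F"
  shows "((\<lambda>x. prod_list (map (f x) u)) \<longlongrightarrow> prod_list (map l u)) F"
  using assms by (induction u) (auto intro!: tendsto_mult)

lemma tendsto_wsum:
  assumes "\<And>v. v \<in> V \<Longrightarrow> ((\<lambda>x. f x v) \<longlongrightarrow> l v) F"
  shows "((\<lambda>x. wsum V k q (f x)) \<longlongrightarrow> wsum V k q l) F"
  unfolding wsum_def
  by (intro tendsto_sum tendsto_mult tendsto_const tendsto_prod_list assms) (auto simp: tuples_def)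

lemma prod_list_const: "prod_list (map (\<lambda>_. c :: real) u) = c ^ length u"
  by (induction u) auto

definition exact :: "nat \<Rightarrow> ('v list \<Rightarrow> real) \<Rightarrow> 'v set \<Rightarrow> real" where
  "exact k q T = (\<Sum>u\<in>{u. set u = T \<and> length u = k}. q u)"

definition pos_weights :: "'v set \<Rightarrow> ('v \<Rightarrow> real) set" where
  "pos_weights V = {p. (\<forall>v\<in>V. 0 < p v) \<and> (\<Sum>v\<in>V. p v) = 1}"

text \<open>A homogeneous form that is constant on the open simplex is constant on the closed one, in
  particular at the centres of the faces; inclusion-exclusion then recovers its coefficients.\<close>

lemma wsum_const_imp_exact_eq:
  assumes V: "finite V" and const: "\<And>p. p \<in> pos_weights V \<Longrightarrow> wsum V k q p = c"
    and "T \<subseteq> V" "T' \<subseteq> V" "card T = card T'"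
  shows "exact k q T = exact k q T'"
proof -
  \<comment> \<open>At the centre of the face, monomials on \<open>T\<close> have the value
    \<open>(1 / ?r) ^ k\<close> and all others vanish, so the form is a multiple of the plain sum of
    its coefficients on \<open>T\<close>.\<close>
  have face: "(\<Sum>u\<in>tuples T k. q u) = real (card T) ^ k * c" if T: "T \<subseteq> V" "T \<noteq> {}" for T
  proof -
    let ?r = "real (card T)" and ?s = "real (card V)"
    have fin: "finite T" using T V finite_subset by blast
    then have r: "?r > 0" and s: "?s > 0" using T V card_gt_0_iff by fastforce+
    define e where "e v = (if v \<in> T then 1 / ?r else 0)" for v
    have sum_e: "(\<Sum>v\<in>V. e v) = 1"
      using T V fin r unfolding e_def by (simp add: sum.If_cases Int_absorb1)
    \<comment> \<open>Mixing in the uniform distribution makes the weights positive outside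
      \<open>T\<close> too; its share tends to 0.\<close>
    define p where "p n v = (1 - 1 / real (n + 2)) * e v + 1 / real (n + 2) / ?s" for n :: nat and v
    have "p n \<in> pos_weights V" for n
      unfolding pos_weights_def
    proof (intro CollectI conjI ballI)
      show "0 < p n v" for v
        unfolding p_def e_def using r s by (intro add_nonneg_pos mult_nonneg_nonneg) auto
      have "(\<Sum>v\<in>V. p n v) = (1 - 1 / real (n + 2)) * (\<Sum>v\<in>V. e v) + ?s * (1 / real (n + 2) / ?s)"
        unfolding p_def sum.distrib sum_distrib_left by simp
      then show "(\<Sum>v\<in>V. p n v) = 1" using s by (simp add: sum_e)
    qed
    then have "wsum V k q (p n) = c" for n by (rule const)
    moreover have "(\<lambda>n. wsum V k q (p n)) \<longlonglongrightarrow> wsum V k q e"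
    proof (rule tendsto_wsum)
      fix v
      have "(\<lambda>n. 1 / real (n + 2)) \<longlonglongrightarrow> 0" using LIMSEQ_ignore_initial_segment[OF lim_1_over_n, of 2]
        by simp
      then have "(\<lambda>n. (1 - 1 / real (n + 2)) * e v + 1 / real (n + 2) / ?s) \<longlonglongrightarrow> (1 - 0) * e v + 0 /
        ?s"
        using s by (intro tendsto_intros) auto
      then show "(\<lambda>n. p n v) \<longlonglongrightarrow> e v" by (simp add: p_def)
    qed
    ultimately have "wsum V k q e = c" by (simp add: LIMSEQ_const_iff)
    moreover have "wsum V k q e = (\<Sum>u\<in>tuples T k. (1 / ?r) ^ k * q u)"
    proof -
      have "wsum V k q e = (\<Sum>u\<in>tuples T k. prod_list (map e u) * q u)"
        unfolding wsum_def
      proof (rule sum.mono_neutral_right)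
        show "finite (tuples V k)" using V by (rule finite_tuples)
        show "tuples T k \<subseteq> tuples V k" using T by (auto simp: tuples_def)
        show "\<forall>u\<in>tuples V k - tuples T k. prod_list (map e u) * q u = 0"
          by (auto simp: tuples_def e_def prod_list_zero_iff)
      qed
      also have "\<dots> = (\<Sum>u\<in>tuples T k. (1 / ?r) ^ k * q u)"
      proof (intro sum.cong refl)
        fix u assume u: "u \<in> tuples T k"
        then have "map e u = map (\<lambda>_. 1 / ?r) u" by (auto simp: tuples_def e_def)
        then have "prod_list (map e u) = (1 / ?r) ^ k"
          using u by (simp only: prod_list_const) (simp add: tuples_def)
        then show "prod_list (map e u) * q u = (1 / ?r) ^ k * q u" by simp
      qed
      finally show ?thesis .
    qed
    ultimately have "(1 / ?r) ^ k * (\<Sum>u\<in>tuples T k. q u) = c" by (simp add: sum_distrib_left)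
    then show ?thesis using r by (simp add: field_simps)
  qed
  show ?thesis
    using assms(3-5)
  proof (induction "card T" arbitrary: T T' rule: less_induct)
    case less
    have fin: "finite T" "finite T'" using less.prems V finite_subset by blast+
    show ?case
    proof (cases "T = {}")
      case True
      then show ?thesis using less.prems fin by simp
    next
      case False
      then have ne: "T' \<noteq> {}" using less.prems fin by force
      \<comment> \<open>The bijection pairs the proper subsets of \<open>T\<close> with those of
        \<open>T'\<close> by size. Their contributions agree by induction and the face sums agree,
        which leaves the two top terms equal.\<close>
      obtain f where f: "bij_betw f T T'" using finite_same_card_bij[OF fin less.prems(3)] by blast
      have group: "(\<Sum>u\<in>tuples T k. q u) = exact k q T + (\<Sum>X\<in>Pow T - {T}. exact k q X)" if "finite T"
        for T
      proof -
        have "(\<Sum>u\<in>tuples T k. q u) = (\<Sum>X\<in>Pow T. \<Sum>u\<in>{u \<in> tuples T k. set u = X}. q u)"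
          by (rule sum.group[symmetric]) (use that finite_tuples in \<open>auto simp: tuples_def\<close>)
        also have "\<dots> = (\<Sum>X\<in>Pow T. exact k q X)"
          unfolding exact_def by (intro sum.cong refl) (auto simp: tuples_def)
        also have "\<dots> = exact k q T + (\<Sum>X\<in>Pow T - {T}. exact k q X)"
          using that by (intro sum.remove) auto
        finally show ?thesis .
      qed
      have "bij_betw ((`) f) (Pow T - {T}) (Pow T' - {T'})"
      proof -
        have "bij_betw ((`) f) (Pow T) (Pow T')" using f by (rule bij_betw_Pow)
        then have "bij_betw ((`) f) (Pow T - {T}) ((`) f ` Pow T - (`) f ` {T})"
          by (metis bij_betw_DiffI bij_betw_imp_surj_on bij_betw_subset empty_subsetI insert_subset
            Pow_top image_mono order_refl)
        then show ?thesis
          using f bij_betw_imp_surj_on[OF f] bij_betw_imp_surj_on[OF bij_betw_Pow[OF f]] by simp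
      qed
      then have "(\<Sum>X\<in>Pow T' - {T'}. exact k q X) = (\<Sum>X\<in>Pow T - {T}. exact k q (f ` X))"
        by (rule sum.reindex_bij_betw[symmetric])
      also have "\<dots> = (\<Sum>X\<in>Pow T - {T}. exact k q X)"
      proof (intro sum.cong refl)
        fix X assume X: "X \<in> Pow T - {T}"
        then have "card X < card T" using fin by (intro psubset_card_mono) auto
        moreover have "card X = card (f ` X)"
          using f X card_image[of f X] inj_on_subset[of f T X] by (auto simp: bij_betw_def)
        moreover have "f ` X \<subseteq> V" "X \<subseteq> V" using f X less.prems by (auto simp: bij_betw_def)
        ultimately show "exact k q (f ` X) = exact k q X" using less.hyps by metis
      qed
      finally show ?thesis
        using group[OF fin(1)] group[OF fin(2)] face[OF less.prems(1) False] face[OF less.prems(2)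
          ne] less.prems(3) by simp
    qed
  qed
qed

text \<open>The open simplex is convex, so the intermediate value theorem applies along the segment
  from \<open>p\<close> to \<open>p'\<close>.\<close>

lemma wsum_interval:
  assumes p: "p \<in> pos_weights V" "p' \<in> pos_weights V" and less: "wsum V k q p < wsum V k q p'"
    and y: "wsum V k q p \<le> y" "y \<le> wsum V k q p'"
  shows "\<exists>r\<in>pos_weights V. wsum V k q r = y"
proof -
  define r where "r t v = (1 - t) * p v + t * p' v" for t :: real and v
  have "continuous_on {0..1} (\<lambda>t. wsum V k q (r t))"
    unfolding continuous_on_def r_def by (intro ballI tendsto_wsum tendsto_intros)
  moreover have "r 0 = p" "r 1 = p'" by (auto simp: r_def)
  ultimately obtain t where t: "0 \<le> t" "t \<le> 1" "wsum V k q (r t) = y"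
    using IVT'[of "\<lambda>t. wsum V k q (r t)" 0 y 1] y by auto
  have "r t \<in> pos_weights V"
    unfolding pos_weights_def
  proof (intro CollectI conjI ballI)
    fix v assume "v \<in> V"
    then have pv: "0 < p v" "0 < p' v" using p unfolding pos_weights_def by auto
    show "0 < r t v"
    proof (cases "t = 0")
      case False
      then show ?thesis
        unfolding r_def using t pv by (intro add_nonneg_pos mult_nonneg_nonneg mult_pos_pos) auto
    qed (simp add: r_def pv)
  next
    show "(\<Sum>v\<in>V. r t v) = 1"
      using p unfolding r_def pos_weights_def by (simp add: sum.distrib flip: sum_distrib_left)
  qed
  then show ?thesis using t by blast
qed

section \<open>Conditioning on the initial cells\<close>

context sampler
begin

lemma prob_space_PU: "prob_space PU"
  unfolding PU_def by (rule prob_space_PiM) (rule prob_space_U)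

lemma space_PU': "Y \<in> space PU \<longleftrightarrow> (\<forall>i. 0 \<le> Y i \<and> Y i < 1)"
  by (auto simp: PU_def U_def space_PiM space_restrict_space PiE_iff)

text \<open>The padding value \<open>None\<close> is an initial cell, so a padded sample is still
  \<open>ok\<close>; the points beyond \<open>u\<close> do not affect the event.\<close>

definition pad :: "nat option list \<Rightarrow> nat \<Rightarrow> nat option" where
  "pad u i = (if i < length u then u ! i else None)"

text \<open>The conditional probability given the initial cells \<open>u\<close> of the first points; it does not
  depend on the weights.\<close>

definition cond_prob :: "nat list set \<Rightarrow> nat option list \<Rightarrow> real" where
  "cond_prob A u = measure PU {Y \<in> space PU. \<exists>n. realized A [0..<length u] (pad u, Y) n}"

lemma pad_ok:
  assumes "set u \<subseteq> born 0" "Y \<in> space PU"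
  shows "ok (pad u, Y)"
  using assms None_born unfolding ok_def pad_def by (auto simp: space_PU' subset_iff)

lemma pad_sep:
  assumes "distinct u" "None \<notin> set u"
  shows "sep 0 (pad u, Y) (set [0..<length u])"
proof -
  have "cl 0 (pad u, Y) i = u ! i" if "i < length u" for i using that by (simp add: cl_def pad_def)
  moreover have "u ! i \<noteq> None" if "i < length u" for i using assms(2) nth_mem[OF that] by metis
  ultimately show ?thesis
    unfolding sep_def inj_on_def using assms(1) by (simp add: nth_eq_iff_index_eq del: not_None_eq)
qed

lemma pad_lb: "map (lb 0 (pad u, Y)) [0..<length u] = map (\<lambda>c. lab (the c)) u"
  by (rule nth_equalityI) (auto simp: lb_def cl_def pad_def)

text \<open>Distinct labelled initial cells separate the points at level 0 already, so their type is
  settled whatever the positions are.\<close>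

lemma cond_prob_eq:
  assumes A: "inv_set G A" and u: "set u \<subseteq> born 0" "distinct u" "None \<notin> set u"
  shows "cond_prob A u = (if map (\<lambda>c. lab (the c)) u \<in> A then 1 else 0)"
proof -
  interpret prob_space PU by (rule prob_space_PU)
  have "(\<exists>n. realized A [0..<length u] (pad u, Y) n) \<longleftrightarrow> map (\<lambda>c. lab (the c)) u \<in> A" if
    "Y \<in> space PU" for Y
    using realized_iff[OF pad_ok[OF u(1) that] A pad_sep[OF u(2,3)]] unfolding pad_lb .
  then have "{Y \<in> space PU. \<exists>n. realized A [0..<length u] (pad u, Y) n} =
      (if map (\<lambda>c. lab (the c)) u \<in> A then space PU else {})" by auto
  then show ?thesis unfolding cond_prob_def by (simp add: prob_space)
qed

lemma realized_cong:
  assumes "\<And>i. i \<in> set b \<Longrightarrow> fst \<omega> i = fst \<omega>' i \<and> snd \<omega> i = snd \<omega>' i"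
  shows "realized A b \<omega> n \<longleftrightarrow> realized A b \<omega>' n"
proof -
  have cl: "cl n \<omega> i = cl n \<omega>' i" if "i \<in> set b" for i using assms[OF that] by (simp add: cl_def)
  then have "sep n \<omega> (set b) \<longleftrightarrow> sep n \<omega>' (set b)" unfolding sep_def inj_on_def by auto
  moreover have "map (lb n \<omega>) b = map (lb n \<omega>') b" using cl by (simp add: lb_def)
  ultimately show ?thesis unfolding realized_def by (simp only:)
qed

text \<open>Witnesses are added one element at a time, starting from the empty tuple. This supplies
  initial nodes that represent prescribed finite subsets of \<open>M\<close>.\<close>

lemma tower_realizes: "distinct d \<Longrightarrow> \<exists>c. sim G d (map lab c)"
proof (induction d rule: rev_induct)
  case Nil
  then show ?case using sim_refl by (intro exI[of _ "[]"]) simp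
next
  case (snoc b d)
  then obtain c where c: "sim G d (map lab c)" by auto
  have "b \<notin> set d" using snoc by simp
  then obtain n where n: "n \<ge> Suc (Max (set c))" "\<And>c. set c \<subseteq> {..<n} \<Longrightarrow> sim G d (map lab c) \<Longrightarrow>
        \<exists>m\<ge>n. (\<forall>j. n \<le> j \<and> j \<le> m \<longrightarrow> par j = None) \<and> sim G (d @ [b]) (map lab c @ [lab m])"
    using tower_ext by metis
  have "set c \<subseteq> {..<n}"
  proof
    fix x assume "x \<in> set c"
    then have "x \<le> Max (set c)" by simp
    then show "x \<in> {..<n}" using n(1) by simp
  qed
  then obtain m where "sim G (d @ [b]) (map lab c @ [lab m])" using n(2) c by blast
  then show ?case by (intro exI[of _ "c @ [m]"]) simp
qed

end

context sampler_pmf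
begin

text \<open>Roots and positions are independent. Splitting by the roots of the first
  \<open>k\<close> points gives rectangles: the root factor is a monomial in the weights, and the
  position factor is free of them.\<close>

lemma prob_tset:
  assumes A: "inv_set G A"
  shows "P.prob (tset A [0..<k]) = wsum (born 0) k (cond_prob A) (pmf w)"
proof -
  interpret PWs: prob_space PW unfolding PW_def by (rule prob_space_PiM) (rule prob_space_W)
  interpret PUs: prob_space PU by (rule prob_space_PU)
  let ?b = "[0..<k]"
  define R where "R u = {\<omega> \<in> space P. \<forall>i<k. fst \<omega> i = u ! i}" for u
  define Ys where "Ys u = {Y \<in> space PU. \<exists>n. realized A [0..<length u] (pad u, Y) n}" for u
  have b: "distinct ?b" by simp
  have pad: "pad u \<in> space PW" if "u \<in> tuples (born 0) k" for u
    using that None_born by (auto simp: space_PW pad_def tuples_def subset_iff)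
  have Ys: "Ys u \<in> sets PU" if u: "u \<in> tuples (born 0) k" for u
  proof -
    have "Pair (pad u) -` tset A ?b \<in> sets PU"
      using tset_sets[OF b, of A] unfolding P_def by (rule sets_Pair1)
    moreover have "Pair (pad u) -` tset A ?b = Ys u"
      using u pad[OF u] by (auto simp: tset_def Ys_def P_def space_pair_measure tuples_def)
    ultimately show ?thesis by simp
  qed
  have box: "tset A ?b \<inter> R u = root_box {..<k} ((!) u) \<times> Ys u" if u: "u \<in> tuples (born 0) k" for u
  proof -
    have ub: "u ! i \<in> born 0" if "i < k" for i using u that by (auto simp: tuples_def)
    have re: "realized A ?b (J, Y) n \<longleftrightarrow> realized A ?b (pad u, Y) n" if "\<forall>i<k. J i = u ! i" for J Y n
      by (rule realized_cong) (use that u in \<open>auto simp: pad_def tuples_def\<close>)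
    show ?thesis
      using ub re u
      by (auto simp: tset_def R_def root_box_def Ys_def P_def space_pair_measure tuples_def)
  qed
  have sets: "tset A ?b \<inter> R u \<in> sets P" if "u \<in> tuples (born 0) k" for u
    unfolding box[OF that] P_def using root_box(1) Ys[OF that] by (intro pair_measureI) auto
  have meas: "P.prob (tset A ?b \<inter> R u) = prod_list (map (pmf w) u) * cond_prob A u" if u:
    "u \<in> tuples (born 0) k" for u
  proof -
    have "emeasure P (tset A ?b \<inter> R u) = emeasure PW (root_box {..<k} ((!) u)) * emeasure PU (Ys u)"
      unfolding box[OF u] unfolding P_def using root_box(1) Ys[OF u]
      by (intro PUs.emeasure_pair_measure_Times) auto
    also have "\<dots> = ennreal (\<Prod>i<k. pmf w (u ! i)) * ennreal (cond_prob A u)"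
      by (simp add: root_box(2) PUs.emeasure_eq_measure cond_prob_def Ys_def)
    also have "(\<Prod>i<k. pmf w (u ! i)) = prod_list (map (pmf w) u)"
      using u by (simp add: prod.list_conv_set_nth tuples_def atLeast0LessThan)
    finally have e: "emeasure P (tset A ?b \<inter> R u) = ennreal (prod_list (map (pmf w) u)) * ennreal
      (cond_prob A u)" .
    have nn: "0 \<le> prod_list (map (pmf w) u)" "0 \<le> cond_prob A u"
      by (intro prod_list_nonneg) (auto simp: cond_prob_def)
    have "emeasure P (tset A ?b \<inter> R u) = ennreal (prod_list (map (pmf w) u) * cond_prob A u)"
      unfolding e by (rule ennreal_mult[OF nn, symmetric])
    moreover have "0 \<le> prod_list (map (pmf w) u) * cond_prob A u"
      using nn by simp
    ultimately show ?thesis by (simp add: measure_def)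
  qed
  have "tset A ?b = (\<Union>u\<in>tuples (born 0) k. tset A ?b \<inter> R u)"
  proof (intro equalityI subsetI)
    fix \<omega> assume \<omega>: "\<omega> \<in> tset A ?b"
    then have "ok \<omega>" by (simp add: tset_def space_P)
    then have "map (fst \<omega>) [0..<k] \<in> tuples (born 0) k" by (auto simp: tuples_def ok_def)
    moreover have "\<omega> \<in> R (map (fst \<omega>) [0..<k])" using \<omega> by (simp add: R_def tset_def)
    ultimately show "\<omega> \<in> (\<Union>u\<in>tuples (born 0) k. tset A ?b \<inter> R u)" using \<omega> by blast
  qed auto
  then have "P.prob (tset A ?b) = P.prob (\<Union>u\<in>tuples (born 0) k. tset A ?b \<inter> R u)" by simp
  also have "\<dots> = (\<Sum>u\<in>tuples (born 0) k. P.prob (tset A ?b \<inter> R u))"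
  proof (rule P.finite_measure_finite_Union)
    show "finite (tuples (born 0) k)" by (rule finite_tuples[OF finite_born])
    show "disjoint_family_on (\<lambda>u. tset A ?b \<inter> R u) (tuples (born 0) k)"
      unfolding disjoint_family_on_def
    proof (intro ballI impI)
      fix u u' assume "u \<in> tuples (born 0) k" "u' \<in> tuples (born 0) k" "u \<noteq> u'"
      then have "\<exists>i<k. u ! i \<noteq> u' ! i" by (auto simp: tuples_def list_eq_iff_nth_eq)
      then show "(tset A ?b \<inter> R u) \<inter> (tset A ?b \<inter> R u') = {}" unfolding R_def by auto
    qed
  qed (use sets in auto)
  also have "\<dots> = wsum (born 0) k (cond_prob A) (pmf w)"
    unfolding wsum_def by (intro sum.cong refl meas)
  finally show ?thesis .
qed

end

section \<open>Continuum many ergodic measures\<close>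

lemma pmf_of_weights:
  assumes V: "finite V" and p: "p \<in> pos_weights V"
  obtains w where "set_pmf w = V" "\<And>v. v \<in> V \<Longrightarrow> pmf w v = p v"
proof -
  define f where "f v = (if v \<in> V then p v else 0)" for v
  have nn: "0 \<le> f v" for v using p by (auto simp: f_def pos_weights_def less_imp_le)
  have "(\<integral>\<^sup>+ v. ennreal (f v) \<partial>count_space UNIV) = (\<Sum>v\<in>V. ennreal (f v))"
    using V by (intro nn_integral_count_space') (auto simp: f_def split: if_splits)
  also have "\<dots> = ennreal (\<Sum>v\<in>V. f v)" using nn by (simp add: sum_ennreal)
  also have "(\<Sum>v\<in>V. f v) = 1" using p by (simp add: f_def pos_weights_def)
  finally have 1: "(\<integral>\<^sup>+ v. ennreal (f v) \<partial>count_space UNIV) = 1" by simp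
  have pmf: "pmf (embed_pmf f) v = f v" for v by (rule pmf_embed_pmf[OF nn 1])
  have "f v \<noteq> 0 \<longleftrightarrow> v \<in> V" for v using p by (auto simp: f_def pos_weights_def)
  then have "set_pmf (embed_pmf f) = V" by (intro set_eqI) (simp only: set_pmf_iff pmf)
  then show thesis using that[of "embed_pmf f"] by (simp add: pmf f_def)
qed

lemma wsum_cong: "(\<And>v. v \<in> V \<Longrightarrow> p v = p' v) \<Longrightarrow> wsum V k q p = wsum V k q p'"
  unfolding wsum_def
  by (intro sum.cong refl arg_cong2[where f = times] arg_cong[where f =
    prod_list]) (auto simp: tuples_def)

context
  fixes L :: "('r, 'f) language" and M :: "('r, 'f) struct"
  assumes L: "countable_language L" and M: "M \<in> Str L" and dcl: "trivial_dcl L M"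
begin

interpretation perm_group "Aut L M" using M by (rule perm_group_Aut)

lemma trivial_perm_group_Aut: "trivial_perm_group (Aut L M)"
  by unfold_locales (use dcl in \<open>simp add: trivial_dcl_iff\<close>)

interpretation trivial_perm_group "Aut L M" by (rule trivial_perm_group_Aut)

lemma str_samplerI:
  assumes "tower lab par" "set_pmf w = insert None (Some ` {..<n1})"
  shows "str_sampler L M lab par n1 w"
proof -
  interpret S: sampler "Aut L M" lab par n1 by unfold_locales (rule assms)
  show ?thesis by unfold_locales (use assms L M in \<open>auto simp: S.born_def\<close>)
qed

lemma ergodic_measure_exists: "\<exists>\<mu>. \<mu> \<in> invariant_measures_on_orbit L M \<and> ergodic L \<mu>"
proof -
  obtain lab par where "tower lab par" using tower_exists by blast
  \<comment> \<open>All points start unlabelled, so \<open>None\<close> is the only initial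
    cell.\<close>
  then interpret str_sampler L M lab par 0 "return_pmf None" by (rule str_samplerI) simp
  show ?thesis using law_in law_ergodic by blast
qed

text \<open>Take finite sets \<open>X\<close> and \<open>Y\<close> of equal size with no
  automorphism carrying \<open>X\<close> to \<open>Y\<close>. With copies of both among the initial
  nodes, the probability that the first \<open>k\<close> points form a set equivalent to
  \<open>X\<close> is a form whose coefficients tell the two copies apart. Hence it is not constant
  in the weights.\<close>

lemma continuum_many:
  assumes nh: "\<not> highly_homogeneous L M"
  shows "continuum_many_ergodic_measures_on_orbit L M"
proof -
  obtain X Y :: "nat set" where XY: "finite X" "finite Y" "card X = card Y" "\<And>f. f \<in> Aut L M \<Longrightarrow>
    f ` X \<noteq> Y"
    using nh unfolding highly_homogeneous_iff high_hom_def by blast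
  define k where "k = card X"
  define A where "A = {d. distinct d \<and> length d = k \<and> (\<exists>g\<in>Aut L M. g ` set d = X)}"
  have A: "inv_set (Aut L M) A"
    unfolding inv_set_def
  proof (intro ballI)
    fix g d assume g: "g \<in> Aut L M" and d: "d \<in> A"
    then obtain h where h: "h \<in> Aut L M" "h ` set d = X" unfolding A_def by blast
    have bg: "bij g" by (rule G_bij[OF g])
    have "(h \<circ> inv g) ` set (map g d) = X" using h bg by (simp add: image_image bij_is_inj)
    moreover have "h \<circ> inv g \<in> Aut L M" using g h by (simp add: G_comp G_inv)
    moreover have "distinct (map g d)"
      using d bg by (simp add: A_def distinct_map inj_on_subset[OF bij_is_inj[OF bg]])
    moreover have "length (map g d) = k" using d by (simp add: A_def)
    ultimately show "map g d \<in> A" unfolding A_def by blast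
  qed
  obtain lab par where tw: "tower lab par" using tower_exists by blast
  obtain x y where x: "set x = X" "distinct x" and y: "set y = Y" "distinct y"
    using XY finite_distinct_list by metis
  obtain cx cy where cx: "sim (Aut L M) x (map lab cx)" and cy: "sim (Aut L M) y (map lab cy)"
  proof -
    \<comment> \<open>The number \<open>n1\<close> is fixed only afterwards; which nodes realise a
      type depends on the tower alone, so 0 serves here.\<close>
    interpret S: sampler "Aut L M" lab par 0 by unfold_locales (rule tw)
    show thesis using S.tower_realizes[OF x(2)] S.tower_realizes[OF y(2)] that by blast
  qed
  \<comment> \<open>Large enough for all nodes of \<open>cx\<close> and \<open>cy\<close> to be
    initial; the inserted 0 covers empty tuples.\<close>
  define n1 where "n1 = Suc (Max (insert 0 (set cx \<union> set cy)))"
  have n1: "set cx \<subseteq> {..<n1}" "set cy \<subseteq> {..<n1}"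
    unfolding n1_def by (auto simp: less_Suc_eq_le)
  interpret S: sampler "Aut L M" lab par n1 by unfold_locales (rule tw)
  let ?V = "S.born 0"
  have V: "finite ?V" by (rule S.finite_born)
  let ?q = "S.cond_prob A"
  let ?F = "wsum ?V k ?q"
  have dcx: "distinct (map lab cx)" "length cx = k"
    using sim_distinct[OF cx] sim_length[OF cx] x by (auto simp: k_def distinct_card)
  have dcy: "distinct (map lab cy)" "length cy = k"
    using sim_distinct[OF cy] sim_length[OF cy] y XY by (auto simp: k_def distinct_card)
  have dx: "distinct cx" and dy: "distinct cy" using dcx dcy by (auto simp: distinct_map)
  let ?T = "Some ` set cx" and ?T' = "Some ` set cy"
  have TV: "?T \<subseteq> ?V" "?T' \<subseteq> ?V" using n1 by (auto simp: S.Some_born subset_iff)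
  have card: "card ?T = k" "card ?T' = k"
    using dx dy dcx dcy by (auto simp: card_image distinct_card)
  \<comment> \<open>A list of length \<open>k\<close> whose entries form a \<open>k\<close>-element
    set has no repetitions, so the initial cells decide the event and the conditional probability is
    0 or 1.\<close>
  have q_eq: "?q u = (if map (\<lambda>c. lab (the c)) u \<in> A then 1 else 0)"
    if "set u = Some ` C" "Some ` C \<subseteq> ?V" "card (Some ` C) = k" "length u = k" for u C
    by (rule S.cond_prob_eq[OF A]) (use that in \<open>auto intro: card_distinct\<close>)
  \<comment> \<open>The enumeration \<open>cx\<close> contributes 1 and no other one a negative
    amount. Enumerations of the nodes of \<open>cy\<close> contribute nothing, since no automorphism
    takes a copy of \<open>Y\<close> to \<open>X\<close>.\<close>
  have "1 \<le> exact k ?q ?T"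
  proof -
    let ?u = "map Some cx"
    have fin: "finite {u. set u = ?T \<and> length u = k}"
      by (rule finite_subset[OF _ finite_lists_length_eq[of ?T k]]) auto
    obtain g where g: "g \<in> Aut L M" "map g x = map lab cx" using cx unfolding sim_def by blast
    have "inv g ` set (map lab cx) = X"
      using x(1) G_bij[OF g(1)] by (simp add: g(2)[symmetric] image_image bij_is_inj del: map_map)
    then have "map lab cx \<in> A" unfolding A_def using dcx g(1) G_inv by auto
    then have "?q ?u = 1" using q_eq[of ?u "set cx"] TV card dcx by (simp add: comp_def)
    moreover have "?q ?u \<le> exact k ?q ?T"
      unfolding exact_def by (rule member_le_sum) (use fin dcx in \<open>auto simp: S.cond_prob_def\<close>)
    ultimately show ?thesis by simp
  qed
  moreover have "exact k ?q ?T' = 0"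
    unfolding exact_def
  proof (rule sum.neutral, intro ballI)
    fix u assume u: "u \<in> {u. set u = ?T' \<and> length u = k}"
    have "map (\<lambda>c. lab (the c)) u \<notin> A"
    proof
      assume "map (\<lambda>c. lab (the c)) u \<in> A"
      then obtain h where h: "h \<in> Aut L M" "h ` ((\<lambda>c. lab (the c)) ` set u) = X"
        unfolding A_def by auto
      obtain g where g: "g \<in> Aut L M" "map g y = map lab cy" using cy unfolding sim_def by blast
      have "(\<lambda>c. lab (the c)) ` set u = lab ` set cy" using u by (simp add: image_image)
      also have "\<dots> = g ` Y" using arg_cong[OF g(2), of set] y(1) by simp
      finally have hg: "(h \<circ> g) ` Y = X" using h(2) by (simp add: image_comp)
      have hgG: "h \<circ> g \<in> Aut L M" using h g by (simp add: G_comp)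
      have "inv (h \<circ> g) ` X = Y"
        unfolding hg[symmetric] using G_bij[OF hgG] by (metis bij_is_inj image_inv_f_f)
      then show False using XY(4) G_inv[OF hgG] by blast
    qed
    then show "?q u = 0" using q_eq[of u "set cy"] TV card u by simp
  qed
  ultimately have ne: "exact k ?q ?T \<noteq> exact k ?q ?T'" by simp
  have "\<exists>p\<in>pos_weights ?V. \<exists>p'\<in>pos_weights ?V. ?F p < ?F p'"
  proof (rule ccontr)
    assume no: "\<not> ?thesis"
    have Vne: "card ?V > 0" using V S.None_born card_gt_0_iff by blast
    define p0 where "p0 v = 1 / real (card ?V)" for v :: "nat option"
    have "p0 \<in> pos_weights ?V" using Vne by (simp add: pos_weights_def p0_def)
    then have "?F p = ?F p0" if "p \<in> pos_weights ?V" for p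
      using no that by (meson linorder_less_linear)
    then have "exact k ?q ?T = exact k ?q ?T'"
      by (rule wsum_const_imp_exact_eq[OF V _ TV]) (simp_all add: card)
    then show False using ne by simp
  qed
  then obtain p p' where p: "p \<in> pos_weights ?V" "p' \<in> pos_weights ?V" "?F p < ?F p'" by blast
  let ?E = "{\<mu> \<in> invariant_measures_on_orbit L M. ergodic L \<mu>}"
  \<comment> \<open>The probability of this one cylinder tells the laws apart, so an interval of
    reals embeds into the set of ergodic measures.\<close>
  have "\<exists>\<mu>\<in>?E. measure \<mu> (cyl L M A [0..<k]) = r" if r: "r \<in> {?F p..?F p'}" for r
  proof -
    obtain s where s: "s \<in> pos_weights ?V" "?F s = r" using wsum_interval[OF p] r by auto
    obtain w where w: "set_pmf w = ?V" "\<And>v. v \<in> ?V \<Longrightarrow> pmf w v = s v"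
      using pmf_of_weights[OF V s(1)] by blast
    interpret W: str_sampler L M lab par n1 w by (rule str_samplerI[OF tw]) (simp add: w S.born_def)
    have "measure W.law (cyl L M A [0..<k]) = W.P.prob (W.tset A [0..<k])"
      using W.law_cyl[OF A, of "[0..<k]"] by (simp add: measure_def[of W.law])
    also have "\<dots> = ?F (pmf w)" by (rule W.prob_tset[OF A])
    also have "\<dots> = r" using wsum_cong[of ?V "pmf w" s k ?q] w(2) s(2) by simp
    finally show ?thesis using W.law_in W.law_ergodic by blast
  qed
  then have "\<forall>r\<in>{?F p..?F p'}. \<exists>\<mu>. \<mu> \<in> ?E \<and> measure \<mu> (cyl L M A [0..<k]) = r" by blast
  from bchoice[OF this] obtain \<Lambda> where \<Lambda>: "\<And>r. r \<in> {?F p..?F p'} \<Longrightarrow> \<Lambda> r \<in> ?E"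
    "\<And>r. r \<in> {?F p..?F p'} \<Longrightarrow> measure (\<Lambda> r) (cyl L M A [0..<k]) = r" by blast
  have "inj_on \<Lambda> {?F p..?F p'}"
    by (rule inj_on_inverseI[where g = "\<lambda>\<mu>. measure \<mu> (cyl L M A [0..<k])"]) (rule \<Lambda>(2))
  then have "{?F p..?F p'} \<lesssim> ?E" using \<Lambda>(1) unfolding lepoll_def by blast
  moreover have "{?F p..?F p'} \<approx> (UNIV :: real set)"
    using p(3) by (simp add: closed_interval_eqpoll_reals)
  ultimately have "(UNIV :: real set) \<lesssim> ?E" by (metis eqpoll_sym lepoll_trans1)
  moreover have "?E \<lesssim> (UNIV :: real set)"
    using invariant_measures_on_orbit_lepoll[OF L M]
    by (rule lepoll_trans[rotated]) (simp add: subset_imp_lepoll)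
  ultimately show ?thesis
    unfolding continuum_many_ergodic_measures_on_orbit_def by (intro lepoll_antisym)
qed

end

theorem theorem1p1:
  fixes L :: "('r, 'f) language" and M :: "('r, 'f) struct"
  assumes "countable_language L" and "M \<in> Str L"
  shows "((\<not> trivial_dcl L M \<and> \<not> highly_homogeneous L M
             \<and> \<not> continuum_many_ergodic_measures_on_orbit L M) \<or>
          (trivial_dcl L M \<and> highly_homogeneous L M
             \<and> \<not> continuum_many_ergodic_measures_on_orbit L M) \<or>
          (trivial_dcl L M \<and> \<not> highly_homogeneous L M
             \<and> continuum_many_ergodic_measures_on_orbit L M)) \<and>
         (\<not> trivial_dcl L M \<longrightarrow> \<not> (\<exists>\<mu>. \<mu> \<in> invariant_measures_on_orbit L M)) \<and>
         (highly_homogeneous L M \<longrightarrow> (\<exists>!\<mu>. \<mu> \<in> invariant_measures_on_orbit L M))"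
proof -
  note LM = assms
  \<comment> \<open>The first two cases leave at most one invariant measure, so finiteness is what
    excludes the third.\<close>
  have few: "\<not> continuum_many_ergodic_measures_on_orbit L M"
    if "finite (invariant_measures_on_orbit L M)"
  proof
    assume "continuum_many_ergodic_measures_on_orbit L M"
    then have "{\<mu> \<in> invariant_measures_on_orbit L M. ergodic L \<mu>} \<approx> (UNIV :: real set)"
      unfolding continuum_many_ergodic_measures_on_orbit_def .
    moreover have "finite {\<mu> \<in> invariant_measures_on_orbit L M. ergodic L \<mu>}" using that by simp
    ultimately show False using eqpoll_finite_iff infinite_UNIV_char_0 by blast
  qed
  have unique: "\<exists>!\<mu>. \<mu> \<in> invariant_measures_on_orbit L M" if hh: "highly_homogeneous L M"
    using ergodic_measure_exists[OF LM highly_homogeneous_imp_trivial_dcl[OF LM hh]]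
      highly_homogeneous_at_most_one[OF LM hh] by blast
  have "\<not> continuum_many_ergodic_measures_on_orbit L M" if hh: "highly_homogeneous L M"
  proof (rule few)
    obtain \<mu> where "\<And>\<nu>. \<nu> \<in> invariant_measures_on_orbit L M \<Longrightarrow> \<nu> = \<mu>" using unique[OF hh] by blast
    then have "invariant_measures_on_orbit L M \<subseteq> {\<mu>}" by blast
    then show "finite (invariant_measures_on_orbit L M)" by (rule finite_subset) simp
  qed
  moreover have none: "invariant_measures_on_orbit L M = {}" if "\<not> trivial_dcl L M"
    using nontrivial_dcl_no_measure[OF LM that] by blast
  moreover have "\<not> continuum_many_ergodic_measures_on_orbit L M" if "\<not> trivial_dcl L M"
    by (rule few) (simp add: none[OF that])
  moreover note highly_homogeneous_imp_trivial_dcl[OF LM] continuum_many[OF LM] unique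
  ultimately show ?thesis by blast
qed

end
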